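(* (1) Let $\Gamma$ be a finitely generated group such that $H^2(\Gamma;\mathbb{Z})$ has a finite type element $x$ of infinite order. Then $\Gamma$ is not local-to-local (matricially) stable. If furthermore $\Gamma$ is hyperbolic, then $\Gamma$ is not uniform-to-local (matricially) stable. (2) Suppose that $\Gamma$ is a hyperbolic group with $\beta,\psi\in H^1(\Gamma,\mathbb{Z})$ such that the cup product $\beta\smile\psi\in H^2(\Gamma,\mathbb{Z})$ is non-torsion. Let $1<p\le\infty$. Then $\Gamma$ is not uniform-to-local stable in the unnormalized Schatten $p$-norm.
   Context: Cohomology has trivial coefficients. An element $x\in H^2(\Lambda;\mathbb{Z})$, $\Lambda$ a countable discrete group, is of finite type if it is the class of a central extension $0\to\mathbb{Z}\xrightarrow{\iota}E\xrightarrow{q}\Lambda\to1$ such that $E$ has a sequence of finite index subgroups $(E_k)_{k\in\mathbb{N}}$ with $\iota(\mathbb{Z})\cap\bigcap_kE_k=\{e\}$. The unnormalized Schatten $p$-norm on $M_n(\mathbb{C})$ is $\|M\|_p=\mathrm{Tr}(|M|^p)^{1/p}$ for $1\le p<\infty$, and $\|\cdot\|_\infty$ is the operator norm. $\Gamma$ is local-to-local (matricially) stable if for any sequence of maps $\rho_n:\Gamma\to U(k_n)$ ($k_n\ge1$ arbitrary) with $\rho_n(e)=1$ and $\lim_n\|\rho_n(st)-\rho_n(s)\rho_n(t)\|=0$ for all $s,t\in\Gamma$ (operator norm), there are group homomorphisms $\pi_n:\Gamma\to U(k_n)$ with $\lim_n\|\rho_n(s)-\pi_n(s)\|=0$ for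 all $s\in\Gamma$. $\Gamma$ is uniform-to-local (matricially) stable if the same conclusion holds for every such sequence satisfying the stronger hypothesis $\lim_n\sup_{s,t\in\Gamma}\|\rho_n(st)-\rho_n(s)\rho_n(t)\|=0$. Uniform-to-local stability in the unnormalized Schatten $p$-norm is defined in the same way as uniform-to-local matricial stability with the operator norm replaced by $\|\cdot\|_p$ (in both hypothesis and conclusion). Hyperbolic means Gromov hyperbolic. *)

theory Defs
  imports
    "HOL-Algebra.Product_Groups"
    "HOL-Algebra.Multiplicative_Group"
    "HOL-Library.Extended_Real"
    "Jordan_Normal_Form.Schur_Decomposition"
begin

section \<open>Group cohomology with trivial integer coefficients\<close>

text \<open>Cohomology of the inhomogeneous bar complex: an \<open>n\<close>-cochain is an integer-valued function of
  \<open>n\<close>-tuples of group elements, tuples being lists of length \<open>n\<close>.\<close>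

definition tuples :: "('a, 'b) monoid_scheme \<Rightarrow> nat \<Rightarrow> 'a list set" where
  "tuples G n = {xs. set xs \<subseteq> carrier G \<and> length xs = n}"

definition cochain_group :: "('a, 'b) monoid_scheme \<Rightarrow> nat \<Rightarrow> ('a list \<Rightarrow> int) monoid" where
  "cochain_group G n = product_group (tuples G n) (\<lambda>_. integer_group)"

text \<open>\<open>merge G i [x\<^sub>0, \<dots>, x\<^sub>n] = [x\<^sub>0, \<dots>, x\<^sub>i \<otimes> x\<^sub>i\<^sub>+\<^sub>1, \<dots>, x\<^sub>n]\<close>\<close>

definition merge :: "('a, 'b) monoid_scheme \<Rightarrow> nat \<Rightarrow> 'a list \<Rightarrow> 'a list" where
  "merge G i xs = take i xs @ [xs ! i \<otimes>\<^bsub>G\<^esub> xs ! Suc i] @ drop (i + 2) xs"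

definition coboundary :: "('a, 'b) monoid_scheme \<Rightarrow> nat \<Rightarrow> ('a list \<Rightarrow> int) \<Rightarrow> 'a list \<Rightarrow> int" where
  "coboundary G n f = (\<lambda>xs \<in> tuples G (Suc n).
     f (tl xs) + (\<Sum>i<n. (- 1) ^ Suc i * f (merge G i xs)) + (- 1) ^ Suc n * f (butlast xs))"

definition cocycles :: "('a, 'b) monoid_scheme \<Rightarrow> nat \<Rightarrow> ('a list \<Rightarrow> int) set" where
  "cocycles G n = kernel (cochain_group G n) (cochain_group G (Suc n)) (coboundary G n)"

definition coboundaries :: "('a, 'b) monoid_scheme \<Rightarrow> nat \<Rightarrow> ('a list \<Rightarrow> int) set" where
  "coboundaries G n =
     (case n of
        0 \<Rightarrow> {\<one>\<^bsub>cochain_group G 0\<^esub>}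
      | Suc m \<Rightarrow> coboundary G m ` carrier (cochain_group G m))"

definition cohomology_group :: "('a, 'b) monoid_scheme \<Rightarrow> nat \<Rightarrow> ('a list \<Rightarrow> int) set monoid" where
  "cohomology_group G n = (cochain_group G n)\<lparr>carrier := cocycles G n\<rparr> Mod coboundaries G n"

definition cohomology_class ::
  "('a, 'b) monoid_scheme \<Rightarrow> nat \<Rightarrow> ('a list \<Rightarrow> int) \<Rightarrow> ('a list \<Rightarrow> int) set" where
  "cohomology_class G n f = coboundaries G n #>\<^bsub>cochain_group G n\<^esub> f"

definition cup_cochain ::
  "('a, 'b) monoid_scheme \<Rightarrow> nat \<Rightarrow> nat \<Rightarrow> ('a list \<Rightarrow> int) \<Rightarrow> ('a list \<Rightarrow> int) \<Rightarrow> 'a list \<Rightarrow> int" where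
  "cup_cochain G m n f g = (\<lambda>xs \<in> tuples G (m + n). f (take m xs) * g (drop m xs))"

text \<open>Elements of a cohomology group are cosets of cocycles. The class of \<open>f \<smile> g\<close> does not depend on
  the representatives, so the union below is the union of equal sets.\<close>

definition cup_product ::
  "('a, 'b) monoid_scheme \<Rightarrow> nat \<Rightarrow> nat \<Rightarrow>
   ('a list \<Rightarrow> int) set \<Rightarrow> ('a list \<Rightarrow> int) set \<Rightarrow> ('a list \<Rightarrow> int) set" where
  "cup_product G m n x y = (\<Union>f\<in>x. \<Union>g\<in>y. cohomology_class G (m + n) (cup_cochain G m n f g))"

section \<open>Central extensions and classes of finite type\<close>

definition central_extension ::
  "('a, 'b) monoid_scheme \<Rightarrow> ('e, 'c) monoid_scheme \<Rightarrow> (int \<Rightarrow> 'e) \<Rightarrow> ('e \<Rightarrow> 'a) \<Rightarrow> bool" where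
  "central_extension G E \<iota> q \<longleftrightarrow>
     group E \<and> \<iota> \<in> mon integer_group E \<and> q \<in> epi E G \<and> range \<iota> = kernel E G q \<and>
     (\<forall>m. \<forall>e \<in> carrier E. \<iota> m \<otimes>\<^bsub>E\<^esub> e = e \<otimes>\<^bsub>E\<^esub> \<iota> m)"

text \<open>The class of an extension is that of the 2-cocycle measuring the failure of a set-theoretic
  section \<open>\<sigma>\<close> of \<open>q\<close> to be multiplicative; it does not depend on \<open>\<sigma>\<close>.\<close>

definition is_extension_class ::
  "('a, 'b) monoid_scheme \<Rightarrow> ('e, 'c) monoid_scheme \<Rightarrow> (int \<Rightarrow> 'e) \<Rightarrow> ('e \<Rightarrow> 'a) \<Rightarrow>
   ('a list \<Rightarrow> int) set \<Rightarrow> bool" where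
  "is_extension_class G E \<iota> q x \<longleftrightarrow>
     (\<exists>\<sigma> c. \<sigma> \<in> carrier G \<rightarrow> carrier E \<and> (\<forall>s \<in> carrier G. q (\<sigma> s) = s) \<and>
        c \<in> carrier (cochain_group G 2) \<and>
        (\<forall>s \<in> carrier G. \<forall>t \<in> carrier G.
           \<sigma> s \<otimes>\<^bsub>E\<^esub> \<sigma> t = \<iota> (c [s, t]) \<otimes>\<^bsub>E\<^esub> \<sigma> (s \<otimes>\<^bsub>G\<^esub> t)) \<and>
        x = cohomology_class G 2 c)"

text \<open>The underlying set of a central extension of \<open>G\<close> by the integers is in bijection with
  \<open>carrier G \<times> \<int>\<close>, so up to isomorphism all of them live on the type \<^typ>\<open>'a \<times> int\<close>.\<close>

definition finite_type_class :: "('a, 'b) monoid_scheme \<Rightarrow> ('a list \<Rightarrow> int) set \<Rightarrow> bool" where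
  "finite_type_class G x \<longleftrightarrow>
     (\<exists>(E :: ('a \<times> int) monoid) \<iota> q F.
        central_extension G E \<iota> q \<and> is_extension_class G E \<iota> q x \<and>
        (\<forall>k :: nat. subgroup (F k) E \<and> finite (rcosets\<^bsub>E\<^esub> (F k))) \<and>
        range \<iota> \<inter> (\<Inter>k. F k) = {\<one>\<^bsub>E\<^esub>})"

section \<open>Finitely generated and hyperbolic groups\<close>

definition finitely_generated_group :: "('a, 'b) monoid_scheme \<Rightarrow> bool" where
  "finitely_generated_group G \<longleftrightarrow>
     (\<exists>S. finite S \<and> S \<subseteq> carrier G \<and> generate G S = carrier G)"

definition word_length :: "('a, 'b) monoid_scheme \<Rightarrow> 'a set \<Rightarrow> 'a \<Rightarrow> nat" where
  "word_length G S g =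
     (LEAST n. \<exists>ws. length ws = n \<and> set ws \<subseteq> S \<union> m_inv G ` S \<and> foldr (\<otimes>\<^bsub>G\<^esub>) ws \<one>\<^bsub>G\<^esub> = g)"

definition word_dist :: "('a, 'b) monoid_scheme \<Rightarrow> 'a set \<Rightarrow> 'a \<Rightarrow> 'a \<Rightarrow> real" where
  "word_dist G S g h = real (word_length G S (inv\<^bsub>G\<^esub> g \<otimes>\<^bsub>G\<^esub> h))"

definition gromov_product :: "('a \<Rightarrow> 'a \<Rightarrow> real) \<Rightarrow> 'a \<Rightarrow> 'a \<Rightarrow> 'a \<Rightarrow> real" where
  "gromov_product d w x y = (d x w + d y w - d x y) / 2"

definition gromov_hyperbolic :: "'a set \<Rightarrow> ('a \<Rightarrow> 'a \<Rightarrow> real) \<Rightarrow> bool" where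
  "gromov_hyperbolic X d \<longleftrightarrow>
     (\<exists>\<delta>. \<forall>w\<in>X. \<forall>x\<in>X. \<forall>y\<in>X. \<forall>z\<in>X.
        gromov_product d w x z \<ge> min (gromov_product d w x y) (gromov_product d w y z) - \<delta>)"

text \<open>The vertices are 1/2-dense in the Cayley graph, so hyperbolicity of the word metric on the
  group is hyperbolicity of the Cayley graph, and it does not depend on \<open>S\<close>.\<close>

definition hyperbolic_group :: "('a, 'b) monoid_scheme \<Rightarrow> bool" where
  "hyperbolic_group G \<longleftrightarrow>
     (\<exists>S. finite S \<and> S \<subseteq> carrier G \<and> generate G S = carrier G \<and>
        gromov_hyperbolic (carrier G) (word_dist G S))"

section \<open>Unitary groups and matrix norms\<close>

definition unitary_group :: "nat \<Rightarrow> complex mat monoid" where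
  "unitary_group k =
     \<lparr>carrier = {U \<in> carrier_mat k k. U * mat_adjoint U = 1\<^sub>m k \<and> mat_adjoint U * U = 1\<^sub>m k},
      monoid.mult = (*), one = 1\<^sub>m k\<rparr>"

definition l2_norm_vec :: "complex vec \<Rightarrow> real" where
  "l2_norm_vec v = sqrt (Re (v \<bullet>c v))"

definition op_norm :: "complex mat \<Rightarrow> real" where
  "op_norm M = (SUP v \<in> {v \<in> carrier_vec (dim_col M). l2_norm_vec v \<le> 1}. l2_norm_vec (M *\<^sub>v v))"

text \<open>Functional calculus \<open>f(A)\<close> for a self-adjoint matrix \<open>A\<close>: by the spectral theorem \<open>A = U D U\<^sup>*\<close>
  with \<open>U\<close> unitary and \<open>D\<close> real diagonal, and \<open>U f(D) U\<^sup>*\<close> depends only on \<open>A\<close>.\<close>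

definition hermitian_fun :: "(real \<Rightarrow> real) \<Rightarrow> complex mat \<Rightarrow> complex mat" where
  "hermitian_fun f A =
     (THE B. \<exists>U \<in> carrier (unitary_group (dim_row A)). \<exists>d :: nat \<Rightarrow> real.
        A = U * mat_diag (dim_row A) (\<lambda>i. complex_of_real (d i)) * mat_adjoint U \<and>
        B = U * mat_diag (dim_row A) (\<lambda>i. complex_of_real (f (d i))) * mat_adjoint U)"

definition mat_abs :: "complex mat \<Rightarrow> complex mat" where
  "mat_abs M = hermitian_fun sqrt (mat_adjoint M * M)"

definition mat_trace :: "complex mat \<Rightarrow> complex" where
  "mat_trace M = (\<Sum>i<dim_row M. M $$ (i, i))"

text \<open>Unnormalized, for \<open>p \<in> [1, \<infinity>]\<close>; the trace is a nonnegative real.\<close>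

definition schatten_norm :: "ereal \<Rightarrow> complex mat \<Rightarrow> real" where
  "schatten_norm p M =
     (if p = \<infinity> then op_norm M
      else Re (mat_trace (hermitian_fun (\<lambda>t. t powr real_of_ereal p) (mat_abs M)))
             powr (1 / real_of_ereal p))"

section \<open>Stability\<close>

definition unital_unitary_maps ::
  "('a, 'b) monoid_scheme \<Rightarrow> (nat \<Rightarrow> nat) \<Rightarrow> (nat \<Rightarrow> 'a \<Rightarrow> complex mat) \<Rightarrow> bool" where
  "unital_unitary_maps G k \<rho> \<longleftrightarrow>
     (\<forall>n. k n \<ge> 1 \<and> \<rho> n \<in> carrier G \<rightarrow> carrier (unitary_group (k n)) \<and> \<rho> n \<one>\<^bsub>G\<^esub> = 1\<^sub>m (k n))"

definition locally_near_hom ::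
  "(complex mat \<Rightarrow> real) \<Rightarrow> ('a, 'b) monoid_scheme \<Rightarrow> (nat \<Rightarrow> nat) \<Rightarrow>
   (nat \<Rightarrow> 'a \<Rightarrow> complex mat) \<Rightarrow> bool" where
  "locally_near_hom N G k \<rho> \<longleftrightarrow>
     (\<exists>\<pi>. (\<forall>n. \<pi> n \<in> hom G (unitary_group (k n))) \<and>
        (\<forall>s \<in> carrier G. (\<lambda>n. N (\<rho> n s - \<pi> n s)) \<longlonglongrightarrow> 0))"

definition local_to_local_stable ::
  "(complex mat \<Rightarrow> real) \<Rightarrow> ('a, 'b) monoid_scheme \<Rightarrow> bool" where
  "local_to_local_stable N G \<longleftrightarrow>
     (\<forall>k \<rho>. unital_unitary_maps G k \<rho> \<and>
        (\<forall>s \<in> carrier G. \<forall>t \<in> carrier G.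
           (\<lambda>n. N (\<rho> n (s \<otimes>\<^bsub>G\<^esub> t) - \<rho> n s * \<rho> n t)) \<longlonglongrightarrow> 0)
        \<longrightarrow> locally_near_hom N G k \<rho>)"

text \<open>On \<open>U(k)\<close> each of the norms above is bounded, so the real-valued supremum is the true one.\<close>

definition uniform_to_local_stable ::
  "(complex mat \<Rightarrow> real) \<Rightarrow> ('a, 'b) monoid_scheme \<Rightarrow> bool" where
  "uniform_to_local_stable N G \<longleftrightarrow>
     (\<forall>k \<rho>. unital_unitary_maps G k \<rho> \<and>
        (\<lambda>n. SUP (s, t) \<in> carrier G \<times> carrier G.
           N (\<rho> n (s \<otimes>\<^bsub>G\<^esub> t) - \<rho> n s * \<rho> n t)) \<longlonglongrightarrow> 0
        \<longrightarrow> locally_near_hom N G k \<rho>)"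

end

theory Submission
  imports "HOL-Analysis.Further_Topology" "Jordan_Normal_Form.Spectral_Radius" Defs
begin

unbundle no vec_syntax
no_notation inner (infixl "\<bullet>" 70)

text \<open>
  Let \<open>E\<close> be a central extension of \<open>\<Gamma>\<close> by \<open>\<iota>(\<int>)\<close> whose class has infinite order. Since \<open>\<Gamma>\<close> is finitely
  generated, some \<open>\<iota> m\<close> with \<open>m \<noteq> 0\<close> is a product of commutators in \<open>E\<close>. A character of a finite index
  subgroup induces a unitary representation \<open>R\<^sub>n\<close> of \<open>E\<close> in which \<open>\<iota> j\<close> acts as the scalar
  \<open>exp (2 \<pi> i j / d\<^sub>n)\<close>, with \<open>d\<^sub>n \<rightarrow> \<infinity>\<close>. Composing \<open>R\<^sub>n\<close> with a section of \<open>E \<rightarrow> \<Gamma>\<close> gives maps that are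
  asymptotically multiplicative, uniformly so if the section has a bounded cocycle. If they were close
  to homomorphisms \<open>\<pi>\<^sub>n\<close>, the trace of \<open>log (R\<^sub>n(x) \<pi>\<^sub>n(x)\<^sup>*)\<close> would be eventually additive in \<open>x \<in> E\<close> and hence
  vanish at \<open>\<iota> m\<close>, where it is a nonzero multiple of \<open>2 \<pi> i m / d\<^sub>n\<close>.

  For hyperbolic \<open>\<Gamma>\<close> a bounded cocycle is found as follows (after Neumann and Reeves). Among the words for \<open>g\<close>, maximize
  the height of the lift to \<open>E\<close> minus a large multiple of the length. Optimal words are local geodesics,
  hence close to geodesics, so the cocycle of this section at \<open>(g, h)\<close> depends, up to a bounded error,
  only on the side of the tripod of \<open>1, g, gh\<close> that ends at \<open>g\<close>, and averaging with the section obtained by minimizing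
  cancels it.
\<close>

section \<open>Bounded cocycles on hyperbolic groups\<close>

text \<open>The trace of a matrix logarithm is replaced by a continuous logarithm of the determinant
  along the segment from 1. This needs only that the determinant has no zero near 1, and additivity
  becomes a lifting argument over a contractible parameter domain. Additivity holds for each fixed
  pair of elements only from some \<open>n\<close> on; that is enough, since
  \<open>\<iota> m\<close> is one fixed finite product of commutators and their inverses.

  The length penalty is what makes a maximum of heights exist at all: it cuts the infinitely many
  words for \<open>g\<close> down to local geodesics, which are finite in number.

  The dimension restricts the norms. The defect of \<open>R n\<close> composed with a section is a
  scalar of size about \<open>1 / D n\<close> times a unitary, and a unitary of size k has Schatten
  norm k^(1/p). For a general finite type class the index of the inducing subgroup is not controlled
  by \<open>D n\<close>, whence the operator norm. For a cup product the extension is a pullback of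
  the Heisenberg group, which has representations of dimension at most n with the central generator
  acting as exp(2 pi i / n); n^(1/p) / n then tends to 0 for p > 1.\<close>

definition letters :: "('a, 'b) monoid_scheme \<Rightarrow> 'a set \<Rightarrow> 'a set" where
  "letters G S = S \<union> m_inv G ` S"

definition wprod :: "('a, 'b) monoid_scheme \<Rightarrow> 'a list \<Rightarrow> 'a" where
  "wprod G ws = foldr (\<otimes>\<^bsub>G\<^esub>) ws \<one>\<^bsub>G\<^esub>"

section \<open>Word metrics of finitely generated groups\<close>

locale word_metric = group G for G :: "('a, 'b) monoid_scheme" (structure) +
  fixes S :: "'a set"
  assumes finS: "finite S" and SG: "S \<subseteq> carrier G" and genS: "generate G S = carrier G"
begin

abbreviation "T \<equiv> letters G S"
abbreviation "P \<equiv> wprod G"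
abbreviation "wl \<equiv> word_length G S"
abbreviation "d \<equiv> word_dist G S"

lemma letters_carrier: "T \<subseteq> carrier G"
  using SG by (auto simp: letters_def)

lemma finite_letters: "finite T"
  using finS by (simp add: letters_def)

lemma letters_inv: "t \<in> T \<Longrightarrow> inv t \<in> T"
  using SG by (auto simp: letters_def)

lemma wprod_Nil [simp]: "P [] = \<one>"
  and wprod_Cons [simp]: "P (x # ws) = x \<otimes> P ws"
  by (simp_all add: wprod_def)

lemma wprod_closed [simp, intro]: "set ws \<subseteq> T \<Longrightarrow> P ws \<in> carrier G"
  by (induction ws) (use letters_carrier in auto)

lemma wprod_append: "set u \<subseteq> T \<Longrightarrow> set v \<subseteq> T \<Longrightarrow> P (u @ v) = P u \<otimes> P v"
  using letters_carrier by (induction u) (auto simp: m_assoc subset_iff)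

lemma word_exists:
  assumes "g \<in> carrier G"
  shows "\<exists>ws. set ws \<subseteq> T \<and> P ws = g"
proof -
  have "g \<in> generate G S" using assms genS by simp
  then show ?thesis
  proof (induction rule: generate.induct)
    case one
    then show ?case by (intro exI[of _ "[]"]) auto
  next
    case (incl h)
    then show ?case using SG by (intro exI[of _ "[h]"]) (auto simp: letters_def)
  next
    case (inv h)
    then show ?case using SG by (intro exI[of _ "[inv h]"]) (auto simp: letters_def)
  next
    case (eng h1 h2)
    then obtain u v where "set u \<subseteq> T" "P u = h1" "set v \<subseteq> T" "P v = h2" by blast
    then show ?case by (intro exI[of _ "u @ v"]) (auto simp: wprod_append)
  qed
qed

lemma wl_alt: "wl g = (LEAST n. \<exists>ws. length ws = n \<and> set ws \<subseteq> T \<and> P ws = g)"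
  by (simp add: word_length_def letters_def wprod_def)

lemma wl_le: "set ws \<subseteq> T \<Longrightarrow> wl (P ws) \<le> length ws"
  unfolding wl_alt by (rule Least_le) auto

lemma geodesic_word:
  assumes "g \<in> carrier G"
  obtains ws where "set ws \<subseteq> T" "P ws = g" "length ws = wl g"
proof -
  have "\<exists>n ws. length ws = n \<and> set ws \<subseteq> T \<and> P ws = g" using word_exists[OF assms] by blast
  from LeastI_ex[OF this] show ?thesis using that unfolding wl_alt by blast
qed

lemma wl_mult: "g \<in> carrier G \<Longrightarrow> h \<in> carrier G \<Longrightarrow> wl (g \<otimes> h) \<le> wl g + wl h"
  by (metis geodesic_word wprod_append wl_le length_append set_append Un_subset_iff)

lemma wl_one [simp]: "wl \<one> = 0"
  using wl_le[of "[]"] by simp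

lemma wprod_rev_inv: "set ws \<subseteq> T \<Longrightarrow> P (rev (map (m_inv G) ws)) = inv (P ws)"
proof (induction ws)
  case (Cons x ws)
  have "set (rev (map (m_inv G) ws)) \<subseteq> T" using Cons.prems letters_inv by auto
  moreover have "set [inv x] \<subseteq> T" using Cons.prems letters_inv by auto
  moreover have "x \<in> carrier G" "P ws \<in> carrier G" using Cons.prems letters_carrier by auto
  ultimately show ?case using Cons wprod_append[of "rev (map (m_inv G) ws)" "[inv x]"]
    by (auto simp: inv_mult_group)
qed auto

lemma wl_inv_le: "g \<in> carrier G \<Longrightarrow> wl (inv g) \<le> wl g"
proof -
  assume g: "g \<in> carrier G"
  obtain ws where ws: "set ws \<subseteq> T" "P ws = g" "length ws = wl g" using geodesic_word[OF g] .
  have "set (rev (map (m_inv G) ws)) \<subseteq> T" using ws letters_inv by auto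
  from wl_le[OF this] show ?thesis using ws by (simp add: wprod_rev_inv)
qed

lemma wl_inv: "g \<in> carrier G \<Longrightarrow> wl (inv g) = wl g"
  using wl_inv_le[of g] wl_inv_le[of "inv g"] by simp

lemma dist_self [simp]: "x \<in> carrier G \<Longrightarrow> d x x = 0"
  by (simp add: word_dist_def)

lemma dist_nonneg: "0 \<le> d x y"
  by (simp add: word_dist_def)

lemma dist_sym: "x \<in> carrier G \<Longrightarrow> y \<in> carrier G \<Longrightarrow> d x y = d y x"
  using wl_inv[of "inv x \<otimes> y"] by (simp add: word_dist_def inv_mult_group)

lemma inv_mult_cancel: "x \<in> carrier G \<Longrightarrow> y \<in> carrier G \<Longrightarrow> z \<in> carrier G \<Longrightarrow>
    (inv x \<otimes> y) \<otimes> (inv y \<otimes> z) = inv x \<otimes> z"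
  by (metis inv_closed m_assoc m_closed r_inv l_one)

lemma dist_triangle: "x \<in> carrier G \<Longrightarrow> y \<in> carrier G \<Longrightarrow> z \<in> carrier G \<Longrightarrow> d x z \<le> d x y + d y z"
  using wl_mult[of "inv x \<otimes> y" "inv y \<otimes> z"]
  by (simp add: word_dist_def inv_mult_cancel flip: of_nat_add)

lemma dist_translate:
  "a \<in> carrier G \<Longrightarrow> x \<in> carrier G \<Longrightarrow> y \<in> carrier G \<Longrightarrow> d (a \<otimes> x) (a \<otimes> y) = d x y"
  by (simp add: word_dist_def inv_mult_group m_assoc inv_solve_left' flip: m_assoc)
    (simp add: m_assoc inv_mult_group)

lemma finite_ball: "finite {g \<in> carrier G. wl g \<le> n}"
proof (rule finite_subset)
  show "{g \<in> carrier G. wl g \<le> n} \<subseteq> P ` {ws. set ws \<subseteq> T \<and> length ws \<le> n}"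
    by (auto simp: image_iff) (metis geodesic_word)
  show "finite (P ` {ws. set ws \<subseteq> T \<and> length ws \<le> n})"
    by (intro finite_imageI finite_lists_length_le finite_letters)
qed

lemma dist_prefix:
  assumes "set u \<subseteq> T" "set v \<subseteq> T"
  shows "d (P u) (P (u @ v)) \<le> length v"
proof -
  have "inv (P u) \<otimes> P (u @ v) = P v" using assms
    by (simp add: wprod_append flip: m_assoc)
  then show ?thesis using wl_le[OF assms(2)] by (simp add: word_dist_def)
qed

end

section \<open>Local geodesics in a hyperbolic word metric\<close>

lemma split_last:
  assumes "m \<le> length a"
  obtains a' v where "a = a' @ v" "length v = m"
  using that[of "take (length a - m) a" "drop (length a - m) a"] assms by simp

lemma split_first:
  assumes "m \<le> length a"
  obtains v a' where "a = v @ a'" "length v = m"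
  using that[of "take m a" "drop m a"] assms by simp

locale hyperbolic_metric = word_metric +
  fixes \<delta> :: real
  assumes delta_nonneg: "0 \<le> \<delta>"
    and four_point: "\<lbrakk>w \<in> carrier G; x \<in> carrier G; y \<in> carrier G; z \<in> carrier G\<rbrakk> \<Longrightarrow>
      min (gromov_product d w x y) (gromov_product d w y z) - \<delta> \<le> gromov_product d w x z"
begin

text \<open>The block length. In \<open>defect_le\<close> the number \<open>M - \<delta>\<close>
  must exceed \<open>2 * \<delta>\<close>, hence \<open>M > 3 * \<delta>\<close>; the two inductions
  before it use only \<open>M > 2 * \<delta>\<close>. The summand 2 leaves room for a gain of at
  least 1 per block in \<open>local_geodesic_length_less\<close>.\<close>

definition scale :: nat where "scale = nat \<lceil>3 * \<delta>\<rceil> + 2"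

abbreviation "M \<equiv> scale"
abbreviation "gp \<equiv> gromov_product d"

lemma scale_ge: "real M \<ge> 3 * \<delta> + 2"
  unfolding scale_def by linarith

lemma scale_pos: "0 < M"
  by (simp add: scale_def)

text \<open>A window of length \<open>2 * M\<close> holds two adjacent blocks of length
  \<open>M\<close>, so that no defect arises between consecutive blocks.\<close>

definition local_geodesic :: "'a list \<Rightarrow> bool" where
  "local_geodesic w \<longleftrightarrow> set w \<subseteq> T \<and>
     (\<forall>a u b. w = a @ u @ b \<longrightarrow> length u \<le> 2 * M \<longrightarrow> length u = wl (P u))"

lemma local_geodesic_letters: "local_geodesic w \<Longrightarrow> set w \<subseteq> T"
  by (simp add: local_geodesic_def)

lemma local_geodesic_subword: "local_geodesic (a @ u @ b) \<Longrightarrow> local_geodesic u"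
  unfolding local_geodesic_def by (metis append.assoc set_append Un_subset_iff)

lemma local_geodesic_prefix: "local_geodesic (a @ u) \<Longrightarrow> local_geodesic a"
  using local_geodesic_subword[of "[]" a u] by simp

lemma local_geodesic_suffix: "local_geodesic (a @ u) \<Longrightarrow> local_geodesic u"
  using local_geodesic_subword[of a u "[]"] by simp

lemma local_geodesic_length: "local_geodesic u \<Longrightarrow> length u \<le> 2 * M \<Longrightarrow> wl (P u) = length u"
  unfolding local_geodesic_def by (metis append_Nil append_Nil2)

lemma dist_word: "set a \<subseteq> T \<Longrightarrow> set u \<subseteq> T \<Longrightarrow> d (P a) (P (a @ u)) = wl (P u)"
  by (simp add: word_dist_def wprod_append flip: m_assoc)

lemma dist_one: "x \<in> carrier G \<Longrightarrow> d \<one> x = wl x"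
  by (simp add: word_dist_def)

lemma gp_sym: "\<lbrakk>w \<in> carrier G; x \<in> carrier G; y \<in> carrier G\<rbrakk> \<Longrightarrow> gp w x y = gp w y x"
  by (simp add: gromov_product_def dist_sym add.commute)

lemma gp_translate:
  "\<lbrakk>a \<in> carrier G; w \<in> carrier G; x \<in> carrier G; y \<in> carrier G\<rbrakk> \<Longrightarrow>
    gp (a \<otimes> w) (a \<otimes> x) (a \<otimes> y) = gp w x y"
  by (simp add: gromov_product_def dist_translate)

text \<open>The Gromov product at \<open>P a\<close> of the ends of the path \<open>a @ u\<close>.\<close>

definition defect :: "'a list \<Rightarrow> 'a list \<Rightarrow> real" where
  "defect a u = (real (wl (P a)) + real (wl (P u)) - real (wl (P (a @ u)))) / 2"

lemma gp_word:
  assumes "set a \<subseteq> T" "set u \<subseteq> T"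
  shows "gp (P a) \<one> (P (a @ u)) = defect a u"
  using assms dist_word[OF assms] dist_sym[of "P (a @ u)" "P a"]
  by (simp add: gromov_product_def defect_def dist_one)

lemma gp_three_words:
  assumes "set a \<subseteq> T" "set u \<subseteq> T" "set v \<subseteq> T"
  shows "gp (P (a @ u)) (P a) (P (a @ u @ v)) = defect u v"
proof -
  have "P a \<otimes> \<one> = P a" "P (a @ u) = P a \<otimes> P u" "P (a @ u @ v) = P a \<otimes> P (u @ v)"
    using assms wprod_append[of a u] wprod_append[of a "u @ v"] by auto
  then show ?thesis
    using gp_translate[of "P a" "P u" \<one> "P (u @ v)"] gp_word[of u v] assms by auto
qed

lemma gp_first:
  assumes "set u \<subseteq> T" "set v \<subseteq> T"
  shows "gp \<one> (P u) (P (u @ v)) = real (wl (P u)) - defect u v"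
  using assms dist_word[of u v]
  by (simp add: gromov_product_def defect_def dist_one dist_sym[of _ \<one>] field_simps)

lemma gp_at:
  assumes "set a \<subseteq> T" "set u \<subseteq> T" "set v \<subseteq> T"
  shows "gp (P a) (P (a @ u)) (P (a @ u @ v)) = real (wl (P u)) - defect u v"
proof -
  have "P a \<otimes> \<one> = P a" "P (a @ u) = P a \<otimes> P u" "P (a @ u @ v) = P a \<otimes> P (u @ v)"
    using assms wprod_append[of a u] wprod_append[of a "u @ v"] by auto
  then show ?thesis
    using gp_translate[of "P a" \<one> "P u" "P (u @ v)"] gp_first[of u v] assms by auto
qed

lemma gp_last:
  assumes "set u \<subseteq> T" "set v \<subseteq> T"
  shows "gp (P (u @ v)) \<one> (P u) = real (wl (P v)) - defect u v"
  using assms dist_word[of u v]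
  by (simp add: gromov_product_def defect_def dist_one field_simps)

lemma defect_geodesic:
  assumes "local_geodesic (a @ u)" "length (a @ u) \<le> 2 * M"
  shows "defect a u = 0"
  using assms local_geodesic_length[of a] local_geodesic_length[of u] local_geodesic_length[of "a @ u"]
    local_geodesic_prefix[of a u] local_geodesic_suffix[of a u]
  by (simp add: defect_def)

text \<open>The four-point condition based at the end of \<open>a @ u\<close>. If \<open>u\<close>
  is long and \<open>defect a u\<close> and \<open>defect u v\<close> are small, only the second
  term can be the minimum, so starting the path earlier, with \<open>a\<close>, raises the defect
  there by at most \<delta>.\<close>

lemma four_point_words:
  assumes "set a \<subseteq> T" "set u \<subseteq> T" "set v \<subseteq> T"
  shows "min (real (wl (P u)) - defect a u) (defect (a @ u) v) - \<delta> \<le> defect u v"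
proof -
  have "min (gp (P (a @ u)) (P a) \<one>) (gp (P (a @ u)) \<one> (P (a @ u @ v))) - \<delta>
     \<le> gp (P (a @ u)) (P a) (P (a @ u @ v))"
    using assms by (intro four_point) auto
  then show ?thesis
    using assms gp_last[of a u] gp_word[of "a @ u" v] gp_three_words[of a u v]
      gp_sym[of "P (a @ u)" "P a" \<one>] by simp
qed

text \<open>The mirror image, based at \<open>P a\<close>: prolonging the path beyond a long
  \<open>u\<close> raises the defect at the start of \<open>u\<close> by at most \<delta>.\<close>

lemma four_point_words':
  assumes "set a \<subseteq> T" "set u \<subseteq> T" "set v \<subseteq> T"
  shows "min (defect a (u @ v)) (real (wl (P u)) - defect u v) - \<delta> \<le> defect a u"
proof -
  have "min (gp (P a) \<one> (P (a @ u @ v))) (gp (P a) (P (a @ u @ v)) (P (a @ u))) - \<delta>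
     \<le> gp (P a) \<one> (P (a @ u))"
    using assms by (intro four_point) auto
  then show ?thesis
    using assms gp_word[of a "u @ v"] gp_word[of a u] gp_at[of a u v]
      gp_sym[of "P a" "P (a @ u @ v)" "P (a @ u)"] by simp
qed

text \<open>Induction by blocks: split off the last block \<open>v\<close> of \<open>a\<close>. Then
  \<open>v @ u\<close> fits into a window, so \<open>defect v u = 0\<close>, while
  \<open>defect a' v\<close> is small by induction. \<open>four_point_words\<close> transfers the
  value 0 to \<open>defect a u\<close> at the cost of one \<delta>; the errors do not add up along
  the word.\<close>

lemma defect_end:
  assumes "local_geodesic (a @ u)" "length u \<le> M"
  shows "defect a u \<le> \<delta>"
  using assms
proof (induction "length a" arbitrary: a u rule: less_induct)
  case less
  show ?case
  proof (cases "length a \<le> M")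
    case True
    then show ?thesis using defect_geodesic[of a u] less.prems delta_nonneg by simp
  next
    case False
    then obtain a' v where a: "a = a' @ v" "length v = M"
      by (metis linear split_last)
    have lg: "local_geodesic (a' @ v)" "local_geodesic (v @ u)" "local_geodesic v"
      using less.prems a local_geodesic_prefix local_geodesic_suffix by (metis append.assoc)+
    have "defect a' v \<le> \<delta>" using a lg scale_pos by (intro less.hyps) auto
    moreover have "defect v u = 0" using defect_geodesic lg a less.prems by simp
    moreover have "wl (P v) = M" using local_geodesic_length[of v] lg a by simp
    moreover have "min (real (wl (P v)) - defect a' v) (defect (a' @ v) u) - \<delta> \<le> defect v u"
      using lg[THEN local_geodesic_letters] by (intro four_point_words) auto
    ultimately show ?thesis using scale_ge delta_nonneg a by auto
  qed
qed

lemma defect_start: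
  assumes "local_geodesic (u @ b)" "length u = M"
  shows "defect u b \<le> \<delta>"
  using assms
proof (induction "length b" arbitrary: b u rule: less_induct)
  case less
  show ?case
  proof (cases "length b \<le> M")
    case True
    then show ?thesis using defect_geodesic[of u b] less.prems delta_nonneg by simp
  next
    case False
    then obtain v b' where b: "b = v @ b'" "length v = M"
      by (metis linear split_first)
    have lg: "local_geodesic (v @ b')" "local_geodesic (u @ v)" "local_geodesic v"
      using less.prems b local_geodesic_prefix local_geodesic_suffix by (metis append.assoc)+
    have "defect v b' \<le> \<delta>" using b lg scale_pos by (intro less.hyps) auto
    moreover have "defect u v = 0" using defect_geodesic lg b less.prems by simp
    moreover have "wl (P v) = M" using local_geodesic_length[of v] lg b by simp
    moreover have "min (defect u (v @ b')) (real (wl (P v)) - defect v b') - \<delta> \<le> defect u v"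
      using lg[THEN local_geodesic_letters] by (intro four_point_words') auto
    ultimately show ?thesis using scale_ge delta_nonneg b by auto
  qed
qed

text \<open>Every vertex of a local geodesic is almost on a geodesic between its ends. Both ends of
  the first block of \<open>b\<close> have defect at most \<delta>, by \<open>defect_end\<close> and
  \<open>defect_start\<close>, and prolonging the path beyond this block costs one more
  \<delta>.\<close>

lemma defect_le:
  assumes "local_geodesic (a @ b)"
  shows "defect a b \<le> 2 * \<delta>"
proof (cases "length b \<le> M")
  case True
  then show ?thesis using defect_end[OF assms] delta_nonneg by simp
next
  case False
  then obtain u b' where b: "b = u @ b'" "length u = M"
    by (metis linear split_first)
  have lg: "local_geodesic (u @ b')" "local_geodesic (a @ u)" "local_geodesic u"
    using assms b local_geodesic_prefix local_geodesic_suffix by (metis append.assoc)+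
  have "defect u b' \<le> \<delta>" using b lg by (intro defect_start) auto
  moreover have "defect a u \<le> \<delta>" using defect_end lg b by simp
  moreover have "wl (P u) = M" using local_geodesic_length[of u] lg b by simp
  moreover have "min (defect a (u @ b')) (real (wl (P u)) - defect u b') - \<delta> \<le> defect a u"
    using lg[THEN local_geodesic_letters] by (intro four_point_words') auto
  ultimately show ?thesis using scale_ge delta_nonneg b by auto
qed

text \<open>The last block of length \<open>M\<close> has defect at most \<delta> and so moves the
  endpoint away from 1 by at least one unit. Consequently each element is represented by finitely
  many local geodesics, and \<open>best\<close> below is a maximum over a finite set.\<close>

lemma local_geodesic_length_less:
  "local_geodesic w \<Longrightarrow> length w < M * (wl (P w) + 1)"
proof (induction "length w" arbitrary: w rule: less_induct)
  case less
  show ?case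
  proof (cases "length w < M")
    case False
    then obtain a u where w: "w = a @ u" "length u = M"
      by (metis linorder_not_less split_last)
    have lg: "local_geodesic a" "local_geodesic u"
      using less.prems w local_geodesic_prefix local_geodesic_suffix by blast+
    have "length a < M * (wl (P a) + 1)" using less.hyps[of a] w lg scale_pos by simp
    moreover have "wl (P a) + 1 \<le> wl (P w)"
      using defect_end[of a u] less.prems w local_geodesic_length[of u] lg scale_ge delta_nonneg
      by (simp add: defect_def)
    ultimately have "length w < M * (wl (P a) + 1) + M" "M * (wl (P a) + 1) + M \<le> M * (wl (P w) + 1)"
      using w mult_le_mono2[of "wl (P a) + 1 + 1" "wl (P w) + 1" M] by simp_all
    then show ?thesis by linarith
  qed simp
qed

text \<open>The length bound puts \<open>w\<close> inside one window, where it is geodesic.\<close>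

lemma local_geodesic_trivial: "local_geodesic w \<Longrightarrow> P w = \<one> \<Longrightarrow> w = []"
  using local_geodesic_length_less[of w] local_geodesic_length[of w] by simp

lemma finite_local_geodesics: "finite {w. local_geodesic w \<and> P w = g}"
proof (rule finite_subset)
  show "{w. local_geodesic w \<and> P w = g} \<subseteq> {w. set w \<subseteq> T \<and> length w \<le> M * (wl g + 1)}"
    using local_geodesic_length_less by (auto dest: local_geodesic_letters less_imp_le)
  show "finite {w. set w \<subseteq> T \<and> length w \<le> M * (wl g + 1)}"
    by (intro finite_lists_length_le finite_letters)
qed

end

section \<open>Integer 2-cocycles and words of maximal score\<close>

lemma discrete_ivt:
  fixes f :: "nat \<Rightarrow> nat"
  assumes "f 0 \<le> m" "m \<le> f n" "\<And>i. i < n \<Longrightarrow> f (Suc i) \<le> f i + 1"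
  shows "\<exists>i\<le>n. f i = m"
  using assms
proof (induction n)
  case (Suc n)
  show ?case
  proof (cases "m \<le> f n")
    case True
    then show ?thesis using Suc by (metis le_Suc_eq less_Suc_eq)
  next
    case False
    then show ?thesis using Suc.prems(2) Suc.prems(3)[of n] by (intro exI[of _ "Suc n"]) auto
  qed
qed auto

definition int_cocycle :: "('a, 'b) monoid_scheme \<Rightarrow> ('a \<Rightarrow> 'a \<Rightarrow> int) \<Rightarrow> bool" where
  "int_cocycle G c \<longleftrightarrow> (\<forall>g\<in>carrier G. \<forall>h\<in>carrier G. \<forall>k\<in>carrier G.
     c g h + c (g \<otimes>\<^bsub>G\<^esub> h) k = c h k + c g (h \<otimes>\<^bsub>G\<^esub> k))"

lemma int_cocycleD:
  "\<lbrakk>int_cocycle G c; g \<in> carrier G; h \<in> carrier G; k \<in> carrier G\<rbrakk> \<Longrightarrow>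
    c g h + c (g \<otimes>\<^bsub>G\<^esub> h) k = c h k + c g (h \<otimes>\<^bsub>G\<^esub> k)"
  by (simp add: int_cocycle_def)

context group
begin

lemma inv_mult_left: "g \<in> carrier G \<Longrightarrow> h \<in> carrier G \<Longrightarrow> inv g \<otimes> (g \<otimes> h) = h"
  and mult_inv_left: "g \<in> carrier G \<Longrightarrow> h \<in> carrier G \<Longrightarrow> g \<otimes> (inv g \<otimes> h) = h"
  by (simp_all flip: m_assoc)

lemma int_cocycle_one_left:
  "int_cocycle G c \<Longrightarrow> k \<in> carrier G \<Longrightarrow> c \<one> k = c \<one> \<one>"
  using int_cocycleD[of G c \<one> \<one> k] by simp

lemma int_cocycle_one_right:
  "int_cocycle G c \<Longrightarrow> k \<in> carrier G \<Longrightarrow> c k \<one> = c \<one> \<one>"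
  using int_cocycleD[of G c k \<one> \<one>] by simp

text \<open>For a nonnegative cocycle this bounds \<open>c g h\<close> by
  \<open>c g (inv g)\<close>, uniformly in \<open>h\<close>; the bounds on \<open>excess\<close>
  come from here.\<close>

lemma int_cocycle_inverse:
  assumes "int_cocycle G c" "c \<one> \<one> = 0" "g \<in> carrier G" "h \<in> carrier G"
  shows "c g h + c (inv g) (g \<otimes> h) = c g (inv g)"
proof -
  have "c (inv g) g + c (inv g \<otimes> g) h = c g h + c (inv g) (g \<otimes> h)"
    "c g (inv g) + c (g \<otimes> inv g) g = c (inv g) g + c g (inv g \<otimes> g)"
    using int_cocycleD[OF assms(1), of "inv g" g h] int_cocycleD[OF assms(1), of g "inv g" g] assms(3,4)
    by simp_all
  then show ?thesis
    using int_cocycle_one_left[OF assms(1)] int_cocycle_one_right[OF assms(1)] assms(2-4) by simp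
qed

end

locale hyperbolic_cocycle = hyperbolic_metric +
  fixes c :: "'a \<Rightarrow> 'a \<Rightarrow> int"
  assumes cocycle: "int_cocycle G c" and c_one: "c \<one> \<one> = 0"
begin

lemma c_one_left [simp]: "g \<in> carrier G \<Longrightarrow> c \<one> g = 0"
  and c_one_right [simp]: "g \<in> carrier G \<Longrightarrow> c g \<one> = 0"
  using int_cocycle_one_left[OF cocycle] int_cocycle_one_right[OF cocycle] c_one by auto

text \<open>The product of the lifts of the letters of \<open>w\<close> to the central extension is the lift of \<open>P w\<close>
  shifted by \<open>height w\<close>.\<close>

primrec height :: "'a list \<Rightarrow> int" where
  "height [] = 0"
| "height (x # w) = height w + c x (P w)"

lemma height_append:
  "set u \<subseteq> T \<Longrightarrow> set v \<subseteq> T \<Longrightarrow> height (u @ v) = height u + height v + c (P u) (P v)"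
proof (induction u)
  case (Cons x u)
  then have "c x (P u) + c (x \<otimes> P u) (P v) = c (P u) (P v) + c x (P u \<otimes> P v)"
    using letters_carrier by (intro int_cocycleD[OF cocycle]) auto
  with Cons show ?case by (simp add: wprod_append)
qed simp

text \<open>Twice the maximal absolute height bounds the difference of any two heights within a
  window, so a single saved letter pays for any change of height. The maximum exists because the
  alphabet is finite.\<close>

definition penalty :: int where
  "penalty = 2 * Max ((\<lambda>u. \<bar>height u\<bar>) ` {u. set u \<subseteq> T \<and> length u \<le> 2 * M})"

lemma height_diff_le:
  assumes "set u \<subseteq> T" "length u \<le> 2 * M" "set v \<subseteq> T" "length v \<le> 2 * M"
  shows "height u - height v \<le> penalty"
proof -
  have "finite {u. set u \<subseteq> T \<and> length u \<le> 2 * M}"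
    by (intro finite_lists_length_le finite_letters)
  then have "\<bar>height u\<bar> \<le> Max ((\<lambda>u. \<bar>height u\<bar>) ` {u. set u \<subseteq> T \<and> length u \<le> 2 * M})"
    "\<bar>height v\<bar> \<le> Max ((\<lambda>u. \<bar>height u\<bar>) ` {u. set u \<subseteq> T \<and> length u \<le> 2 * M})"
    using assms by (auto intro!: Max_ge)
  then show ?thesis unfolding penalty_def by linarith
qed

lemma penalty_nonneg: "0 \<le> penalty"
  using height_diff_le[of "[]" "[]"] by simp

definition score :: "'a list \<Rightarrow> int" where
  "score w = height w - penalty * int (length w)"

lemma score_append:
  "set u \<subseteq> T \<Longrightarrow> set v \<subseteq> T \<Longrightarrow> score (u @ v) = score u + score v + c (P u) (P v)"
  by (simp add: score_def height_append algebra_simps)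

text \<open>Replacing a non-geodesic subword of length at most \<open>2 * M\<close> by a geodesic one shortens the word,
  and the penalty outweighs the change of height.\<close>

lemma score_improve:
  "set w \<subseteq> T \<Longrightarrow> \<exists>w'. local_geodesic w' \<and> P w' = P w \<and> score w \<le> score w'"
proof (induction "length w" arbitrary: w rule: less_induct)
  case less
  show ?case
  proof (cases "local_geodesic w")
    case False
    then obtain a u b where w: "w = a @ u @ b" "length u \<le> 2 * M" "length u \<noteq> wl (P u)"
      using less.prems unfolding local_geodesic_def by blast
    have sets: "set a \<subseteq> T" "set u \<subseteq> T" "set b \<subseteq> T" using less.prems w by auto
    obtain u' where u': "set u' \<subseteq> T" "P u' = P u" "length u' = wl (P u)"
      using geodesic_word[of "P u"] sets by blast
    have lt: "length u' < length u" using wl_le[of u] sets u' w by simp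
    then have "length (a @ u' @ b) < length w" using w by simp
    moreover have "set (a @ u' @ b) \<subseteq> T" using sets u' by simp
    ultimately obtain w' where w': "local_geodesic w'" "P w' = P (a @ u' @ b)"
      "score (a @ u' @ b) \<le> score w'"
      using less.hyps by blast
    have "P (a @ u' @ b) = P w" using sets u' w wprod_append[of a "u' @ b"] wprod_append[of a "u @ b"]
      wprod_append[of u b] wprod_append[of u' b] by simp
    moreover have "score w \<le> score (a @ u' @ b)"
    proof -
      have "penalty * (int (length u) - int (length u')) \<ge> penalty * 1"
        using lt penalty_nonneg by (intro mult_left_mono) auto
      moreover have "height u - height u' \<le> penalty"
        using sets u' w lt by (intro height_diff_le) auto
      ultimately have "score u \<le> score u'" by (simp add: score_def algebra_simps)
      then show ?thesis using sets u' w score_append[of a "u' @ b"] score_append[of a "u @ b"]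
        score_append[of u b] score_append[of u' b] wprod_append[of u b] wprod_append[of u' b] by simp
    qed
    ultimately show ?thesis using w' by auto
  qed auto
qed

text \<open>The maximum runs over local geodesics to be taken over a finite set; by
  \<open>score_improve\<close> it nevertheless bounds the score of every word for
  \<open>g\<close>.\<close>

definition best :: "'a \<Rightarrow> int" where
  "best g = Max (score ` {w. local_geodesic w \<and> P w = g})"

lemma best_attained:
  assumes "g \<in> carrier G"
  obtains w where "local_geodesic w" "P w = g" "score w = best g"
proof -
  obtain w where "set w \<subseteq> T" "P w = g" using word_exists[OF assms] by blast
  then have "{w. local_geodesic w \<and> P w = g} \<noteq> {}" using score_improve by blast
  then have "best g \<in> score ` {w. local_geodesic w \<and> P w = g}"
    unfolding best_def using finite_local_geodesics by (intro Max_in) auto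
  then show ?thesis using that by auto
qed

lemma score_le_best: "set w \<subseteq> T \<Longrightarrow> score w \<le> best (P w)"
proof -
  assume "set w \<subseteq> T"
  then obtain w' where w': "local_geodesic w'" "P w' = P w" "score w \<le> score w'"
    using score_improve by blast
  have "score w' \<le> best (P w)"
    unfolding best_def using finite_local_geodesics w' by (intro Max_ge) auto
  with w' show ?thesis by simp
qed

lemma best_one: "best \<one> = 0"
proof -
  obtain w where w: "local_geodesic w" "P w = \<one>" "score w = best \<one>"
    using best_attained by blast
  then have "w = []" using local_geodesic_trivial by blast
  then show ?thesis using w by (simp add: score_def)
qed

text \<open>Minus the cocycle obtained from \<open>c\<close> by shifting the section by
  \<open>best\<close>. With this sign it is nonnegative: concatenated optimal words compete for the
  product.\<close>

definition excess :: "'a \<Rightarrow> 'a \<Rightarrow> int" where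
  "excess g h = best (g \<otimes> h) - best g - best h - c g h"

lemma excess_cocycle: "int_cocycle G excess"
  unfolding int_cocycle_def
proof (intro ballI)
  fix g h k assume "g \<in> carrier G" "h \<in> carrier G" "k \<in> carrier G"
  then show "excess g h + excess (g \<otimes> h) k = excess h k + excess g (h \<otimes> k)"
    using int_cocycleD[OF cocycle, of g h k] by (simp add: excess_def m_assoc)
qed

lemma excess_one [simp]: "g \<in> carrier G \<Longrightarrow> excess \<one> g = 0"
  by (simp add: excess_def best_one)

lemma excess_nonneg:
  assumes "g \<in> carrier G" "h \<in> carrier G"
  shows "0 \<le> excess g h"
proof -
  obtain u v where "local_geodesic u" "P u = g" "score u = best g"
    "local_geodesic v" "P v = h" "score v = best h"
    using best_attained assms by metis
  then show ?thesis
    using score_le_best[of "u @ v"] score_append[of u v] wprod_append[of u v]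
    by (simp add: excess_def local_geodesic_letters)
qed

text \<open>If a piece of an optimal word could be improved, so could the whole word; hence both
  pieces are optimal and their scores add up without loss.\<close>

lemma excess_optimal:
  assumes "local_geodesic (u @ v)" "score (u @ v) = best (P (u @ v))"
  shows "excess (P u) (P v) = 0"
proof -
  have "set u \<subseteq> T" "set v \<subseteq> T" using local_geodesic_letters[OF assms(1)] by auto
  then show ?thesis using assms(2) score_append[of u v] score_le_best[of u] score_le_best[of v]
    excess_nonneg[of "P u" "P v"] wprod_append[of u v] by (simp add: excess_def)
qed

text \<open>By the four-point condition at \<open>p\<close>, the point \<open>z\<close> has Gromov
  product at most \<open>a + \<delta>\<close> with \<open>x\<close> or with \<open>y\<close>. In
  either case \<open>p\<close> and \<open>z\<close> lie nearly on one geodesic and at nearly equal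
  distance from \<open>x\<close>, which forces them together.\<close>

lemma near_geodesic_close:
  assumes "x \<in> carrier G" "y \<in> carrier G" "p \<in> carrier G" "z \<in> carrier G"
    and "gp p x y \<le> a" "gp z x y \<le> b" "\<bar>d x p - d x z\<bar> \<le> e"
  shows "d p z \<le> 2 * a + 2 * b + e + 2 * \<delta>"
proof -
  have tri: "d x y \<le> d x p + d p y" using assms(1-4) by (intro dist_triangle)
  have sym: "d p x = d x p" "d y p = d p y" "d z p = d p z" "d z x = d x z" "d y z = d z y"
    using assms(1-4) by (simp_all add: dist_sym)
  have "gp p x z \<le> a + \<delta> \<or> gp p z y \<le> a + \<delta>"
    using four_point[of p x z y] assms(1-5) by linarith
  then have alt: "d x p + d p z - d x z \<le> 2 * (a + \<delta>) \<or> d p z + d p y - d z y \<le> 2 * (a + \<delta>)"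
    by (auto simp: gromov_product_def sym field_simps)
  have b: "d x z + d z y - d x y \<le> 2 * b" "0 \<le> b"
    using assms(6) dist_triangle[of x z y] assms(1-4) by (simp_all add: gromov_product_def sym)
  have abs: "d x p - d x z \<le> e" "d x z - d x p \<le> e" using assms(7) by auto
  from alt show ?thesis
  proof
    assume "d x p + d p z - d x z \<le> 2 * (a + \<delta>)"
    then show ?thesis using abs b by argo
  next
    assume "d p z + d p y - d z y \<le> 2 * (a + \<delta>)"
    then show ?thesis using abs b tri by argo
  qed
qed

lemma wl_prefix_step:
  assumes "set w \<subseteq> T" "i < length w"
  shows "wl (P (take (Suc i) w)) \<le> wl (P (take i w)) + 1"
proof -
  have s: "set (take i w) \<subseteq> T" "set [w ! i] \<subseteq> T" using assms set_take_subset[of i w] by auto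
  have "take (Suc i) w = take i w @ [w ! i]" using assms by (simp add: take_Suc_conv_app_nth)
  then have "P (take (Suc i) w) = P (take i w) \<otimes> P [w ! i]" using wprod_append[OF s] by simp
  then have "wl (P (take (Suc i) w)) \<le> wl (P (take i w)) + wl (P [w ! i])"
    using wl_mult[of "P (take i w)" "P [w ! i]"] wprod_closed[OF s(1)] wprod_closed[OF s(2)] by simp
  then show ?thesis using wl_le[OF s(2)] by simp
qed

lemma near_local_geodesic:
  assumes w: "local_geodesic w" and p: "p \<in> carrier G" and gp: "gp p \<one> (P w) \<le> a"
  obtains u v where "w = u @ v" "d p (P u) \<le> 4 * a + 6 * \<delta>"
proof -
  have sw: "set w \<subseteq> T" using w by (rule local_geodesic_letters)
  have a0: "0 \<le> a" using gp dist_triangle[of \<one> p "P w"] dist_sym[of p \<one>] dist_sym[of p "P w"] p sw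
    by (simp add: gromov_product_def)
  \<comment> \<open>The distance from 1 grows by at most one per letter, so some prefix ends exactly
    as far from 1 as \<open>p\<close>. If \<open>p\<close> is farther away than the endpoint, the
    full distance is taken instead; the difference is then at most \<open>2 * a\<close>.\<close>
  have "\<exists>i\<le>length w. wl (P (take i w)) = min (wl p) (wl (P w))"
    using wl_prefix_step[OF sw] by (intro discrete_ivt) auto
  then obtain i where i: "i \<le> length w" "wl (P (take i w)) = min (wl p) (wl (P w))" by blast
  define u where "u = take i w"
  have uv: "w = u @ drop i w" by (simp add: u_def)
  have su: "set u \<subseteq> T" "set (drop i w) \<subseteq> T" using sw set_take_subset[of i w] set_drop_subset[of i w]
    by (auto simp: u_def)
  have "real (wl p) \<le> wl (P w) + 2 * a"
    using gp dist_nonneg[of p "P w"] p sw dist_sym[of p \<one>] dist_sym[of p "P w"]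
    by (simp add: gromov_product_def dist_one)
  then have "\<bar>d \<one> p - d \<one> (P u)\<bar> \<le> 2 * a"
    using i a0 p su by (simp add: dist_one u_def[symmetric] min_def)
  moreover have "gp (P u) \<one> (P w) \<le> 2 * \<delta>"
    using gp_word[OF su] defect_le[of u "drop i w"] w uv by metis
  ultimately have "d p (P u) \<le> 2 * a + 2 * (2 * \<delta>) + 2 * a + 2 * \<delta>"
    using gp p sw su by (intro near_geodesic_close) auto
  then show ?thesis using that[OF uv] by simp
qed

text \<open>By \<open>int_cocycle_inverse\<close>, the value \<open>excess t (inv t)\<close> bounds
  \<open>excess t m\<close> for all \<open>m\<close> at once, so finitely many values control a
  whole ball of first arguments.\<close>

definition ball_bound :: "real \<Rightarrow> int" where
  "ball_bound r = Max ((\<lambda>t. excess t (inv t)) ` {t \<in> carrier G. wl t \<le> nat \<lceil>r\<rceil>})"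

lemma excess_ball: "t \<in> carrier G \<Longrightarrow> real (wl t) \<le> r \<Longrightarrow> excess t (inv t) \<le> ball_bound r"
proof -
  assume t: "t \<in> carrier G" "real (wl t) \<le> r"
  then have "wl t \<le> nat \<lceil>r\<rceil>" by linarith
  with t show ?thesis unfolding ball_bound_def using finite_ball by (intro Max_ge) auto
qed

lemma excess_one_one: "excess \<one> \<one> = 0"
  by simp

text \<open>An optimal word for \<open>p \<otimes> m\<close> passes near \<open>p\<close>, say
  through \<open>P u\<close>, and splits there with excess 0. Moving the splitting point from
  \<open>P u\<close> to \<open>p\<close> by the short element \<open>t\<close> changes the excess,
  through the cocycle identity, by at most \<open>excess t m\<close>.\<close>

lemma excess_near:
  assumes p: "p \<in> carrier G" and m: "m \<in> carrier G" and "gp p \<one> (p \<otimes> m) \<le> a"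
  shows "excess p m \<le> ball_bound (4 * a + 6 * \<delta>)"
proof -
  obtain w where w: "local_geodesic w" "P w = p \<otimes> m" "score w = best (p \<otimes> m)"
    using best_attained[OF m_closed[OF p m]] .
  obtain u v where uv: "w = u @ v" "d p (P u) \<le> 4 * a + 6 * \<delta>"
  proof (rule near_local_geodesic[OF w(1) p])
    show "gp p \<one> (P w) \<le> a" using assms(3) w(2) by simp
  qed
  have s: "set u \<subseteq> T" "set v \<subseteq> T" using local_geodesic_letters[OF w(1)] uv by auto
  have e0: "excess (P u) (P v) = 0"
    using excess_optimal[of u v] w(1,3) unfolding w(2)[symmetric] uv(1) by blast
  define t where "t = inv (P u) \<otimes> p"
  have Puv: "P u \<in> carrier G" "P v \<in> carrier G" using s by auto
  have t: "t \<in> carrier G" "P u \<otimes> t = p" using Puv p by (auto simp: t_def mult_inv_left)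
  have "p \<otimes> m = P u \<otimes> P v" using w(2) uv(1) wprod_append[OF s] by simp
  then have tm: "t \<otimes> m = P v" using Puv p m by (simp add: t_def m_assoc inv_mult_left)
  have "excess (P u) t + excess p m = excess t m + 0"
    using int_cocycleD[OF excess_cocycle Puv(1) t(1) m] t(2) tm e0 by simp
  moreover have "0 \<le> excess (P u) t" using Puv t by (simp add: excess_nonneg)
  moreover have "excess t m \<le> excess t (inv t)"
    using int_cocycle_inverse[OF excess_cocycle excess_one_one t(1) m]
      excess_nonneg[of "inv t" "t \<otimes> m"] t(1) m by simp
  moreover have "excess t (inv t) \<le> ball_bound (4 * a + 6 * \<delta>)"
  proof (rule excess_ball[OF t(1)])
    show "real (wl t) \<le> 4 * a + 6 * \<delta>"
      using uv(2) unfolding dist_sym[OF p Puv(1)] by (simp add: word_dist_def t_def)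
  qed
  ultimately show ?thesis by linarith
qed

text \<open>Here \<open>p\<close> is a centre of the tripod of 1, \<open>g\<close>,
  \<open>g \<otimes> h\<close>, and \<open>?k\<close> runs along the side from \<open>p\<close> to
  \<open>g\<close>. The cocycle identity for \<open>p\<close>, \<open>?k\<close>, \<open>h\<close>
  reduces \<open>excess g h\<close> to \<open>excess ?k h\<close> up to terms at \<open>p\<close>,
  which \<open>excess_near\<close> bounds. Since \<open>inv ?k\<close> is near a geodesic from 1 to
  \<open>h\<close>, \<open>int_cocycle_inverse\<close> then replaces \<open>h\<close> by
  \<open>inv ?k\<close>.\<close>

lemma excess_centre:
  assumes g: "g \<in> carrier G" and h: "h \<in> carrier G" and p: "p \<in> carrier G"
    and "gp p \<one> g \<le> a" "gp p g (g \<otimes> h) \<le> a" "gp p \<one> (g \<otimes> h) \<le> a"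
  shows "\<bar>excess g h - excess (inv p \<otimes> g) (inv g \<otimes> p)\<bar> \<le> 2 * ball_bound (4 * a + 6 * \<delta>)"
proof -
  let ?k = "inv p \<otimes> g"
  let ?B = "ball_bound (4 * a + 6 * \<delta>)"
  have k: "?k \<in> carrier G" "p \<otimes> ?k = g" "p \<otimes> (?k \<otimes> h) = g \<otimes> h" "inv ?k = inv g \<otimes> p"
    using g h p by (auto simp: inv_mult_group m_assoc mult_inv_left)
  have "gp (inv ?k) \<one> (inv ?k \<otimes> (?k \<otimes> h)) = gp p g (g \<otimes> h)"
  proof -
    have "inv g \<otimes> g = \<one>" "inv ?k \<otimes> (?k \<otimes> h) = inv g \<otimes> (g \<otimes> h)"
      using k(4) g h p by (auto simp: m_assoc mult_inv_left inv_mult_left)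
    then show ?thesis using gp_translate[of "inv g" p g "g \<otimes> h"] g h p k(4) by simp
  qed
  then have "excess (inv ?k) (?k \<otimes> h) \<le> ?B"
    by (intro excess_near) (simp_all only: assms(5) inv_closed m_closed k(1) h)
  moreover have "excess p ?k \<le> ?B" "excess p (?k \<otimes> h) \<le> ?B"
    by (rule excess_near; simp only: assms k m_closed)+
  moreover have "excess p ?k + excess g h = excess ?k h + excess p (?k \<otimes> h)"
    using int_cocycleD[OF excess_cocycle p k(1) h] k by simp
  moreover have "excess ?k h + excess (inv ?k) (?k \<otimes> h) = excess ?k (inv ?k)"
    by (rule int_cocycle_inverse[OF excess_cocycle excess_one_one k(1) h])
  moreover have "0 \<le> excess p ?k" "0 \<le> excess p (?k \<otimes> h)" "0 \<le> excess (inv ?k) (?k \<otimes> h)"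
    by (intro excess_nonneg m_closed inv_closed k(1) p h)+
  ultimately show ?thesis using k(4) by simp
qed

text \<open>Walk along a local geodesic from 1 to \<open>g \<otimes> h\<close>. Each vertex has
  defect at most \<open>2 * \<delta>\<close>, so by the four-point condition it is within
  \<open>3 * \<delta>\<close> of being aligned with the side to 1 or the side to
  \<open>g \<otimes> h\<close>. The first vertex of the second kind works: its predecessor is of the
  first kind, and one step changes a Gromov product by at most 1.\<close>

lemma centre_exists:
  assumes g: "g \<in> carrier G" and h: "h \<in> carrier G"
  obtains p where "p \<in> carrier G" "gp p \<one> g \<le> 3 * \<delta> + 1" "gp p g (g \<otimes> h) \<le> 3 * \<delta> + 1"
    "gp p \<one> (g \<otimes> h) \<le> 3 * \<delta> + 1"
proof -
  obtain w where w: "local_geodesic w" "P w = g \<otimes> h"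
    using best_attained[of "g \<otimes> h"] g h by blast
  have sw: "set w \<subseteq> T" using w by (simp add: local_geodesic_letters)
  define x where "x i = P (take i w)" for i
  have x: "x i \<in> carrier G" for i using sw set_take_subset[of i w] by (auto simp: x_def)
  have xgp: "gp (x i) \<one> (g \<otimes> h) \<le> 2 * \<delta>" for i
  proof -
    have "gp (x i) \<one> (P (take i w @ drop i w)) = defect (take i w) (drop i w)"
      using sw set_take_subset[of i w] set_drop_subset[of i w] unfolding x_def by (intro gp_word) auto
    then show ?thesis using defect_le[of "take i w" "drop i w"] w by simp
  qed
  have alt: "gp (x i) \<one> g \<le> 3 * \<delta> \<or> gp (x i) g (g \<otimes> h) \<le> 3 * \<delta>" for i
    using four_point[of "x i" \<one> g "g \<otimes> h"] xgp[of i] x[of i] g h by (auto simp: min_def split: if_splits)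
  define n where "n = (LEAST i. gp (x i) g (g \<otimes> h) \<le> 3 * \<delta>)"
  have "gp (x (length w)) g (g \<otimes> h) \<le> 3 * \<delta>"
    using w g h delta_nonneg by (simp add: x_def gromov_product_def)
  then have n: "gp (x n) g (g \<otimes> h) \<le> 3 * \<delta>" "n \<le> length w"
    unfolding n_def by (rule LeastI, rule Least_le)
  have less: "\<not> gp (x i) g (g \<otimes> h) \<le> 3 * \<delta>" if "i < n" for i
    using that unfolding n_def by (rule not_less_Least)
  have "gp (x n) \<one> g \<le> 3 * \<delta> + 1"
  proof (cases n)
    case 0
    then show ?thesis using g delta_nonneg dist_sym[of g \<one>] by (simp add: x_def gromov_product_def)
  next
    case (Suc i)
    then have "gp (x i) \<one> g \<le> 3 * \<delta>" using alt[of i] less[of i] by auto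
    moreover have "d (x i) (x n) \<le> 1"
    proof -
      have s: "set (take i w) \<subseteq> T" "set [w ! i] \<subseteq> T" using sw n Suc set_take_subset[of i w] by auto
      have "x n = P (take i w @ [w ! i])" using Suc n by (simp add: x_def take_Suc_conv_app_nth)
      then show ?thesis using dist_prefix[OF s] by (simp add: x_def)
    qed
    ultimately show ?thesis
      using dist_triangle[of \<one> "x i" "x n"] dist_triangle[of g "x i" "x n"] x g
      by (simp add: gromov_product_def)
  qed
  then show ?thesis using that[of "x n"] n xgp[of n] x delta_nonneg by simp
qed

text \<open>Translating the triangle by \<open>inv (g \<otimes> h)\<close> and reversing it turns
  the pair \<open>g\<close>, \<open>h\<close> into \<open>inv h\<close>, \<open>inv g\<close>; the
  centre moves along and the side in \<open>excess_centre\<close> stays the same element. Hence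
  \<open>excess\<close> is invariant under this reversal up to a bounded error, and half the
  coboundary of \<open>s\<close>, which is the mean of the two values, cancels it.\<close>

theorem bounded_cohomologous:
  "\<exists>a B. \<forall>g\<in>carrier G. \<forall>h\<in>carrier G. \<bar>c g h + a g + a h - a (g \<otimes> h)\<bar> \<le> B"
proof -
  define B where "B = ball_bound (4 * (3 * \<delta> + 1) + 6 * \<delta>)"
  have sym: "\<bar>excess g h - excess (inv h) (inv g)\<bar> \<le> 4 * B"
    if g: "g \<in> carrier G" and h: "h \<in> carrier G" for g h
  proof -
    obtain p where p: "p \<in> carrier G" "gp p \<one> g \<le> 3 * \<delta> + 1" "gp p g (g \<otimes> h) \<le> 3 * \<delta> + 1"
      "gp p \<one> (g \<otimes> h) \<le> 3 * \<delta> + 1"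
      using centre_exists[OF g h] .
    let ?gh = "g \<otimes> h"
    define p' where "p' = inv ?gh \<otimes> p"
    have p': "p' \<in> carrier G" using p g h by (simp add: p'_def)
    have eqs: "inv ?gh \<otimes> \<one> = inv h \<otimes> inv g" "inv ?gh \<otimes> g = inv h" "inv ?gh \<otimes> ?gh = \<one>"
      using g h by (simp_all add: inv_mult_group m_assoc inv_mult_left)
    have tr: "gp p' (inv ?gh \<otimes> x) (inv ?gh \<otimes> y) = gp p x y" if "x \<in> carrier G" "y \<in> carrier G" for x y
      unfolding p'_def using that p g h by (intro gp_translate) auto
    have "\<bar>excess (inv h) (inv g) - excess (inv p' \<otimes> inv h) (inv (inv h) \<otimes> p')\<bar> \<le> 2 * B"
      unfolding B_def
    proof (rule excess_centre)
      show "gp p' \<one> (inv h) \<le> 3 * \<delta> + 1"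
        using tr[of ?gh g] eqs gp_sym[of p g ?gh] p g h by simp
      show "gp p' (inv h) (inv h \<otimes> inv g) \<le> 3 * \<delta> + 1"
        using tr[of g \<one>] eqs gp_sym[of p g \<one>] p g h by simp
      show "gp p' \<one> (inv h \<otimes> inv g) \<le> 3 * \<delta> + 1"
        using tr[of ?gh \<one>] eqs gp_sym[of p ?gh \<one>] p g h by simp
    qed (use g h p' in auto)
    moreover have "inv p' \<otimes> inv h = inv p \<otimes> g" "inv (inv h) \<otimes> p' = inv g \<otimes> p"
      using g h p by (simp_all add: p'_def inv_mult_group m_assoc mult_inv_left)
    moreover have "\<bar>excess g h - excess (inv p \<otimes> g) (inv g \<otimes> p)\<bar> \<le> 2 * B"
      unfolding B_def using p g h by (intro excess_centre)
    ultimately show ?thesis by simp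
  qed
  \<comment> \<open>\<open>best g + s g\<close> equals \<open>- best (inv g) - c g (inv g)\<close>,
    the shift belonging to the inverse of the optimal lift of \<open>inv g\<close>; it plays the
    role of the minimizing section.\<close>
  define s where "s g = excess g (inv g)" for g
  have s: "s (g \<otimes> h) = s g + s h - excess (inv h) (inv g) - excess g h"
    if g: "g \<in> carrier G" and h: "h \<in> carrier G" for g h
  proof -
    have "excess g h + excess (g \<otimes> h) (inv h \<otimes> inv g)
        = excess h (inv h \<otimes> inv g) + excess g (h \<otimes> (inv h \<otimes> inv g))"
      using g h by (intro int_cocycleD[OF excess_cocycle]) auto
    moreover have "excess h (inv h) + excess (h \<otimes> inv h) (inv g)
        = excess (inv h) (inv g) + excess h (inv h \<otimes> inv g)"
      using g h by (intro int_cocycleD[OF excess_cocycle]) auto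
    moreover have "h \<otimes> (inv h \<otimes> inv g) = inv g" using g h by (simp add: mult_inv_left)
    ultimately show ?thesis using g h by (simp add: s_def inv_mult_group)
  qed
  \<comment> \<open>The mean of the shifts \<open>best g\<close> and \<open>best g + s g\<close>;
    the rounding of the three integer halves is absorbed by the summand 4 below.\<close>
  define a where "a g = best g + s g div 2" for g
  have "\<bar>c g h + a g + a h - a (g \<otimes> h)\<bar> \<le> 4 * B + 4" if g: "g \<in> carrier G" and h: "h \<in> carrier G" for g h
  proof -
    have "c g h + a g + a h - a (g \<otimes> h) = s g div 2 + s h div 2 - s (g \<otimes> h) div 2 - excess g h"
      by (simp add: a_def excess_def)
    then show ?thesis using s[OF g h] sym[OF g h] by linarith
  qed
  then show ?thesis by blast
qed

end

theorem (in group) hyperbolic_bounded_cocycle: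
  assumes hyp: "hyperbolic_group G" and c: "int_cocycle G c"
  obtains a B where "\<And>g h. g \<in> carrier G \<Longrightarrow> h \<in> carrier G \<Longrightarrow> \<bar>c g h + a g + a h - a (g \<otimes> h)\<bar> \<le> (B :: int)"
proof -
  obtain S \<delta> where S: "finite S" "S \<subseteq> carrier G" "generate G S = carrier G"
    and \<delta>: "\<And>w x y z. \<lbrakk>w \<in> carrier G; x \<in> carrier G; y \<in> carrier G; z \<in> carrier G\<rbrakk> \<Longrightarrow>
        gromov_product (word_dist G S) w x z
          \<ge> min (gromov_product (word_dist G S) w x y) (gromov_product (word_dist G S) w y z) - \<delta>"
    using hyp unfolding hyperbolic_group_def gromov_hyperbolic_def by blast
  \<comment> \<open>Subtracting the constant \<open>c \<one> \<one>\<close> normalizes the cocycle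
    and enters the final bound. The hyperbolicity constant comes without a sign, hence
    \<open>max \<delta> 0\<close>.\<close>
  interpret hyperbolic_cocycle G S "max \<delta> 0" "\<lambda>g h. c g h - c \<one> \<one>"
  proof unfold_locales
    show "int_cocycle G (\<lambda>g h. c g h - c \<one> \<one>)"
      using c unfolding int_cocycle_def by simp
  next
    fix w x y z
    assume "w \<in> carrier G" "x \<in> carrier G" "y \<in> carrier G" "z \<in> carrier G"
    from \<delta>[OF this]
    show "min (gromov_product (word_dist G S) w x y) (gromov_product (word_dist G S) w y z) - max \<delta> 0
       \<le> gromov_product (word_dist G S) w x z"
      by linarith
  qed (use S in auto)
  obtain a B where aB: "\<forall>g\<in>carrier G. \<forall>h\<in>carrier G. \<bar>c g h - c \<one> \<one> + a g + a h - a (g \<otimes> h)\<bar> \<le> B"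
    using bounded_cohomologous by blast
  then have "\<bar>c g h + a g + a h - a (g \<otimes> h)\<bar> \<le> B + \<bar>c \<one> \<one>\<bar>" if "g \<in> carrier G" "h \<in> carrier G" for g h
    using that by fastforce
  then show ?thesis using that by blast
qed

section \<open>The logarithm of the determinant near the identity\<close>

lemma sqnorm_cscalar: "(v :: complex vec) \<bullet>c v = of_real (\<Sum>i<dim_vec v. (cmod (v $ i))\<^sup>2)"
  unfolding scalar_prod_def of_real_sum lessThan_atLeast0
  by (rule sum.cong) (auto simp flip: complex_norm_square)

lemma l2_norm_vec_alt: "l2_norm_vec v = L2_set (\<lambda>i. cmod (v $ i)) {..<dim_vec v}"
  by (simp add: l2_norm_vec_def sqnorm_cscalar L2_set_def)

lemma l2_norm_vec_nonneg: "0 \<le> l2_norm_vec v"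
  by (simp add: l2_norm_vec_alt)

lemma l2_norm_vec_smult: "l2_norm_vec (z \<cdot>\<^sub>v v) = cmod z * l2_norm_vec v"
  unfolding l2_norm_vec_alt L2_set_right_distrib[OF norm_ge_zero]
  by (rule L2_set_cong) (auto simp: norm_mult)

lemma l2_norm_vec_add_le:
  "dim_vec v = dim_vec w \<Longrightarrow> l2_norm_vec (v + w) \<le> l2_norm_vec v + l2_norm_vec w"
proof -
  assume eq: "dim_vec v = dim_vec w"
  have "l2_norm_vec (v + w) \<le> L2_set (\<lambda>i. cmod (v $ i) + cmod (w $ i)) {..<dim_vec w}"
    unfolding l2_norm_vec_alt by (simp, rule L2_set_mono) (auto intro: norm_triangle_ineq)
  also have "\<dots> \<le> l2_norm_vec v + l2_norm_vec w"
    unfolding l2_norm_vec_alt eq by (rule L2_set_triangle_ineq)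
  finally show ?thesis .
qed

lemma l2_norm_vec_uminus: "l2_norm_vec (- v) = l2_norm_vec v"
  unfolding l2_norm_vec_alt by (rule L2_set_cong) auto

lemma l2_norm_vec_eq_0: "v \<in> carrier_vec n \<Longrightarrow> l2_norm_vec v = 0 \<longleftrightarrow> v = 0\<^sub>v n"
  by (auto simp: l2_norm_vec_alt L2_set_eq_0_iff)

text \<open>A bound on the operator norm that avoids the supremum. It is the only information about
  closeness that the determinant argument takes from the norms in the theorem.\<close>

definition norm_le :: "complex mat \<Rightarrow> real \<Rightarrow> bool" where
  "norm_le A e \<longleftrightarrow> (\<forall>v\<in>carrier_vec (dim_col A). l2_norm_vec (A *\<^sub>v v) \<le> e * l2_norm_vec v)"

lemma norm_le_add:
  assumes "A \<in> carrier_mat n m" "B \<in> carrier_mat n m" "norm_le A a" "norm_le B b"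
  shows "norm_le (A + B) (a + b)"
  unfolding norm_le_def
proof
  fix v :: "complex vec" assume "v \<in> carrier_vec (dim_col (A + B))"
  then have v: "v \<in> carrier_vec m" using assms by simp
  have "(A + B) *\<^sub>v v = A *\<^sub>v v + B *\<^sub>v v" using assms v by (simp add: add_mult_distrib_mat_vec)
  then have "l2_norm_vec ((A + B) *\<^sub>v v) \<le> l2_norm_vec (A *\<^sub>v v) + l2_norm_vec (B *\<^sub>v v)"
    using assms by (auto intro!: l2_norm_vec_add_le)
  also have "\<dots> \<le> a * l2_norm_vec v + b * l2_norm_vec v"
    using assms v by (intro add_mono) (auto simp: norm_le_def)
  finally show "l2_norm_vec ((A + B) *\<^sub>v v) \<le> (a + b) * l2_norm_vec v" by (simp add: algebra_simps)
qed

lemma norm_le_smult: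
  assumes "A \<in> carrier_mat n m" "norm_le A a"
  shows "norm_le (z \<cdot>\<^sub>m A) (cmod z * a)"
  unfolding norm_le_def
proof
  fix v :: "complex vec" assume "v \<in> carrier_vec (dim_col (z \<cdot>\<^sub>m A))"
  then have v: "v \<in> carrier_vec m" using assms by simp
  have "l2_norm_vec ((z \<cdot>\<^sub>m A) *\<^sub>v v) = cmod z * l2_norm_vec (A *\<^sub>v v)"
  proof -
    have "(z \<cdot>\<^sub>m A) *\<^sub>v v = z \<cdot>\<^sub>v (A *\<^sub>v v)" using assms v by (intro eq_vecI) auto
    then show ?thesis by (simp add: l2_norm_vec_smult)
  qed
  also have "\<dots> \<le> cmod z * (a * l2_norm_vec v)"
    using assms v by (intro mult_left_mono) (auto simp: norm_le_def)
  finally show "l2_norm_vec ((z \<cdot>\<^sub>m A) *\<^sub>v v) \<le> cmod z * a * l2_norm_vec v" by (simp add: mult.assoc)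
qed

lemma norm_le_mult:
  assumes "A \<in> carrier_mat n m" "B \<in> carrier_mat m k" "norm_le A a" "norm_le B b" "0 \<le> a"
  shows "norm_le (A * B) (a * b)"
  unfolding norm_le_def
proof
  fix v :: "complex vec" assume "v \<in> carrier_vec (dim_col (A * B))"
  then have v: "v \<in> carrier_vec k" using assms by simp
  have "l2_norm_vec ((A * B) *\<^sub>v v) = l2_norm_vec (A *\<^sub>v (B *\<^sub>v v))"
    using assms v by (simp add: assoc_mult_mat_vec)
  also have "\<dots> \<le> a * l2_norm_vec (B *\<^sub>v v)"
    using assms v by (auto simp: norm_le_def)
  also have "\<dots> \<le> a * (b * l2_norm_vec v)"
    using assms v by (intro mult_left_mono) (auto simp: norm_le_def)
  finally show "l2_norm_vec ((A * B) *\<^sub>v v) \<le> a * b * l2_norm_vec v" by (simp add: mult.assoc)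
qed

lemma norm_le_mono: "norm_le A a \<Longrightarrow> a \<le> b \<Longrightarrow> norm_le A b"
  unfolding norm_le_def by (meson l2_norm_vec_nonneg mult_right_mono order_trans)

lemma det_one_plus_nonzero:
  assumes A: "A \<in> carrier_mat n n" and "norm_le A a" "a < 1"
  shows "det (1\<^sub>m n + A) \<noteq> 0"
proof
  assume "det (1\<^sub>m n + A) = 0"
  then obtain v where v: "v \<in> carrier_vec n" "v \<noteq> 0\<^sub>v n" "(1\<^sub>m n + A) *\<^sub>v v = 0\<^sub>v n"
    using det_0_iff_vec_prod_zero[of "1\<^sub>m n + A" n] A by auto
  have z: "v + A *\<^sub>v v = 0\<^sub>v n"
    using v A add_mult_distrib_mat_vec[of "1\<^sub>m n" n n A v] by simp
  have "A *\<^sub>v v = - v"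
  proof (rule eq_vecI)
    fix i assume "i < dim_vec (- v)"
    then show "(A *\<^sub>v v) $ i = (- v) $ i"
      using arg_cong[OF z, of "\<lambda>w. w $ i"] v(1) A by (simp add: add_eq_0_iff)
  qed (use A v in auto)
  then have "l2_norm_vec v \<le> a * l2_norm_vec v"
    using assms v l2_norm_vec_uminus[of v] unfolding norm_le_def by (metis carrier_matD(2))
  moreover have "0 < l2_norm_vec v" using v l2_norm_vec_eq_0 l2_norm_vec_nonneg[of v] by fastforce
  ultimately show False using assms(3) by (simp add: mult_le_cancel_right1)
qed

section \<open>Continuous logarithms of determinants\<close>

lemma continuous_on_det:
  fixes F :: "'t::topological_space \<Rightarrow> complex mat"
  assumes "\<And>x. F x \<in> carrier_mat n n" "\<And>i j. i < n \<Longrightarrow> j < n \<Longrightarrow> continuous_on S (\<lambda>x. F x $$ (i, j))"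
  shows "continuous_on S (\<lambda>x. det (F x))"
proof -
  have "det (F x) = (\<Sum>p\<in>{p. p permutes {0..<n}}. signof p * (\<Prod>i = 0..<n. F x $$ (i, p i)))" for x
    using assms(1) by (rule det_def')
  then show ?thesis using assms(2)
    by (auto intro!: continuous_intros simp: permutes_in_image)
qed

text \<open>For \<open>u\<close> near 1 this is the trace of the principal logarithm of
  \<open>u\<close>. It is a relation because no such \<open>z\<close> exists when the determinant
  vanishes on the segment from 1 to \<open>u\<close>.\<close>

definition det_log :: "complex mat \<Rightarrow> complex \<Rightarrow> bool" where
  "det_log u z \<longleftrightarrow> (\<exists>g. continuous_on {0..1::real} g \<and> g 0 = 0 \<and> g 1 = z \<and>
     (\<forall>t\<in>{0..1}. exp (g t) = det (1\<^sub>m (dim_row u) + of_real t \<cdot>\<^sub>m (u - 1\<^sub>m (dim_row u)))))"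

text \<open>The difference of two lifts takes values in a set with gaps of at least
  \<open>2 * pi\<close>, hence is constant on the interval.\<close>

lemma exp_lifts_differ_const:
  fixes g h :: "real \<Rightarrow> complex"
  assumes "continuous_on {0..1} g" "continuous_on {0..1} h"
    "\<And>t. t \<in> {0..1} \<Longrightarrow> exp (g t) = exp (h t) * w"
  shows "g 1 - g 0 = h 1 - h 0"
proof -
  have w: "exp (g t - h t) = w" if "t \<in> {0..1}" for t
    using assms(3)[OF that] by (simp add: exp_diff)
  have "(\<lambda>t. g t - h t) constant_on {0..1}"
  proof (rule continuous_discrete_range_constant)
    show "continuous_on {0..1} (\<lambda>t. g t - h t)" using assms by (intro continuous_intros)
    show "\<exists>e>0. \<forall>y. y \<in> {0..1} \<and> (g y - h y) \<noteq> (g x - h x) \<longrightarrow> e \<le> cmod ((g y - h y) - (g x - h x))"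
      if "x \<in> {0..1}" for x
    proof (intro exI[of _ "2 * pi"] conjI allI impI)
      fix y assume y: "y \<in> {0..1} \<and> g y - h y \<noteq> g x - h x"
      then have "exp (g y - h y) = exp (g x - h x)" using w that by simp
      then obtain n :: int where "g y - h y = g x - h x + (of_int (2 * n) * pi) * \<i>"
        unfolding exp_eq by auto
      then have n: "g y - h y - (g x - h x) = of_int (2 * n) * of_real pi * \<i>" by simp
      with y have "n \<noteq> 0" by auto
      then have "1 \<le> \<bar>real_of_int n\<bar>" by linarith
      then show "2 * pi \<le> cmod (g y - h y - (g x - h x))"
        unfolding n by (simp add: norm_mult)
    qed simp
  qed auto
  then obtain y where "\<And>t. t \<in> {0..1} \<Longrightarrow> g t - h t = y" unfolding constant_on_def by auto
  from this[of 0] this[of 1] have "g 1 - h 1 = g 0 - h 0" by simp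
  then show ?thesis by (simp add: algebra_simps)
qed

lemma det_log_unique:
  assumes "det_log u z" "det_log u z'"
  shows "z = z'"
proof -
  obtain g h where g: "continuous_on {0..1::real} g" "g 0 = 0" "g 1 = z"
      "\<And>t. t \<in> {0..1} \<Longrightarrow> exp (g t) = det (1\<^sub>m (dim_row u) + of_real t \<cdot>\<^sub>m (u - 1\<^sub>m (dim_row u)))"
    and h: "continuous_on {0..1::real} h" "h 0 = 0" "h 1 = z'"
      "\<And>t. t \<in> {0..1} \<Longrightarrow> exp (h t) = det (1\<^sub>m (dim_row u) + of_real t \<cdot>\<^sub>m (u - 1\<^sub>m (dim_row u)))"
    using assms unfolding det_log_def by (elim exE conjE) blast
  have "g 1 - g 0 = h 1 - h 0"
    using g(1) h(1) by (rule exp_lifts_differ_const[where w = 1]) (simp add: g(4) h(4))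
  then show ?thesis using g h by simp
qed

text \<open>The condition keeps the segment from 1 to \<open>z\<close> in the right half-plane,
  where \<open>Ln\<close> is continuous.\<close>

lemma det_log_scalar:
  assumes "cmod (z - 1) < 1"
  shows "det_log (z \<cdot>\<^sub>m 1\<^sub>m n) (of_nat n * Ln z)"
proof -
  let ?f = "\<lambda>t :: real. 1 + of_real t * (z - 1)"
  have re: "0 < Re (?f t)" if "t \<in> {0..1}" for t
  proof -
    have "\<bar>t * (Re z - 1)\<bar> \<le> 1 * \<bar>Re z - 1\<bar>" using that unfolding abs_mult by (intro mult_right_mono) auto
    also have "\<dots> < 1" using abs_Re_le_cmod[of "z - 1"] assms by simp
    finally show ?thesis by simp
  qed
  have nn: "?f t \<notin> \<real>\<^sub>\<le>\<^sub>0" if "t \<in> {0..1}" for t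
    using re[OF that] by (auto simp: complex_nonpos_Reals_iff)
  have "continuous_on {0..1} (\<lambda>t. of_nat n * Ln (?f t))"
    using nn by (intro continuous_intros) auto
  moreover have "exp (of_nat n * Ln (?f t)) = det (1\<^sub>m n + of_real t \<cdot>\<^sub>m (z \<cdot>\<^sub>m 1\<^sub>m n - 1\<^sub>m n))"
    if t: "t \<in> {0..1}" for t
  proof -
    have "1\<^sub>m n + of_real t \<cdot>\<^sub>m (z \<cdot>\<^sub>m 1\<^sub>m n - 1\<^sub>m n) = ?f t \<cdot>\<^sub>m 1\<^sub>m n"
      by (auto simp: algebra_simps)
    moreover have "?f t \<noteq> 0" using re[OF t] by force
    ultimately show ?thesis by (simp add: exp_of_nat_mult)
  qed
  ultimately show ?thesis unfolding det_log_def by (intro exI[of _ "\<lambda>t. of_nat n * Ln (?f t)"]) simp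
qed

text \<open>The determinant has no zero on the convex hull of \<open>1\<close>, \<open>u\<close> and \<open>u v\<close>, hence a continuous logarithm;
  on the edge from \<open>u\<close> to \<open>u v\<close> it is \<open>det u\<close> times the determinant on the segment from \<open>1\<close> to \<open>v\<close>.\<close>

lemma det_log_mult:
  assumes u: "u \<in> carrier_mat n n" and v: "v \<in> carrier_mat n n"
    and nu: "norm_le (u - 1\<^sub>m n) (1/4)" and nv: "norm_le (v - 1\<^sub>m n) (1/4)"
  shows "\<exists>a b. det_log u a \<and> det_log v b \<and> det_log (u * v) (a + b)"
proof -
  define X where "X = u - 1\<^sub>m n"
  define Y where "Y = u * v - u"
  have XY: "X \<in> carrier_mat n n" "Y \<in> carrier_mat n n" using u v by (auto simp: X_def Y_def)
  define F where "F p = 1\<^sub>m n + (of_real (fst p) \<cdot>\<^sub>m X + of_real (snd p) \<cdot>\<^sub>m Y)" for p :: "real \<times> real"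
  have F: "F p \<in> carrier_mat n n" for p using XY by (simp add: F_def)
  have nX: "norm_le X (1/4)" using nu by (simp add: X_def)
  \<comment> \<open>With 1/4 for \<open>X\<close> and 5/16, rounded up to 1/2, for \<open>Y\<close>,
    the perturbation stays at most 3/4 on the whole parameter square.\<close>
  have nY: "norm_le Y (1/2)"
  proof -
    have Y: "Y = X * (v - 1\<^sub>m n) + (v - 1\<^sub>m n)"
    proof -
      have "X * (v - 1\<^sub>m n) = u * (v - 1\<^sub>m n) - 1\<^sub>m n * (v - 1\<^sub>m n)"
        unfolding X_def using u v by (intro minus_mult_distrib_mat) auto
      also have "u * (v - 1\<^sub>m n) = u * v - u * 1\<^sub>m n"
        using u v by (intro mult_minus_distrib_mat) auto
      finally show ?thesis unfolding Y_def using u v by auto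
    qed
    have "norm_le (X * (v - 1\<^sub>m n) + (v - 1\<^sub>m n)) (1/4 * (1/4) + 1/4)"
      using XY v nX nv by (intro norm_le_add[of _ n n] norm_le_mult[of _ n n _ n]) auto
    then show ?thesis unfolding Y[symmetric] by (rule norm_le_mono) simp
  qed
  \<comment> \<open>The lower edge, the right edge and the diagonal of the square parametrize the
    segments from 1 to \<open>u\<close>, from \<open>u\<close> to \<open>u * v\<close> and from 1 to
    \<open>u * v\<close>. One logarithm on the square restricts to all three.\<close>
  define S where "S = cbox (0 :: real \<times> real) (1, 1)"
  have nz: "det (F p) \<noteq> 0" if "p \<in> S" for p
  proof -
    have p: "0 \<le> fst p" "fst p \<le> 1" "0 \<le> snd p" "snd p \<le> 1"
      using that by (auto simp: S_def cbox_Pair_eq zero_prod_def)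
    have "norm_le (of_real (fst p) \<cdot>\<^sub>m X + of_real (snd p) \<cdot>\<^sub>m Y)
      (cmod (of_real (fst p)) * (1/4) + cmod (of_real (snd p)) * (1/2))"
      using XY nX nY by (intro norm_le_add[of _ n n] norm_le_smult[of _ n n]) auto
    then have "norm_le (of_real (fst p) \<cdot>\<^sub>m X + of_real (snd p) \<cdot>\<^sub>m Y) (3/4)"
      using p by (auto elim: norm_le_mono)
    then show ?thesis unfolding F_def using XY by (intro det_one_plus_nonzero) auto
  qed
  have cont: "continuous_on S (\<lambda>p. det (F p))"
    using XY F by (intro continuous_on_det[of _ n]) (auto simp: F_def intro!: continuous_intros)
  have "contractible S" unfolding S_def by (intro convex_imp_contractible convex_box)
  then obtain g where g: "continuous_on S g" "\<And>p. p \<in> S \<Longrightarrow> det (F p) = exp (g p)"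
    using continuous_logarithm_on_contractible[OF cont] nz by blast
  have mem: "(t, 0) \<in> S" "(1, t) \<in> S" "(t, t) \<in> S" if "t \<in> {0..1}" for t
    using that by (auto simp: S_def cbox_Pair_eq zero_prod_def)
  have mem0: "(0, 0) \<in> S" "(1, 0) \<in> S" "(1, 1) \<in> S" using mem by force+
  have F0: "F (0, 0) = 1\<^sub>m n" and F1: "F (1, 0) = u"
    using u v by (auto simp: F_def X_def Y_def)
  have e0: "exp (g (0, 0)) = 1" using g(2)[OF mem0(1)] F0 by simp
  have e1: "exp (g (1, 0)) = det u" using g(2)[OF mem0(2)] F1 by simp
  have cg: "continuous_on {0..1} (\<lambda>t. g (t, 0))" "continuous_on {0..1} (\<lambda>t. g (1, t))"
    "continuous_on {0..1} (\<lambda>t. g (t, t))"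
    by (rule continuous_on_compose2[OF g(1)]; use mem in \<open>force intro!: continuous_intros\<close>)+
  have "det_log u (g (1, 0) - g (0, 0))"
    unfolding det_log_def
  proof (intro exI[of _ "\<lambda>t. g (t, 0) - g (0, 0)"] conjI ballI)
    fix t :: real assume "t \<in> {0..1}"
    then have "exp (g (t, 0)) = det (F (t, 0))" using g mem by simp
    also have "F (t, 0) = 1\<^sub>m (dim_row u) + of_real t \<cdot>\<^sub>m (u - 1\<^sub>m (dim_row u))"
      using u v by (auto simp: F_def X_def Y_def)
    finally show "exp (g (t, 0) - g (0, 0)) = det (1\<^sub>m (dim_row u) + of_real t \<cdot>\<^sub>m (u - 1\<^sub>m (dim_row u)))"
      using e0 by (simp add: exp_diff)
  qed (use cg in \<open>auto intro!: continuous_intros\<close>)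
  moreover have "det_log v (g (1, 1) - g (1, 0))"
    unfolding det_log_def
  proof (intro exI[of _ "\<lambda>t. g (1, t) - g (1, 0)"] conjI ballI)
    fix t :: real assume "t \<in> {0..1}"
    then have "exp (g (1, t)) = det (F (1, t))" using g mem by simp
    also have "F (1, t) = u * (1\<^sub>m n + of_real t \<cdot>\<^sub>m (v - 1\<^sub>m n))"
    proof -
      have "u * (1\<^sub>m n + of_real t \<cdot>\<^sub>m (v - 1\<^sub>m n)) = u * 1\<^sub>m n + u * (of_real t \<cdot>\<^sub>m (v - 1\<^sub>m n))"
        using u v by (intro mult_add_distrib_mat) auto
      also have "u * (of_real t \<cdot>\<^sub>m (v - 1\<^sub>m n)) = of_real t \<cdot>\<^sub>m (u * (v - 1\<^sub>m n))"
        using u v by (intro mult_smult_distrib) auto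
      also have "u * (v - 1\<^sub>m n) = u * v - u * 1\<^sub>m n"
        using u v by (intro mult_minus_distrib_mat) auto
      finally show ?thesis using u v by (auto simp: F_def X_def Y_def)
    qed
    also have "det \<dots> = det u * det (1\<^sub>m n + of_real t \<cdot>\<^sub>m (v - 1\<^sub>m n))"
      using u v by (intro det_mult) auto
    finally show "exp (g (1, t) - g (1, 0)) = det (1\<^sub>m (dim_row v) + of_real t \<cdot>\<^sub>m (v - 1\<^sub>m (dim_row v)))"
      using e1 nz[OF mem0(2)] F1 v by (simp add: exp_diff)
  qed (use cg in \<open>auto intro!: continuous_intros\<close>)
  moreover have "det_log (u * v) (g (1, 1) - g (0, 0))"
    unfolding det_log_def
  proof (intro exI[of _ "\<lambda>t. g (t, t) - g (0, 0)"] conjI ballI)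
    fix t :: real assume "t \<in> {0..1}"
    then have "exp (g (t, t)) = det (F (t, t))" using g mem by simp
    also have "F (t, t) = 1\<^sub>m (dim_row (u * v)) + of_real t \<cdot>\<^sub>m (u * v - 1\<^sub>m (dim_row (u * v)))"
      using u v by (auto simp: F_def X_def Y_def algebra_simps)
    finally show "exp (g (t, t) - g (0, 0)) =
        det (1\<^sub>m (dim_row (u * v)) + of_real t \<cdot>\<^sub>m (u * v - 1\<^sub>m (dim_row (u * v))))"
      using e0 by (simp add: exp_diff)
  qed (use cg in \<open>auto intro!: continuous_intros\<close>)
  ultimately show ?thesis
    by (intro exI[of _ "g (1, 0) - g (0, 0)"] exI[of _ "g (1, 1) - g (1, 0)"]) simp
qed

section \<open>The spectral theorem and Schatten norms\<close>

lemma one_smult_mat: "(1 :: 'a :: semiring_1) \<cdot>\<^sub>m A = A"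
  by (rule eq_matI) auto

lemma mat_adjoint_dim [simp]:
  "dim_row (mat_adjoint A) = dim_col A" "dim_col (mat_adjoint A) = dim_row A"
  by (simp_all add: mat_adjoint_def)

lemma mat_adjoint_carrier [simp]: "A \<in> carrier_mat n m \<Longrightarrow> mat_adjoint A \<in> carrier_mat m n"
  by auto

lemma mat_adjoint_index [simp]:
  "i < dim_col A \<Longrightarrow> j < dim_row A \<Longrightarrow> mat_adjoint (A :: complex mat) $$ (i, j) = cnj (A $$ (j, i))"
  by (simp add: mat_adjoint_def mat_of_rows_def)

lemma mat_adjoint_mult:
  assumes "(A :: complex mat) \<in> carrier_mat n m" "B \<in> carrier_mat m k"
  shows "mat_adjoint (A * B) = mat_adjoint B * mat_adjoint A"
  by (rule eq_matI) (use assms in \<open>auto simp: scalar_prod_def mult.commute\<close>)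

lemma mat_adjoint_adjoint [simp]: "mat_adjoint (mat_adjoint (A :: complex mat)) = A"
  by (rule eq_matI) auto

lemma mat_adjoint_one [simp]: "mat_adjoint (1\<^sub>m n :: complex mat) = 1\<^sub>m n"
  by (rule eq_matI) auto

lemma mat_adjoint_smult: "mat_adjoint (z \<cdot>\<^sub>m A) = cnj z \<cdot>\<^sub>m mat_adjoint (A :: complex mat)"
  by (rule eq_matI) auto

lemma mat_adjoint_inner:
  assumes "(A :: complex mat) \<in> carrier_mat n m" "v \<in> carrier_vec m" "w \<in> carrier_vec n"
  shows "(A *\<^sub>v v) \<bullet>c w = v \<bullet>c (mat_adjoint A *\<^sub>v w)"
proof -
  have "(A *\<^sub>v v) \<bullet>c w = (\<Sum>i<n. \<Sum>j<m. A $$ (i, j) * v $ j * cnj (w $ i))"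
    using assms by (auto simp: scalar_prod_def sum_distrib_right lessThan_atLeast0 intro!: sum.cong)
  also have "\<dots> = (\<Sum>j<m. \<Sum>i<n. A $$ (i, j) * v $ j * cnj (w $ i))"
    by (rule sum.swap)
  also have "\<dots> = v \<bullet>c (mat_adjoint A *\<^sub>v w)"
    using assms by (auto simp: scalar_prod_def sum_distrib_left lessThan_atLeast0 ac_simps intro!: sum.cong)
  finally show ?thesis .
qed

lemma unitaryD:
  assumes "U \<in> carrier (unitary_group n)"
  shows "U \<in> carrier_mat n n" "U * mat_adjoint U = 1\<^sub>m n" "mat_adjoint U * U = 1\<^sub>m n"
  using assms by (auto simp: unitary_group_def)

lemma unitaryI:
  assumes "(U :: complex mat) \<in> carrier_mat n n" "mat_adjoint U * U = 1\<^sub>m n"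
  shows "U \<in> carrier (unitary_group n)"
  using assms mat_mult_left_right_inverse[of "mat_adjoint U" n U] by (auto simp: unitary_group_def)

lemmas sq_mat = assoc_mult_mat[of _ n n _ n _ n] mult_carrier_mat[of _ n n _ n]
  left_mult_one_mat[of _ n n] right_mult_one_mat[of _ n n] mat_adjoint_mult[of _ n n _ n] for n

lemma unitary_cancel:
  assumes "U \<in> carrier (unitary_group n)" "X \<in> carrier_mat n k"
  shows "mat_adjoint U * (U * X) = X" "U * (mat_adjoint U * X) = X"
  using unitaryD[OF assms(1)] assms(2)
    assoc_mult_mat[of "mat_adjoint U" n n U n X k] assoc_mult_mat[of U n n "mat_adjoint U" n X k] by auto

lemma unitary_cancel_vec:
  assumes "U \<in> carrier (unitary_group n)" "v \<in> carrier_vec n"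
  shows "mat_adjoint U *\<^sub>v (U *\<^sub>v v) = v" "U *\<^sub>v (mat_adjoint U *\<^sub>v v) = v"
  using unitaryD[OF assms(1)] assms(2)
    assoc_mult_mat_vec[of "mat_adjoint U" n n U n v] assoc_mult_mat_vec[of U n n "mat_adjoint U" n v] by auto

lemma unitary_adjoint: "U \<in> carrier (unitary_group n) \<Longrightarrow> mat_adjoint U \<in> carrier (unitary_group n)"
  by (auto simp: unitary_group_def)

lemma unitary_mult:
  assumes "U \<in> carrier (unitary_group n)" "V \<in> carrier (unitary_group n)"
  shows "U * V \<in> carrier (unitary_group n)"
proof (rule unitaryI)
  note U = unitaryD[OF assms(1)] note V = unitaryD[OF assms(2)]
  show "mat_adjoint (U * V) * (U * V) = 1\<^sub>m n"
    using U V unitary_cancel[OF assms(1)] by (simp add: sq_mat[where n = n])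
  show "U * V \<in> carrier_mat n n" using U V by simp
qed

lemma unitary_one: "1\<^sub>m n \<in> carrier (unitary_group n)"
  by (simp add: unitary_group_def)

lemma unitary_norm:
  assumes "U \<in> carrier (unitary_group n)" "v \<in> carrier_vec n"
  shows "l2_norm_vec (U *\<^sub>v v) = l2_norm_vec v"
proof -
  note U = unitaryD[OF assms(1)]
  have "(U *\<^sub>v v) \<bullet>c (U *\<^sub>v v) = v \<bullet>c (mat_adjoint U *\<^sub>v (U *\<^sub>v v))"
    using U assms(2) by (intro mat_adjoint_inner) auto
  also have "mat_adjoint U *\<^sub>v (U *\<^sub>v v) = v"
    by (rule unitary_cancel_vec[OF assms])
  finally show ?thesis by (simp add: l2_norm_vec_def)
qed

lemma norm_le_unitary: "U \<in> carrier (unitary_group n) \<Longrightarrow> norm_le U 1"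
  using unitary_norm[of U n] by (auto simp: norm_le_def dest: unitaryD)

text \<open>A crude bound by the entries; it makes the real supremum in \<open>op_norm\<close>
  meaningful.\<close>

lemma norm_le_exists: "\<exists>C\<ge>0. norm_le M C"
proof (intro exI conjI)
  let ?C = "\<Sum>i<dim_row M. \<Sum>j<dim_col M. cmod (M $$ (i, j))"
  show "0 \<le> ?C" by (intro sum_nonneg) auto
  show "norm_le M ?C"
    unfolding norm_le_def
  proof
    fix v :: "complex vec" assume v: "v \<in> carrier_vec (dim_col M)"
    have "l2_norm_vec (M *\<^sub>v v) \<le> (\<Sum>i<dim_row M. cmod ((M *\<^sub>v v) $ i))"
      unfolding l2_norm_vec_alt dim_mult_mat_vec by (rule L2_set_le_sum) auto
    also have "\<dots> \<le> (\<Sum>i<dim_row M. \<Sum>j<dim_col M. cmod (M $$ (i, j)) * l2_norm_vec v)"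
    proof (rule sum_mono)
      fix i assume i: "i \<in> {..<dim_row M}"
      then have "(M *\<^sub>v v) $ i = (\<Sum>j<dim_col M. M $$ (i, j) * v $ j)"
        using v by (auto simp: scalar_prod_def lessThan_atLeast0)
      then have "cmod ((M *\<^sub>v v) $ i) \<le> (\<Sum>j<dim_col M. cmod (M $$ (i, j) * v $ j))"
        by (simp add: norm_sum)
      also have "\<dots> \<le> (\<Sum>j<dim_col M. cmod (M $$ (i, j)) * l2_norm_vec v)"
        using v member_le_L2_set[of "{..<dim_col M}" _ "\<lambda>i. cmod (v $ i)"]
        by (intro sum_mono) (auto simp: norm_mult l2_norm_vec_alt intro!: mult_left_mono)
      finally show "cmod ((M *\<^sub>v v) $ i) \<le> (\<Sum>j<dim_col M. cmod (M $$ (i, j)) * l2_norm_vec v)" .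
    qed
    finally show "l2_norm_vec (M *\<^sub>v v) \<le> ?C * l2_norm_vec v" by (simp add: sum_distrib_right)
  qed
qed

lemma l2_norm_zero [simp]: "l2_norm_vec (0\<^sub>v n) = 0"
  using l2_norm_vec_eq_0[of "0\<^sub>v n" n] by simp

lemma op_norm_leI:
  assumes "norm_le M C" "0 \<le> C"
  shows "op_norm M \<le> C"
  unfolding op_norm_def
proof (rule cSUP_least)
  have "0\<^sub>v (dim_col M) \<in> {v \<in> carrier_vec (dim_col M). l2_norm_vec v \<le> 1}" by simp
  then show "{v \<in> carrier_vec (dim_col M). l2_norm_vec v \<le> 1} \<noteq> {}" by blast
  fix v assume v: "v \<in> {v \<in> carrier_vec (dim_col M). l2_norm_vec v \<le> 1}"
  then have "l2_norm_vec (M *\<^sub>v v) \<le> C * l2_norm_vec v" using assms by (simp add: norm_le_def)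
  also have "\<dots> \<le> C * 1" using v assms by (intro mult_left_mono) auto
  finally show "l2_norm_vec (M *\<^sub>v v) \<le> C" by simp
qed

lemma op_norm_ge:
  assumes "v \<in> carrier_vec (dim_col M)" "l2_norm_vec v \<le> 1"
  shows "l2_norm_vec (M *\<^sub>v v) \<le> op_norm M"
  unfolding op_norm_def
proof (rule cSUP_upper)
  obtain C where C: "0 \<le> C" "norm_le M C" using norm_le_exists by blast
  show "bdd_above ((\<lambda>v. l2_norm_vec (M *\<^sub>v v)) ` {v \<in> carrier_vec (dim_col M). l2_norm_vec v \<le> 1})"
  proof (rule bdd_aboveI2)
    fix v assume v: "v \<in> {v \<in> carrier_vec (dim_col M). l2_norm_vec v \<le> 1}"
    then have "l2_norm_vec (M *\<^sub>v v) \<le> C * l2_norm_vec v" using C by (simp add: norm_le_def)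
    also have "\<dots> \<le> C * 1" using v C by (intro mult_left_mono) auto
    finally show "l2_norm_vec (M *\<^sub>v v) \<le> C" by simp
  qed
qed (use assms in auto)

lemma op_norm_nonneg: "0 \<le> op_norm M"
  using op_norm_ge[of "0\<^sub>v (dim_col M)" M] l2_norm_vec_nonneg[of "M *\<^sub>v 0\<^sub>v (dim_col M)"] by simp

lemma norm_le_op_norm: "norm_le M (op_norm M)"
  unfolding norm_le_def
proof
  fix v :: "complex vec" assume v: "v \<in> carrier_vec (dim_col M)"
  show "l2_norm_vec (M *\<^sub>v v) \<le> op_norm M * l2_norm_vec v"
  proof (cases "l2_norm_vec v = 0")
    case True
    obtain C where "0 \<le> C" "norm_le M C" using norm_le_exists by blast
    then have "l2_norm_vec (M *\<^sub>v v) \<le> C * l2_norm_vec v" using v by (simp add: norm_le_def)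
    with True show ?thesis by simp
  next
    case False
    then have pos: "0 < l2_norm_vec v" using l2_norm_vec_nonneg[of v] by simp
    define z where "z = complex_of_real (1 / l2_norm_vec v)"
    have z: "cmod z = 1 / l2_norm_vec v" using pos by (simp add: z_def norm_divide)
    have "l2_norm_vec (M *\<^sub>v (z \<cdot>\<^sub>v v)) \<le> op_norm M"
      using v pos by (intro op_norm_ge) (auto simp: l2_norm_vec_smult z)
    moreover have "M *\<^sub>v (z \<cdot>\<^sub>v v) = z \<cdot>\<^sub>v (M *\<^sub>v v)" using v by (intro eq_vecI) auto
    ultimately show ?thesis using pos by (simp add: l2_norm_vec_smult z field_simps)
  qed
qed

text \<open>Two diagonalizations are intertwined by \<open>W\<close>: its entry at
  \<open>(i, j)\<close> can be nonzero only if the eigenvalues \<open>d j\<close> and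
  \<open>e i\<close> agree, and then their images under \<open>f\<close> agree too. So
  \<open>W\<close> also intertwines the transformed diagonals, and the definite description is
  meaningful for every diagonalization.\<close>

lemma hermitian_fun_eq:
  assumes U: "U \<in> carrier (unitary_group n)"
    and A: "A = U * mat_diag n (\<lambda>i. complex_of_real (d i)) * mat_adjoint U"
  shows "hermitian_fun f A = U * mat_diag n (\<lambda>i. complex_of_real (f (d i))) * mat_adjoint U"
proof -
  note Uc = unitaryD[OF U]
  have dA: "dim_row A = n" using Uc A by simp
  show ?thesis
    unfolding hermitian_fun_def dA
  proof (rule the_equality)
    fix B
    assume "\<exists>V\<in>carrier (unitary_group n). \<exists>e. A = V * mat_diag n (\<lambda>i. complex_of_real (e i)) * mat_adjoint V \<and>
       B = V * mat_diag n (\<lambda>i. complex_of_real (f (e i))) * mat_adjoint V"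
    then obtain V e where V: "V \<in> carrier (unitary_group n)"
      and A': "A = V * mat_diag n (\<lambda>i. complex_of_real (e i)) * mat_adjoint V"
      and B: "B = V * mat_diag n (\<lambda>i. complex_of_real (f (e i))) * mat_adjoint V" by blast
    note Vc = unitaryD[OF V]
    define W where "W = mat_adjoint V * U"
    have W: "W \<in> carrier_mat n n" using Uc Vc by (simp add: W_def sq_mat[where n = n])
    let ?D = "\<lambda>d. mat_diag n (\<lambda>i. complex_of_real (d i))"
    note cU = unitary_cancel[OF U, where k = n] and cV = unitary_cancel[OF V, where k = n]
    note as = sq_mat[where n = n] cU cV
    have VW: "V * W = U"
      using Uc Vc by (simp add: W_def as)
    have WU: "W * mat_adjoint U = mat_adjoint V"
      using Uc Vc by (simp add: W_def as)
    have "W * ?D d = mat_adjoint V * (U * ?D d * mat_adjoint U) * U"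
      using Uc Vc by (simp add: W_def as)
    also have "\<dots> = mat_adjoint V * (V * ?D e * mat_adjoint V) * U" using A A' by simp
    also have "\<dots> = (mat_adjoint V * V) * ?D e * W" using Uc Vc by (simp add: W_def as)
    finally have WD: "W * ?D d = ?D e * W" using Vc W by (simp add: sq_mat[where n = n])
    have ent: "W $$ (i, j) * complex_of_real (d j) = complex_of_real (e i) * W $$ (i, j)"
      if "i < n" "j < n" for i j
      using arg_cong[OF WD, of "\<lambda>M. M $$ (i, j)"] that W
      by (simp add: mat_diag_mult_left[OF W] mat_diag_mult_right[OF W])
    have "W * ?D (\<lambda>i. f (d i)) = ?D (\<lambda>i. f (e i)) * W"
      unfolding mat_diag_mult_left[OF W] mat_diag_mult_right[OF W]
    proof (rule cong_mat[OF refl refl], clarify)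
      fix i j assume "i < n" "j < n"
      then show "W $$ (i, j) * complex_of_real (f (d j)) = complex_of_real (f (e i)) * W $$ (i, j)"
        using ent[of i j] by (cases "W $$ (i, j) = 0") auto
    qed
    then have "V * ((W * ?D (\<lambda>i. f (d i))) * mat_adjoint U) = V * ((?D (\<lambda>i. f (e i)) * W) * mat_adjoint U)"
      by simp
    moreover have "V * ((W * ?D (\<lambda>i. f (d i))) * mat_adjoint U) = (V * W) * ?D (\<lambda>i. f (d i)) * mat_adjoint U"
      using Uc Vc W by (simp add: sq_mat[where n = n])
    moreover have "V * ((?D (\<lambda>i. f (e i)) * W) * mat_adjoint U) = V * ?D (\<lambda>i. f (e i)) * (W * mat_adjoint U)"
      using Uc Vc W by (simp add: sq_mat[where n = n])
    ultimately show "B = U * ?D (\<lambda>i. f (d i)) * mat_adjoint U" using VW WU B by simp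
  qed (use U A in blast)
qed

text \<open>An eigenvector is completed to a basis and orthogonalized; Gram-Schmidt leaves its first
  vector unchanged.\<close>

lemma unitary_eigenvector_first:
  assumes A: "(A :: complex mat) \<in> carrier_mat n n" and n: "n \<noteq> 0"
  obtains W \<mu> where "W \<in> carrier (unitary_group n)" "A *\<^sub>v col W 0 = \<mu> \<cdot>\<^sub>v col W 0"
proof -
  obtain \<mu> where "eigenvalue A \<mu>" using spectrum_non_empty[OF A] n by (auto simp: spectrum_def)
  then obtain v where v: "v \<in> carrier_vec n" "v \<noteq> 0\<^sub>v n" "A *\<^sub>v v = \<mu> \<cdot>\<^sub>v v"
    using A by (auto simp: eigenvalue_def eigenvector_def)
  interpret cof_vec_space n "TYPE(complex)" .
  define b where "b = basis_completion v"
  note b = basis_completion[OF v(1,2), folded b_def]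
  define ws where "ws = gram_schmidt n b"
  have ws: "set ws \<subseteq> carrier_vec n" "corthogonal ws" "length ws = n"
    using gram_schmidt_result[OF b(2) b(4) b(5) ws_def] b(6) by auto
  obtain vs where "b = v # vs" using b(6,7) n by (cases b) auto
  then have "hd ws = v" using gram_schmidt_hd[OF v(1), of vs] by (simp add: ws_def)
  moreover have "ws \<noteq> []" using ws(3) n by auto
  ultimately have hd: "ws ! 0 = v" by (simp add: hd_conv_nth)
  have wc: "ws ! i \<in> carrier_vec n" if "i < n" for i using ws that by auto
  \<comment> \<open>The orthogonalized vectors are not of unit length; \<open>N\<close> holds the
    norms by which the columns of \<open>W\<close> are divided.\<close>
  define N where "N i = complex_of_real (l2_norm_vec (ws ! i))" for i
  have N: "N i \<noteq> 0" "ws ! i \<bullet>c ws ! i = N i * N i" if "i < n" for i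
  proof -
    have "ws ! i \<bullet>c ws ! i \<noteq> 0" using corthogonalD[OF ws(2), of i i] that ws(3) by simp
    moreover show "ws ! i \<bullet>c ws ! i = N i * N i"
      unfolding N_def l2_norm_vec_def sqnorm_cscalar by (simp add: sum_nonneg flip: of_real_mult)
    ultimately show "N i \<noteq> 0" by auto
  qed
  define W where "W = Matrix.mat n n (\<lambda>(i, j). ws ! j $ i / N j)"
  have W: "W \<in> carrier_mat n n" by (simp add: W_def)
  have "mat_adjoint W * W = 1\<^sub>m n"
  proof (rule eq_matI)
    fix i j assume "i < dim_row (1\<^sub>m n :: complex mat)" "j < dim_col (1\<^sub>m n :: complex mat)"
    then have ij: "i < n" "j < n" by auto
    have "(mat_adjoint W * W) $$ (i, j) = (\<Sum>k<n. ws ! j $ k * cnj (ws ! i $ k) / (N j * N i))"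
      using ij W by (auto simp: scalar_prod_def lessThan_atLeast0 W_def N_def ac_simps intro!: sum.cong)
    also have "\<dots> = (ws ! j \<bullet>c ws ! i) / (N j * N i)"
      using wc[OF ij(1)] wc[OF ij(2)] by (simp add: scalar_prod_def lessThan_atLeast0 sum_divide_distrib)
    also have "\<dots> = 1\<^sub>m n $$ (i, j)"
      using ij N corthogonalD[OF ws(2), of j i] ws(3) by auto
    finally show "(mat_adjoint W * W) $$ (i, j) = 1\<^sub>m n $$ (i, j)" .
  qed (use W in auto)
  then have Wu: "W \<in> carrier (unitary_group n)" by (rule unitaryI[OF W])
  have "col W 0 = (1 / N 0) \<cdot>\<^sub>v v"
    using n W v(1) hd by (intro eq_vecI) (auto simp: W_def)
  then have "A *\<^sub>v col W 0 = \<mu> \<cdot>\<^sub>v col W 0"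
    using A v by (simp add: mult_mat_vec smult_smult_assoc mult.commute)
  then show ?thesis using that Wu by blast
qed

lemma unitary_block:
  assumes P: "P \<in> carrier (unitary_group m)"
  shows "four_block_mat (1\<^sub>m 1) (0\<^sub>m 1 m) (0\<^sub>m m 1) P \<in> carrier (unitary_group (Suc m))"
proof (rule unitaryI)
  note Pc = unitaryD[OF P]
  have adj: "mat_adjoint (four_block_mat (1\<^sub>m 1) (0\<^sub>m 1 m) (0\<^sub>m m 1) P) =
    four_block_mat (1\<^sub>m 1) (0\<^sub>m 1 m) (0\<^sub>m m 1) (mat_adjoint P)"
    using Pc by (intro eq_matI) auto
  show "mat_adjoint (four_block_mat (1\<^sub>m 1) (0\<^sub>m 1 m) (0\<^sub>m m 1) P) *
     four_block_mat (1\<^sub>m 1) (0\<^sub>m 1 m) (0\<^sub>m m 1) P = 1\<^sub>m (Suc m)"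
    unfolding adj using Pc
    by (subst mult_four_block_mat[of _ 1 1 _ m _ m _ _ 1 _ m]) auto
  show "four_block_mat (1\<^sub>m 1) (0\<^sub>m 1 m) (0\<^sub>m m 1) P \<in> carrier_mat (Suc m) (Suc m)"
    using four_block_carrier_mat[of "1\<^sub>m 1" 1 1 P m m] Pc by simp
qed

text \<open>Deflation: conjugation by a unitary with an eigenvector as first column clears the first
  column below the diagonal, and self-adjointness clears the first row and makes the eigenvalue
  real. The remaining block is self-adjoint and smaller by one.\<close>

theorem hermitian_diagonalization:
  assumes "(A :: complex mat) \<in> carrier_mat n n" "mat_adjoint A = A"
  shows "\<exists>U\<in>carrier (unitary_group n). \<exists>d :: nat \<Rightarrow> real.
    A = U * mat_diag n (\<lambda>i. complex_of_real (d i)) * mat_adjoint U"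
  using assms
proof (induction n arbitrary: A)
  case 0
  then show ?case by (intro bexI[of _ "1\<^sub>m 0"] exI) (auto simp: unitary_one)
next
  case (Suc m)
  let ?n = "Suc m"
  obtain W \<mu> where W: "W \<in> carrier (unitary_group ?n)" and eig: "A *\<^sub>v col W 0 = \<mu> \<cdot>\<^sub>v col W 0"
    using unitary_eigenvector_first[OF Suc.prems(1)] by blast
  note Wc = unitaryD[OF W]
  note as = sq_mat[where n = ?n] unitary_cancel[OF W, where k = ?n]
  define B where "B = mat_adjoint W * (A * W)"
  have B: "B \<in> carrier_mat ?n ?n" using Wc Suc.prems by (simp add: B_def as)
  have AB: "A = W * B * mat_adjoint W"
    using Wc Suc.prems by (simp add: B_def as)
  have "mat_adjoint B = B"
    using Wc Suc.prems by (simp add: B_def as)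
  then have Bh: "cnj (B $$ (j, i)) = B $$ (i, j)" if "i < ?n" "j < ?n" for i j
    using that B mat_adjoint_index[of i B j] by simp
  have "col B 0 = mat_adjoint W *\<^sub>v (A *\<^sub>v col W 0)"
  proof -
    have "col B 0 = mat_adjoint W *\<^sub>v col (A * W) 0"
      unfolding B_def using Wc Suc.prems by (intro col_mult2[of _ ?n ?n _ ?n]) auto
    also have "col (A * W) 0 = A *\<^sub>v col W 0"
      using Wc Suc.prems by (intro col_mult2[of _ ?n ?n _ ?n]) auto
    finally show ?thesis .
  qed
  also have "\<dots> = \<mu> \<cdot>\<^sub>v col (mat_adjoint W * W) 0"
  proof -
    have "mat_adjoint W *\<^sub>v (\<mu> \<cdot>\<^sub>v col W 0) = \<mu> \<cdot>\<^sub>v (mat_adjoint W *\<^sub>v col W 0)"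
      using Wc by (intro mult_mat_vec) auto
    moreover have "mat_adjoint W *\<^sub>v col W 0 = col (mat_adjoint W * W) 0"
      using Wc by (intro col_mult2[symmetric]) auto
    ultimately show ?thesis unfolding eig by simp
  qed
  finally have colB: "col B 0 = \<mu> \<cdot>\<^sub>v unit_vec ?n 0" using Wc by simp
  have B0: "B $$ (i, 0) = (if i = 0 then \<mu> else 0)" if "i < ?n" for i
    using arg_cong[OF colB, of "\<lambda>v. v $ i"] that B by (auto simp: unit_vec_def)
  have lam: "\<mu> = complex_of_real (Re \<mu>)"
    using Bh[of 0 0] B0[of 0] by (simp add: complex_eq_iff)
  define C where "C = Matrix.mat m m (\<lambda>(i, j). B $$ (Suc i, Suc j))"
  have C: "C \<in> carrier_mat m m" by (simp add: C_def)
  have "mat_adjoint C = C" using Bh by (intro eq_matI) (auto simp: C_def)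
  then obtain P d where P: "P \<in> carrier (unitary_group m)"
    and CP: "C = P * mat_diag m (\<lambda>i. complex_of_real (d i)) * mat_adjoint P"
    using Suc.IH[OF C] by blast
  note Pc = unitaryD[OF P]
  have Bblock: "B = four_block_mat (\<mu> \<cdot>\<^sub>m 1\<^sub>m 1) (0\<^sub>m 1 m) (0\<^sub>m m 1) C"
  proof (rule eq_matI)
    fix i j assume "i < dim_row (four_block_mat (\<mu> \<cdot>\<^sub>m 1\<^sub>m 1) (0\<^sub>m 1 m) (0\<^sub>m m 1) C)"
      "j < dim_col (four_block_mat (\<mu> \<cdot>\<^sub>m 1\<^sub>m 1) (0\<^sub>m 1 m) (0\<^sub>m m 1) C)"
    then have ij: "i < ?n" "j < ?n" using C by auto
    show "B $$ (i, j) = four_block_mat (\<mu> \<cdot>\<^sub>m 1\<^sub>m 1) (0\<^sub>m 1 m) (0\<^sub>m m 1) C $$ (i, j)"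
      using ij B0[of i] B0[of j] Bh[of 0 j] C
      by (cases i; cases j) (auto simp: C_def)
  qed (use B C in auto)
  define Q where "Q = four_block_mat (1\<^sub>m 1) (0\<^sub>m 1 m) (0\<^sub>m m 1) P"
  define e where "e i = (if i = 0 then Re \<mu> else d (i - 1))" for i
  have Q: "Q \<in> carrier (unitary_group ?n)" unfolding Q_def by (rule unitary_block[OF P])
  note Qc = unitaryD[OF Q]
  have De: "mat_diag ?n (\<lambda>i. complex_of_real (e i)) =
      four_block_mat (\<mu> \<cdot>\<^sub>m 1\<^sub>m 1) (0\<^sub>m 1 m) (0\<^sub>m m 1) (mat_diag m (\<lambda>i. complex_of_real (d i)))"
    using lam by (intro eq_matI) (auto simp: mat_diag_def e_def)
  have adjQ: "mat_adjoint Q = four_block_mat (1\<^sub>m 1) (0\<^sub>m 1 m) (0\<^sub>m m 1) (mat_adjoint P)"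
    using Pc unfolding Q_def by (intro eq_matI) auto
  have QB: "Q * mat_diag ?n (\<lambda>i. complex_of_real (e i)) * mat_adjoint Q = B"
    unfolding De Bblock adjQ CP unfolding Q_def using Pc
    apply (subst mult_four_block_mat[of _ 1 1 _ m _ m _ _ 1 _ m])
    apply (simp_all add: sq_mat[where n = m] carrier_matD[OF mat_diag_dim])
    apply (subst mult_four_block_mat[of _ 1 1 _ m _ m _ _ 1 _ m])
    apply (auto simp: sq_mat[where n = m] carrier_matD[OF mat_diag_dim])
    done
  have "A = (W * Q) * mat_diag ?n (\<lambda>i. complex_of_real (e i)) * mat_adjoint (W * Q)"
    using AB Wc Qc B by (simp add: as flip: QB)
  then show ?case using unitary_mult[OF W Q] by blast
qed

section \<open>Traces and Schatten norms\<close>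

lemma mat_trace_conj_diag:
  assumes U: "U \<in> carrier (unitary_group n)"
  shows "mat_trace (U * mat_diag n (\<lambda>i. complex_of_real (d i)) * mat_adjoint U) = of_real (\<Sum>i<n. d i)"
proof -
  note Uc = unitaryD[OF U]
  have "mat_trace (U * mat_diag n (\<lambda>i. complex_of_real (d i)) * mat_adjoint U)
      = (\<Sum>i<n. \<Sum>k<n. U $$ (i, k) * d k * cnj (U $$ (i, k)))"
    using Uc by (auto simp: mat_trace_def mat_diag_mult_right[of _ n n] scalar_prod_def lessThan_atLeast0
        intro!: sum.cong)
  also have "\<dots> = (\<Sum>k<n. \<Sum>i<n. d k * (cnj (U $$ (i, k)) * U $$ (i, k)))"
    by (subst sum.swap) (simp add: ac_simps)
  also have "\<dots> = (\<Sum>k<n. d k * (mat_adjoint U * U) $$ (k, k))"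
    using Uc(1) by (auto simp: scalar_prod_def lessThan_atLeast0 sum_distrib_left intro!: sum.cong)
  finally show ?thesis using Uc(3) by simp
qed

lemma hermitian_fun_scalar:
  "hermitian_fun f (complex_of_real a \<cdot>\<^sub>m 1\<^sub>m n) = complex_of_real (f a) \<cdot>\<^sub>m 1\<^sub>m n"
proof -
  have diag: "complex_of_real b \<cdot>\<^sub>m 1\<^sub>m n = 1\<^sub>m n * mat_diag n (\<lambda>i. complex_of_real b) * mat_adjoint (1\<^sub>m n)"
    for b by (simp add: sq_mat[where n = n]) (auto simp: mat_diag_def)
  show ?thesis
    using hermitian_fun_eq[OF unitary_one diag, of f a] unfolding diag[of "f a"] .
qed

lemma adjoint_mult_smult_unitary:
  assumes U: "U \<in> carrier (unitary_group n)"
  shows "mat_adjoint (z \<cdot>\<^sub>m U) * (z \<cdot>\<^sub>m U) = complex_of_real ((cmod z)\<^sup>2) \<cdot>\<^sub>m 1\<^sub>m n"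
proof -
  note Uc = unitaryD[OF U]
  have "mat_adjoint (z \<cdot>\<^sub>m U) * (z \<cdot>\<^sub>m U) = z \<cdot>\<^sub>m (cnj z \<cdot>\<^sub>m (mat_adjoint U * U))"
    using Uc by (simp add: mat_adjoint_smult mult_smult_distrib[of _ n n _ n]
        mult_smult_assoc_mat[of _ n n _ n])
  also have "\<dots> = complex_of_real ((cmod z)\<^sup>2) \<cdot>\<^sub>m 1\<^sub>m n"
    unfolding complex_norm_square using Uc by (intro eq_matI) auto
  finally show ?thesis .
qed

text \<open>All n singular values of \<open>z \<cdot>\<^sub>m U\<close> equal \<open>cmod z\<close>.
  This is the origin of the growth exponent 1/p.\<close>

lemma schatten_norm_smult_unitary:
  assumes U: "U \<in> carrier (unitary_group n)" and p: "0 < p"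
  shows "schatten_norm (ereal p) (z \<cdot>\<^sub>m U) = real n powr (1 / p) * cmod z"
proof -
  have abs: "mat_abs (z \<cdot>\<^sub>m U) = complex_of_real (cmod z) \<cdot>\<^sub>m 1\<^sub>m n"
    unfolding mat_abs_def adjoint_mult_smult_unitary[OF U] hermitian_fun_scalar by simp
  have "Re (mat_trace (hermitian_fun (\<lambda>t. t powr p) (mat_abs (z \<cdot>\<^sub>m U)))) = real n * cmod z powr p"
    unfolding abs hermitian_fun_scalar by (simp add: mat_trace_def)
  then show ?thesis using p by (simp add: schatten_norm_def powr_mult powr_powr)
qed

text \<open>The largest singular value is at most the p-norm of all of them. In an eigenbasis of
  \<open>mat_adjoint M * M\<close> the squared length of \<open>M *\<^sub>v v\<close> is a sum of
  squared coordinates weighted by the eigenvalues \<open>d k\<close>.\<close>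

lemma norm_le_schatten_norm:
  assumes M: "(M :: complex mat) \<in> carrier_mat n n" and p: "0 < p"
  shows "norm_le M (schatten_norm (ereal p) M)"
proof -
  define A where "A = mat_adjoint M * M"
  have A: "A \<in> carrier_mat n n" "mat_adjoint A = A"
    using M by (simp_all add: A_def sq_mat[where n = n])
  obtain U d where U: "U \<in> carrier (unitary_group n)"
    and AU: "A = U * mat_diag n (\<lambda>i. complex_of_real (d i)) * mat_adjoint U"
    using hermitian_diagonalization[OF A] by blast
  note Uc = unitaryD[OF U]
  let ?s = "schatten_norm (ereal p) M"
  have sq: "complex_of_real ((l2_norm_vec (M *\<^sub>v v))\<^sup>2)
      = of_real (\<Sum>k<n. d k * (cmod ((mat_adjoint U *\<^sub>v v) $ k))\<^sup>2)" if v: "v \<in> carrier_vec n" for v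
  proof -
    define w where "w = mat_adjoint U *\<^sub>v v"
    have w: "w \<in> carrier_vec n" using Uc v by (simp add: w_def mult_mat_vec_carrier[of _ n n])
    have n2: "complex_of_real ((l2_norm_vec (M *\<^sub>v v))\<^sup>2) = (M *\<^sub>v v) \<bullet>c (M *\<^sub>v v)"
      unfolding l2_norm_vec_def sqnorm_cscalar by (simp add: sum_nonneg)
    have "(M *\<^sub>v v) \<bullet>c (M *\<^sub>v v) = v \<bullet>c (A *\<^sub>v v)"
      using mat_adjoint_inner[OF M v, of "M *\<^sub>v v"] M v
      by (simp add: A_def assoc_mult_mat_vec[of _ n n _ n])
    also have "\<dots> = (U *\<^sub>v w) \<bullet>c (A *\<^sub>v v)" using unitary_cancel_vec[OF U v] by (simp add: w_def)
    also have "\<dots> = w \<bullet>c (mat_adjoint U *\<^sub>v (A *\<^sub>v v))"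
      using Uc w A v by (intro mat_adjoint_inner) auto
    also have "mat_adjoint U *\<^sub>v (A *\<^sub>v v) = mat_diag n (\<lambda>i. complex_of_real (d i)) *\<^sub>v w"
    proof -
      have "A *\<^sub>v v = U *\<^sub>v (mat_diag n (\<lambda>i. complex_of_real (d i)) *\<^sub>v w)"
        using Uc v unfolding AU w_def
        by (simp add: assoc_mult_mat_vec[of _ n n _ n] sq_mat[where n = n])
      moreover have "mat_diag n (\<lambda>i. complex_of_real (d i)) *\<^sub>v w \<in> carrier_vec n"
        using w by (auto simp: mult_mat_vec_carrier[of _ n n])
      ultimately show ?thesis using unitary_cancel_vec[OF U] by simp
    qed
    also have "mat_diag n (\<lambda>i. complex_of_real (d i)) *\<^sub>v w = vec n (\<lambda>k. d k * w $ k)"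
    proof (rule eq_vecI)
      fix i assume i: "i < dim_vec (vec n (\<lambda>k. d k * w $ k))"
      then show "(mat_diag n (\<lambda>i. complex_of_real (d i)) *\<^sub>v w) $ i = vec n (\<lambda>k. d k * w $ k) $ i"
        using w by (simp add: mat_diag_def scalar_prod_def if_distrib[where f = "\<lambda>x. x * _"] cong: if_cong)
    qed (simp add: mat_diag_def)
    also have "w \<bullet>c vec n (\<lambda>k. d k * w $ k) = of_real (\<Sum>k<n. d k * (cmod (w $ k))\<^sup>2)"
      using w unfolding scalar_prod_def of_real_sum
      by (auto simp: lessThan_atLeast0 complex_norm_square ac_simps simp del: of_real_power intro!: sum.cong)
    finally show ?thesis using n2 by (simp add: w_def)
  qed
  then have sq': "(l2_norm_vec (M *\<^sub>v v))\<^sup>2 = (\<Sum>k<n. d k * (cmod ((mat_adjoint U *\<^sub>v v) $ k))\<^sup>2)"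
    if "v \<in> carrier_vec n" for v
    using that of_real_eq_iff by blast
  \<comment> \<open>\<open>d k\<close> is the squared length of the image under \<open>M\<close> of
    the k-th eigenvector.\<close>
  have d0: "0 \<le> d k" if k: "k < n" for k
  proof -
    have "mat_adjoint U *\<^sub>v (U *\<^sub>v unit_vec n k) = unit_vec n k"
      using unitary_cancel_vec[OF U, of "unit_vec n k"] by simp
    then have "(l2_norm_vec (M *\<^sub>v (U *\<^sub>v unit_vec n k)))\<^sup>2 = (\<Sum>j<n. d j * (cmod (unit_vec n k $ j))\<^sup>2)"
      using sq'[of "U *\<^sub>v unit_vec n k"] Uc by simp
    also have "\<dots> = (\<Sum>j<n. if j = k then d j else 0)"
      by (intro sum.cong) (auto simp: unit_vec_def)
    finally have "(l2_norm_vec (M *\<^sub>v (U *\<^sub>v unit_vec n k)))\<^sup>2 = d k" using k by simp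
    then show ?thesis by (metis zero_le_power2)
  qed
  have absM: "mat_abs M = U * mat_diag n (\<lambda>i. complex_of_real (sqrt (d i))) * mat_adjoint U"
    unfolding mat_abs_def A_def[symmetric] by (rule hermitian_fun_eq[OF U AU])
  have tr: "Re (mat_trace (hermitian_fun (\<lambda>t. t powr p) (mat_abs M))) = (\<Sum>i<n. sqrt (d i) powr p)"
    unfolding hermitian_fun_eq[OF U absM] mat_trace_conj_diag[OF U] by simp
  have sch: "?s = (\<Sum>i<n. sqrt (d i) powr p) powr (1 / p)"
    using tr by (simp add: schatten_norm_def)
  have ds: "d k \<le> ?s\<^sup>2" if k: "k < n" for k
  proof -
    have "sqrt (d k) = (sqrt (d k) powr p) powr (1 / p)"
      using p d0[OF k] by (simp add: powr_powr)
    also have "\<dots> \<le> ?s"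
      unfolding sch using k p
      by (intro powr_mono2 member_le_sum[where f = "\<lambda>i. sqrt (d i) powr p"]) auto
    finally have "(sqrt (d k))\<^sup>2 \<le> ?s\<^sup>2" using d0[OF k] by (intro power_mono) auto
    then show ?thesis using d0[OF k] by simp
  qed
  have s0: "0 \<le> ?s" by (simp add: schatten_norm_def)
  show ?thesis
    unfolding norm_le_def
  proof
    fix v :: "complex vec" assume "v \<in> carrier_vec (dim_col M)"
    then have v: "v \<in> carrier_vec n" using M by simp
    let ?w = "mat_adjoint U *\<^sub>v v"
    have w: "dim_vec ?w = n" using Uc by simp
    have "(l2_norm_vec (M *\<^sub>v v))\<^sup>2 \<le> (\<Sum>k<n. ?s\<^sup>2 * (cmod (?w $ k))\<^sup>2)"
      unfolding sq'[OF v] using ds by (intro sum_mono mult_right_mono) auto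
    also have "\<dots> = ?s\<^sup>2 * (l2_norm_vec ?w)\<^sup>2"
      unfolding l2_norm_vec_alt L2_set_def w by (simp add: sum_nonneg sum_distrib_left)
    also have "\<dots> = (?s * l2_norm_vec v)\<^sup>2"
      using unitary_norm[OF unitary_adjoint[OF U] v] by (simp add: power_mult_distrib)
    finally show "l2_norm_vec (M *\<^sub>v v) \<le> ?s * l2_norm_vec v"
      by (rule power2_le_imp_le) (use s0 l2_norm_vec_nonneg[of v] in simp)
  qed
qed

text \<open>What the argument needs of the operator norm (\<open>e = 0\<close>) and of the Schatten \<open>p\<close>-norm (\<open>e = 1 / p\<close>).\<close>

definition unitary_norm_growth :: "(complex mat \<Rightarrow> real) \<Rightarrow> real \<Rightarrow> bool" where
  "unitary_norm_growth N e \<longleftrightarrow> (\<forall>n M. M \<in> carrier_mat n n \<longrightarrow> 0 \<le> N M \<and> norm_le M (N M)) \<and>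
     (\<forall>n z. \<forall>U\<in>carrier (unitary_group n). n \<ge> 1 \<longrightarrow> N (z \<cdot>\<^sub>m U) \<le> real n powr e * cmod z)"

lemma unitary_norm_growth_op: "unitary_norm_growth op_norm 0"
  unfolding unitary_norm_growth_def
proof (intro conjI allI impI ballI)
  fix n :: nat and z U assume U: "U \<in> carrier (unitary_group n)" "n \<ge> 1"
  have "norm_le (z \<cdot>\<^sub>m U) (cmod z * 1)"
    using norm_le_unitary[OF U(1)] unitaryD[OF U(1)] by (intro norm_le_smult[of _ n n])
  then show "op_norm (z \<cdot>\<^sub>m U) \<le> real n powr 0 * cmod z"
    using U by (intro op_norm_leI) auto
qed (rule op_norm_nonneg norm_le_op_norm)+

text \<open>The hypothesis \<open>1 < p\<close> enters here: it makes the exponent smaller than 1,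
  so that a dimension of order n cannot outweigh the factor 1/n of the defect.\<close>

lemma unitary_norm_growth_schatten:
  assumes "1 < p"
  shows "\<exists>e. 0 \<le> e \<and> e < 1 \<and> unitary_norm_growth (schatten_norm p) e"
proof (cases p)
  case (real r)
  then have "1 < r" using assms by simp
  then have "unitary_norm_growth (schatten_norm p) (1 / r)" "0 \<le> 1 / r" "1 / r < 1"
    unfolding unitary_norm_growth_def real
    by (auto simp: schatten_norm_smult_unitary norm_le_schatten_norm) (simp add: schatten_norm_def)
  then show ?thesis by blast
next
  case PInf
  then have "schatten_norm p = op_norm" by (auto simp: schatten_norm_def)
  then show ?thesis using unitary_norm_growth_op by (intro exI[of _ 0]) simp
next
  case MInf
  then show ?thesis using assms by simp
qed

text \<open>Conjugation fixes 1, hence carries the segment from 1 to \<open>u\<close> to the segment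
  from 1 to the conjugate, and preserves determinants. The additivity argument in
  \<open>no_nearby_homs\<close> produces such a conjugate.\<close>

lemma det_log_conj:
  assumes P: "P \<in> carrier (unitary_group n)" and u: "u \<in> carrier_mat n n" and z: "det_log u z"
  shows "det_log (P * u * mat_adjoint P) z"
proof -
  note Pc = unitaryD[OF P]
  have "det (1\<^sub>m n + of_real t \<cdot>\<^sub>m (P * u * mat_adjoint P - 1\<^sub>m n)) = det (1\<^sub>m n + of_real t \<cdot>\<^sub>m (u - 1\<^sub>m n))"
    for t :: real
  proof -
    let ?A = "1\<^sub>m n + of_real t \<cdot>\<^sub>m (u - 1\<^sub>m n)"
    have A: "?A \<in> carrier_mat n n" by (intro add_carrier_mat smult_carrier_mat minus_carrier_mat) simp
    have dP: "det P * det (mat_adjoint P) = 1"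
      using Pc by (simp flip: det_mult[of P n "mat_adjoint P"])
    have "P * ?A = P * 1\<^sub>m n + P * (of_real t \<cdot>\<^sub>m (u - 1\<^sub>m n))"
      using Pc u by (intro mult_add_distrib_mat) auto
    also have "P * (of_real t \<cdot>\<^sub>m (u - 1\<^sub>m n)) = of_real t \<cdot>\<^sub>m (P * (u - 1\<^sub>m n))"
      using Pc u by (intro mult_smult_distrib) auto
    also have "P * (u - 1\<^sub>m n) = P * u - P * 1\<^sub>m n"
      using Pc u by (intro mult_minus_distrib_mat) auto
    finally have "P * ?A * mat_adjoint P = (P + of_real t \<cdot>\<^sub>m (P * u - P)) * mat_adjoint P"
      using Pc by simp
    also have "\<dots> = P * mat_adjoint P + (of_real t \<cdot>\<^sub>m (P * u - P)) * mat_adjoint P"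
      using Pc u by (intro add_mult_distrib_mat[of _ n n]) (auto simp: sq_mat[where n = n])
    also have "(of_real t \<cdot>\<^sub>m (P * u - P)) * mat_adjoint P = of_real t \<cdot>\<^sub>m ((P * u - P) * mat_adjoint P)"
      using Pc u by (intro mult_smult_assoc_mat[of _ n n]) (auto simp: sq_mat[where n = n])
    also have "(P * u - P) * mat_adjoint P = P * u * mat_adjoint P - P * mat_adjoint P"
      using Pc u by (intro minus_mult_distrib_mat[of _ n n]) (auto simp: sq_mat[where n = n])
    finally have "P * ?A * mat_adjoint P = 1\<^sub>m n + of_real t \<cdot>\<^sub>m (P * u * mat_adjoint P - 1\<^sub>m n)"
      using Pc by simp
    moreover have "det (P * ?A * mat_adjoint P) = det P * det (mat_adjoint P) * det ?A"
      using Pc A by (simp add: det_mult[of _ n] sq_mat[where n = n])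
    ultimately show ?thesis using dP by simp
  qed
  then show ?thesis using z Pc u by (simp add: det_log_def)
qed

text \<open>In contrast to \<open>norm_le_mult\<close>, no sign of \<open>e\<close> is required,
  because the right factor preserves lengths.\<close>

lemma norm_le_mult_adjoint:
  assumes P: "P \<in> carrier (unitary_group n)" and A: "A \<in> carrier_mat n n" and e: "norm_le A e"
  shows "norm_le (A * mat_adjoint P) e"
  unfolding norm_le_def
proof
  note Pc = unitaryD[OF P]
  fix v :: "complex vec" assume "v \<in> carrier_vec (dim_col (A * mat_adjoint P))"
  then have v: "v \<in> carrier_vec n" using Pc by simp
  have "(A * mat_adjoint P) *\<^sub>v v = A *\<^sub>v (mat_adjoint P *\<^sub>v v)"
    using Pc A v by (intro assoc_mult_mat_vec[of _ n n _ n]) auto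
  then have "l2_norm_vec ((A * mat_adjoint P) *\<^sub>v v) \<le> e * l2_norm_vec (mat_adjoint P *\<^sub>v v)"
    using e Pc A v by (auto simp: norm_le_def mult_mat_vec_carrier[of _ n n])
  then show "l2_norm_vec ((A * mat_adjoint P) *\<^sub>v v) \<le> e * l2_norm_vec v"
    using unitary_norm[OF unitary_adjoint[OF P] v] by simp
qed

lemma norm_le_right_unitary:
  assumes P: "P \<in> carrier (unitary_group n)" and u: "u \<in> carrier_mat n n" and e: "norm_le (u - P) e"
  shows "norm_le (u * mat_adjoint P - 1\<^sub>m n) e"
proof -
  note Pc = unitaryD[OF P]
  have "(u - P) * mat_adjoint P = u * mat_adjoint P - P * mat_adjoint P"
    using Pc u by (intro minus_mult_distrib_mat[of _ n n]) auto
  moreover have "u - P \<in> carrier_mat n n" using Pc by (intro minus_carrier_mat)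
  ultimately show ?thesis using norm_le_mult_adjoint[OF P _ e] Pc by simp
qed

lemma norm_le_conj:
  assumes P: "P \<in> carrier (unitary_group n)" and u: "u \<in> carrier_mat n n" and e: "norm_le (u - 1\<^sub>m n) e"
  shows "norm_le (P * u * mat_adjoint P - 1\<^sub>m n) e"
proof (rule norm_le_right_unitary[OF P])
  note Pc = unitaryD[OF P]
  show "P * u \<in> carrier_mat n n" using Pc u by simp
  have "P * (u - 1\<^sub>m n) = P * u - P * 1\<^sub>m n"
    using Pc u by (intro mult_minus_distrib_mat) auto
  moreover have "norm_le (P * (u - 1\<^sub>m n)) (1 * e)"
    using Pc u by (intro norm_le_mult[OF Pc(1) _ norm_le_unitary[OF P] e]) auto
  ultimately show "norm_le (P * u - P) e" using Pc by simp
qed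

section \<open>Classes of infinite order and the derived subgroup of an extension\<close>

lemma tuples_1: "xs \<in> tuples G 1 \<longleftrightarrow> (\<exists>s\<in>carrier G. xs = [s])"
  by (auto simp: tuples_def length_Suc_conv)

lemma tuples_2: "xs \<in> tuples G 2 \<longleftrightarrow> (\<exists>s\<in>carrier G. \<exists>t\<in>carrier G. xs = [s, t])"
  by (auto simp: tuples_def length_Suc_conv numeral_2_eq_2)

lemma tuples_3: "xs \<in> tuples G 3 \<longleftrightarrow>
    (\<exists>s\<in>carrier G. \<exists>t\<in>carrier G. \<exists>u\<in>carrier G. xs = [s, t, u])"
  by (auto simp: tuples_def length_Suc_conv numeral_3_eq_3)

lemma cochain_group_simps:
  "carrier (cochain_group G n) = (\<Pi>\<^sub>E xs\<in>tuples G n. UNIV)"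
  "f \<otimes>\<^bsub>cochain_group G n\<^esub> g = (\<lambda>xs\<in>tuples G n. f xs + g xs)"
  "\<one>\<^bsub>cochain_group G n\<^esub> = (\<lambda>xs\<in>tuples G n. 0)"
  by (simp_all add: cochain_group_def product_group_def)

lemma comm_group_cochain_group: "comm_group (cochain_group G n)"
proof (rule group.group_comm_groupI)
  show "group (cochain_group G n)" by (simp add: cochain_group_def)
qed (auto simp: cochain_group_simps add.commute)

lemma coboundary_1:
  "s \<in> carrier G \<Longrightarrow> t \<in> carrier G \<Longrightarrow> coboundary G 1 f [s, t] = f [t] - f [s \<otimes>\<^bsub>G\<^esub> t] + f [s]"
  using tuples_2[of "[s, t]" G] by (simp add: coboundary_def merge_def numeral_2_eq_2)

lemma coboundary_2:
  "s \<in> carrier G \<Longrightarrow> t \<in> carrier G \<Longrightarrow> u \<in> carrier G \<Longrightarrow> coboundary G 2 f [s, t, u] =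
    f [t, u] - f [s \<otimes>\<^bsub>G\<^esub> t, u] + f [s, t \<otimes>\<^bsub>G\<^esub> u] - f [s, t]"
  using tuples_3[of "[s, t, u]" G] by (simp add: coboundary_def merge_def numeral_3_eq_3 numeral_2_eq_2)

lemma coboundary_extensional: "coboundary G n f \<in> extensional (tuples G (Suc n))"
  by (simp add: coboundary_def)

lemma coboundary_eqI:
  assumes "g \<in> extensional (tuples G (Suc n))"
    and "\<And>xs. xs \<in> tuples G (Suc n) \<Longrightarrow> coboundary G n f xs = g xs"
  shows "coboundary G n f = g"
  using assms coboundary_extensional by (intro extensionalityI)

lemma (in group) int_cocycle_eqI:
  assumes "\<And>s t. s \<in> carrier G \<Longrightarrow> t \<in> carrier G \<Longrightarrow> c s t = m * a s t + n * b s t"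
    "int_cocycle G a" "int_cocycle G b"
  shows "int_cocycle G c"
  unfolding int_cocycle_def
proof (intro ballI)
  fix s t u assume m: "s \<in> carrier G" "t \<in> carrier G" "u \<in> carrier G"
  have "c s t + c (s \<otimes> t) u = m * (a s t + a (s \<otimes> t) u) + n * (b s t + b (s \<otimes> t) u)"
    using m by (simp add: assms(1) algebra_simps)
  also have "\<dots> = m * (a t u + a s (t \<otimes> u)) + n * (b t u + b s (t \<otimes> u))"
    using int_cocycleD[OF assms(2) m] int_cocycleD[OF assms(3) m] by simp
  also have "\<dots> = c t u + c s (t \<otimes> u)"
    using m by (simp add: assms(1) algebra_simps)
  finally show "c s t + c (s \<otimes> t) u = c t u + c s (t \<otimes> u)" .
qed

lemma cocycles_2_iff:
  "f \<in> cocycles G 2 \<longleftrightarrow> f \<in> carrier (cochain_group G 2) \<and> int_cocycle G (\<lambda>s t. f [s, t])"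
proof -
  have "coboundary G 2 f = (\<lambda>xs\<in>tuples G 3. 0) \<longleftrightarrow> int_cocycle G (\<lambda>s t. f [s, t])"
  proof
    assume eq: "coboundary G 2 f = (\<lambda>xs\<in>tuples G 3. 0)"
    show "int_cocycle G (\<lambda>s t. f [s, t])"
      unfolding int_cocycle_def
    proof (intro ballI)
      fix s t u assume m: "s \<in> carrier G" "t \<in> carrier G" "u \<in> carrier G"
      have "coboundary G 2 f [s, t, u] = 0" unfolding eq using m tuples_3[of "[s, t, u]" G] by simp
      then show "f [s, t] + f [s \<otimes>\<^bsub>G\<^esub> t, u] = f [t, u] + f [s, t \<otimes>\<^bsub>G\<^esub> u]"
        unfolding coboundary_2[OF m] by simp
    qed
  next
    assume c: "int_cocycle G (\<lambda>s t. f [s, t])"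
    show "coboundary G 2 f = (\<lambda>xs\<in>tuples G 3. 0)"
    proof (rule coboundary_eqI)
      fix xs assume "xs \<in> tuples G (Suc 2)"
      then have xs: "xs \<in> tuples G 3" by (simp add: eval_nat_numeral)
      then obtain s t u where m: "s \<in> carrier G" "t \<in> carrier G" "u \<in> carrier G" "xs = [s, t, u]"
        by (auto simp: tuples_3)
      show "coboundary G 2 f xs = (\<lambda>xs\<in>tuples G 3. 0) xs"
        using int_cocycleD[OF c m(1-3)] coboundary_2[OF m(1-3), of f] xs m(4) by simp
    qed (simp add: eval_nat_numeral)
  qed
  then show ?thesis by (auto simp: cocycles_def kernel_def cochain_group_simps numeral_3_eq_3)
qed

lemma coboundaries_2: "coboundaries G 2 = coboundary G 1 ` carrier (cochain_group G 1)"
  by (simp add: coboundaries_def numeral_2_eq_2)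

context group
begin

lemma coboundary_1_add:
  "coboundary G 1 (f \<otimes>\<^bsub>cochain_group G 1\<^esub> g) = coboundary G 1 f \<otimes>\<^bsub>cochain_group G 2\<^esub> coboundary G 1 g"
proof (rule coboundary_eqI)
  show "coboundary G 1 f \<otimes>\<^bsub>cochain_group G 2\<^esub> coboundary G 1 g \<in> extensional (tuples G (Suc 1))"
    by (simp add: cochain_group_simps numeral_2_eq_2)
  fix xs assume "xs \<in> tuples G (Suc 1)"
  then obtain s t where "s \<in> carrier G" "t \<in> carrier G" "xs = [s, t]"
    using tuples_2[of xs G] by (auto simp: numeral_2_eq_2)
  then show "coboundary G 1 (f \<otimes>\<^bsub>cochain_group G 1\<^esub> g) xs =
      (coboundary G 1 f \<otimes>\<^bsub>cochain_group G 2\<^esub> coboundary G 1 g) xs"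
    using tuples_1[of _ G] tuples_2[of _ G]
    by (auto simp: cochain_group_simps coboundary_1[unfolded One_nat_def])
qed

lemma int_cocycle_coboundary: "int_cocycle G (\<lambda>s t. coboundary G 1 f [s, t])"
  by (simp add: int_cocycle_def coboundary_1[unfolded One_nat_def] m_assoc)

lemma coboundary_1_closed: "coboundary G 1 f \<in> carrier (cochain_group G 2)"
  using coboundary_extensional[of G 1 f]
  by (simp add: cochain_group_simps PiE_def numeral_2_eq_2)

lemma subgroup_coboundaries_2: "subgroup (coboundaries G 2) (cochain_group G 2)"
proof -
  interpret C1: comm_group "cochain_group G 1" by (rule comm_group_cochain_group)
  interpret C2: comm_group "cochain_group G 2" by (rule comm_group_cochain_group)
  interpret group_hom "cochain_group G 1" "cochain_group G 2" "coboundary G 1"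
    by unfold_locales (auto simp: hom_def coboundary_1_closed[unfolded One_nat_def]
        coboundary_1_add[unfolded One_nat_def])
  show ?thesis unfolding coboundaries_2 by (rule img_is_subgroup)
qed

lemma coboundaries_2_subset: "coboundaries G 2 \<subseteq> cocycles G 2"
  unfolding coboundaries_2 using coboundary_1_closed int_cocycle_coboundary
  by (auto simp: cocycles_2_iff)

lemma subgroup_cocycles_2: "subgroup (cocycles G 2) (cochain_group G 2)"
proof -
  interpret C2: comm_group "cochain_group G 2" by (rule comm_group_cochain_group)
  show ?thesis
  proof (rule C2.subgroupI)
    show "cocycles G 2 \<subseteq> carrier (cochain_group G 2)" by (auto simp: cocycles_2_iff)
    show "cocycles G 2 \<noteq> {}"
      using coboundaries_2_subset subgroup.one_closed[OF subgroup_coboundaries_2] by blast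
  next
    fix a assume a: "a \<in> cocycles G 2"
    define b where "b = inv\<^bsub>cochain_group G 2\<^esub> a"
    have b: "b \<in> carrier (cochain_group G 2)" "a \<otimes>\<^bsub>cochain_group G 2\<^esub> b = \<one>\<^bsub>cochain_group G 2\<^esub>"
      using a by (auto simp: b_def cocycles_2_iff)
    have "b [s, t] = - a [s, t]" if "s \<in> carrier G" "t \<in> carrier G" for s t
      using fun_cong[OF b(2), of "[s, t]"] that tuples_2[of "[s, t]" G] by (simp add: cochain_group_simps)
    then have "int_cocycle G (\<lambda>s t. b [s, t])"
      using a by (auto simp: cocycles_2_iff
          intro: int_cocycle_eqI[where m = "-1" and a = "\<lambda>s t. a [s, t]" and n = 0 and b = "\<lambda>s t. a [s, t]"])
    then show "b \<in> cocycles G 2" using b by (simp add: cocycles_2_iff)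
  next
    fix a b assume ab: "a \<in> cocycles G 2" "b \<in> cocycles G 2"
    have "(a \<otimes>\<^bsub>cochain_group G 2\<^esub> b) [s, t] = a [s, t] + b [s, t]" if "s \<in> carrier G" "t \<in> carrier G" for s t
      using that tuples_2[of "[s, t]" G] by (simp add: cochain_group_simps)
    then have "int_cocycle G (\<lambda>s t. (a \<otimes>\<^bsub>cochain_group G 2\<^esub> b) [s, t])"
      using ab by (auto simp: cocycles_2_iff
          intro: int_cocycle_eqI[where m = 1 and a = "\<lambda>s t. a [s, t]" and n = 1 and b = "\<lambda>s t. b [s, t]"])
    moreover have "a \<otimes>\<^bsub>cochain_group G 2\<^esub> b \<in> carrier (cochain_group G 2)"
      using ab by (intro C2.m_closed) (auto simp: cocycles_2_iff)
    ultimately show "a \<otimes>\<^bsub>cochain_group G 2\<^esub> b \<in> cocycles G 2" by (simp add: cocycles_2_iff)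
  qed
qed

abbreviation cocycle_group_2 :: "('a list \<Rightarrow> int) monoid" where
  "cocycle_group_2 \<equiv> (cochain_group G 2)\<lparr>carrier := cocycles G 2\<rparr>"

lemma normal_coboundaries_2: "coboundaries G 2 \<lhd> cocycle_group_2"
proof -
  interpret C2: comm_group "cochain_group G 2" by (rule comm_group_cochain_group)
  interpret Z2: comm_group cocycle_group_2
    by (rule group.group_comm_groupI[OF C2.subgroup_imp_group[OF subgroup_cocycles_2]])
      (auto simp: cochain_group_simps add.commute)
  have "subgroup (coboundaries G 2) cocycle_group_2"
    using subgroup_cocycles_2 subgroup_coboundaries_2 coboundaries_2_subset
    by (intro C2.subgroup_incl)
  then show ?thesis by (rule Z2.subgroup_imp_normal)
qed

lemma cohomology_class_alt: "cohomology_class G 2 f = coboundaries G 2 #>\<^bsub>cocycle_group_2\<^esub> f"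
  by (simp add: cohomology_class_def r_coset_def)

text \<open>An extension class is given through a cochain only; membership of its coset in the
  cohomology group makes that cochain a cocycle, since the coset contains it and lies within the
  cocycles.\<close>

lemma cohomology_class_carrier_iff:
  assumes "f \<in> carrier (cochain_group G 2)"
  shows "cohomology_class G 2 f \<in> carrier (cohomology_group G 2) \<longleftrightarrow> f \<in> cocycles G 2"
proof
  assume "f \<in> cocycles G 2"
  then show "cohomology_class G 2 f \<in> carrier (cohomology_group G 2)"
    by (auto simp: cohomology_class_alt cohomology_group_def FactGroup_def RCOSETS_def)
next
  interpret C2: comm_group "cochain_group G 2" by (rule comm_group_cochain_group)
  interpret B: normal "coboundaries G 2" cocycle_group_2 by (rule normal_coboundaries_2)
  assume "cohomology_class G 2 f \<in> carrier (cohomology_group G 2)"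
  then obtain g where "g \<in> cocycles G 2" "cohomology_class G 2 f = coboundaries G 2 #>\<^bsub>cocycle_group_2\<^esub> g"
    by (auto simp: cohomology_group_def FactGroup_def RCOSETS_def)
  then have "cohomology_class G 2 f \<subseteq> cocycles G 2"
    using B.r_coset_subset_G[of "coboundaries G 2" g] coboundaries_2_subset by simp
  moreover have "f \<in> cohomology_class G 2 f"
    unfolding cohomology_class_def r_coset_def
    using subgroup.one_closed[OF subgroup_coboundaries_2] C2.l_one[OF assms] by (auto intro!: bexI)
  ultimately show "f \<in> cocycles G 2" by blast
qed

text \<open>Infinite order is encoded as \<open>ord = 0\<close>. If \<open>d\<close> times the
  cocycle were the coboundary of \<open>u\<close>, the d-th power of the class would be
  trivial.\<close>

lemma infinite_order_cocycle:
  assumes f: "f \<in> carrier (cochain_group G 2)"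
    and x: "cohomology_class G 2 f \<in> carrier (cohomology_group G 2)"
    and ord: "group.ord (cohomology_group G 2) (cohomology_class G 2 f) = 0"
    and d: "0 < (d :: nat)"
    and u: "\<And>s t. s \<in> carrier G \<Longrightarrow> t \<in> carrier G \<Longrightarrow> int d * f [s, t] = u s + u t - u (s \<otimes> t)"
  shows False
proof -
  interpret C2: comm_group "cochain_group G 2" by (rule comm_group_cochain_group)
  interpret B: normal "coboundaries G 2" cocycle_group_2 by (rule normal_coboundaries_2)
  interpret Q: group "cohomology_group G 2"
    unfolding cohomology_group_def by (rule B.factorgroup_is_group)
  have fz: "f \<in> cocycles G 2" using cohomology_class_carrier_iff[OF f] x by simp
  interpret h: group_hom cocycle_group_2 "cohomology_group G 2" "\<lambda>a. coboundaries G 2 #>\<^bsub>cocycle_group_2\<^esub> a"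
    using B.r_coset_hom_Mod by unfold_locales (simp add: cohomology_group_def)
  have pow: "f [^]\<^bsub>cocycle_group_2\<^esub> n = (\<lambda>xs\<in>tuples G 2. int n * f xs)" for n
  proof (induction n)
    case 0
    then show ?case by (simp add: cochain_group_simps)
  next
    case (Suc n)
    then show ?case by (auto simp: cochain_group_simps algebra_simps)
  qed
  have "f [^]\<^bsub>cocycle_group_2\<^esub> d \<in> coboundaries G 2"
    unfolding coboundaries_2
  proof (rule image_eqI)
    let ?g = "\<lambda>xs\<in>tuples G 1. u (hd xs)"
    show "?g \<in> carrier (cochain_group G 1)" by (simp add: cochain_group_simps)
    have "coboundary G 1 ?g = (\<lambda>xs\<in>tuples G 2. int d * f xs)"
    proof (rule coboundary_eqI)
      fix xs assume "xs \<in> tuples G (Suc 1)"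
      then obtain s t where st: "s \<in> carrier G" "t \<in> carrier G" "xs = [s, t]"
        using tuples_2[of xs G] by (auto simp: numeral_2_eq_2)
      then have "[s] \<in> tuples G 1" "[t] \<in> tuples G 1" "[s \<otimes> t] \<in> tuples G 1" "xs \<in> tuples G 2"
        by (auto simp: tuples_1[unfolded One_nat_def] tuples_2)
      then show "coboundary G 1 ?g xs = (\<lambda>xs\<in>tuples G 2. int d * f xs) xs"
        using st coboundary_1[OF st(1,2), of ?g] u[OF st(1,2)] by simp
    qed (simp add: numeral_2_eq_2)
    then show "f [^]\<^bsub>cocycle_group_2\<^esub> d = coboundary G 1 ?g" unfolding pow by simp
  qed
  then have "coboundaries G 2 #>\<^bsub>cocycle_group_2\<^esub> (f [^]\<^bsub>cocycle_group_2\<^esub> d) = coboundaries G 2"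
    using B.coset_join2 B.subgroup_axioms subgroup.mem_carrier[OF B.subgroup_axioms] by blast
  then have "cohomology_class G 2 f [^]\<^bsub>cohomology_group G 2\<^esub> d = \<one>\<^bsub>cohomology_group G 2\<^esub>"
    using h.hom_nat_pow[of f d] fz
    by (simp add: cohomology_class_alt) (simp add: cohomology_group_def FactGroup_def)
  then show False using Q.pow_eq_id[OF x, of d] ord d by simp
qed

end

text \<open>A partial character of the abelianization with values in the rationals, written on a
  subgroup containing all commutators instead of on a subgroup of the quotient. Divisibility of the
  rationals makes it extendable.\<close>

definition commutator_trivial_hom ::
  "('a, 'b) monoid_scheme \<Rightarrow> 'a set \<Rightarrow> ('a \<Rightarrow> rat) \<Rightarrow> bool" where
  "commutator_trivial_hom G K \<phi> \<longleftrightarrow> subgroup K G \<and>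
     (\<forall>x\<in>carrier G. \<forall>y\<in>carrier G. x \<otimes>\<^bsub>G\<^esub> y \<otimes>\<^bsub>G\<^esub> inv\<^bsub>G\<^esub> x \<otimes>\<^bsub>G\<^esub> inv\<^bsub>G\<^esub> y \<in> K \<and>
        \<phi> (x \<otimes>\<^bsub>G\<^esub> y \<otimes>\<^bsub>G\<^esub> inv\<^bsub>G\<^esub> x \<otimes>\<^bsub>G\<^esub> inv\<^bsub>G\<^esub> y) = 0) \<and>
     (\<forall>x\<in>K. \<forall>y\<in>K. \<phi> (x \<otimes>\<^bsub>G\<^esub> y) = \<phi> x + \<phi> y)"

context group
begin

lemma commutator_trivial_homD:
  assumes "commutator_trivial_hom G K \<phi>"
  shows "subgroup K G" "\<And>x y. x \<in> K \<Longrightarrow> y \<in> K \<Longrightarrow> \<phi> (x \<otimes> y) = \<phi> x + \<phi> y"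
    "\<And>x y. x \<in> carrier G \<Longrightarrow> y \<in> carrier G \<Longrightarrow> x \<otimes> y \<otimes> inv x \<otimes> inv y \<in> K"
    "\<And>x y. x \<in> carrier G \<Longrightarrow> y \<in> carrier G \<Longrightarrow> \<phi> (x \<otimes> y \<otimes> inv x \<otimes> inv y) = 0"
  using assms by (auto simp: commutator_trivial_hom_def)

lemma commutator_trivial_hom_inv:
  assumes h: "commutator_trivial_hom G K \<phi>"
  shows "\<phi> \<one> = 0" "x \<in> K \<Longrightarrow> \<phi> (inv x) = - \<phi> x"
proof -
  note K = commutator_trivial_homD(1)[OF h] and mult = commutator_trivial_homD(2)[OF h]
  show one: "\<phi> \<one> = 0" using mult[of \<one> \<one>] subgroup.one_closed[OF K] by simp
  assume x: "x \<in> K"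
  then show "\<phi> (inv x) = - \<phi> x"
    using mult[of x "inv x"] subgroup.m_inv_closed[OF K x] subgroup.mem_carrier[OF K x] one by simp
qed

lemma commutator_trivial_hom_int_pow:
  assumes h: "commutator_trivial_hom G K \<phi>" and x: "x \<in> K"
  shows "\<phi> (x [^] (n :: int)) = of_int n * \<phi> x"
proof -
  note K = commutator_trivial_homD(1)[OF h] and mult = commutator_trivial_homD(2)[OF h]
  have xc: "x \<in> carrier G" using subgroup.mem_carrier[OF K x] .
  have pos: "x [^] m \<in> K \<and> \<phi> (x [^] m) = of_nat m * \<phi> x" for m :: nat
  proof (induction m)
    case 0
    then show ?case using commutator_trivial_hom_inv[OF h] subgroup.one_closed[OF K] by simp
  next
    case (Suc m)
    then show ?case using mult[of "x [^] m" x] x subgroup.m_closed[OF K] by (simp add: algebra_simps)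
  qed
  show ?thesis
  proof (cases n)
    case (nonneg m)
    then show ?thesis using pos[of m] by (simp add: int_pow_int)
  next
    case (neg m)
    have "x [^] n = inv (x [^] Suc m)" unfolding neg using xc by (rule int_pow_neg_int)
    moreover have "\<phi> (inv (x [^] Suc m)) = - (of_nat (Suc m) * \<phi> x)"
      using pos[of "Suc m"] commutator_trivial_hom_inv(2)[OF h, of "x [^] Suc m"] by simp
    ultimately show ?thesis unfolding neg by (simp add: algebra_simps)
  qed
qed

text \<open>The conjugate of \<open>k\<close> is the commutator of \<open>x\<close> and
  \<open>k\<close> times \<open>k\<close>; so \<open>K\<close> is normal and \<phi> is invariant
  under conjugation.\<close>

lemma commutator_trivial_hom_conj:
  assumes h: "commutator_trivial_hom G K \<phi>" and x: "x \<in> carrier G" and k: "k \<in> K"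
  shows "x \<otimes> k \<otimes> inv x \<in> K" "\<phi> (x \<otimes> k \<otimes> inv x) = \<phi> k"
proof -
  note hD = commutator_trivial_homD[OF h]
  have kc: "k \<in> carrier G" using subgroup.mem_carrier[OF hD(1) k] .
  have eq: "x \<otimes> k \<otimes> inv x = (x \<otimes> k \<otimes> inv x \<otimes> inv k) \<otimes> k"
    using x kc by (simp add: m_assoc)
  show "x \<otimes> k \<otimes> inv x \<in> K"
    by (subst eq, rule subgroup.m_closed[OF hD(1) hD(3)[OF x kc] k])
  show "\<phi> (x \<otimes> k \<otimes> inv x) = \<phi> k"
    by (subst eq) (simp add: hD(2)[OF hD(3)[OF x kc] k] hD(4)[OF x kc])
qed

text \<open>The domain grows to the product of \<open>K\<close> with the powers of \<open>e\<close>,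
  a subgroup since \<open>K\<close> is normal. Two expressions of one element differ by a power of
  \<open>e\<close> lying in \<open>K\<close>, where the hypothesis on \<open>a\<close> makes their
  values agree.\<close>

lemma commutator_trivial_hom_extend:
  assumes h: "commutator_trivial_hom G K \<phi>" and e: "e \<in> carrier G"
    and a: "\<And>n :: int. e [^] n \<in> K \<Longrightarrow> \<phi> (e [^] n) = of_int n * a"
  shows "\<exists>K' \<phi>'. commutator_trivial_hom G K' \<phi>' \<and> K \<subseteq> K' \<and> e \<in> K' \<and> (\<forall>x\<in>K. \<phi>' x = \<phi> x) \<and> \<phi>' e = a"
proof -
  note hD = commutator_trivial_homD[OF h] and hI = commutator_trivial_hom_inv[OF h]
  note conj = commutator_trivial_hom_conj[OF h]
  interpret K: subgroup K G by (rule hD(1))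
  define K' where "K' = {k \<otimes> e [^] n | k (n :: int). k \<in> K}"
  define \<phi>' where "\<phi>' x = (THE v. \<exists>k\<in>K. \<exists>n :: int. x = k \<otimes> e [^] n \<and> v = \<phi> k + of_int n * a)" for x
  have en: "e [^] (n :: int) \<in> carrier G" for n using e by simp
  have \<phi>': "\<phi>' (k \<otimes> e [^] n) = \<phi> k + of_int n * a" if k: "k \<in> K" for k and n :: int
    unfolding \<phi>'_def
  proof (rule the_equality)
    show "\<exists>k'\<in>K. \<exists>m :: int. k \<otimes> e [^] n = k' \<otimes> e [^] m \<and> \<phi> k + of_int n * a = \<phi> k' + of_int m * a"
      using k by blast
    fix v assume "\<exists>k'\<in>K. \<exists>m :: int. k \<otimes> e [^] n = k' \<otimes> e [^] m \<and> v = \<phi> k' + of_int m * a"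
    then obtain k' and m :: int where k': "k' \<in> K" and eq: "k \<otimes> e [^] n = k' \<otimes> e [^] m"
      and v: "v = \<phi> k' + of_int m * a" by blast
    have kc: "k \<in> carrier G" "k' \<in> carrier G" using k k' by auto
    have "inv k' \<otimes> (k \<otimes> e [^] n) \<otimes> e [^] (- n) = inv k' \<otimes> (k' \<otimes> e [^] m) \<otimes> e [^] (- n)"
      unfolding eq ..
    moreover have "inv k' \<otimes> (k \<otimes> e [^] n) \<otimes> e [^] (- n) = inv k' \<otimes> (k \<otimes> e [^] (n + - n))"
      using kc en e by (simp only: int_pow_mult[OF e] m_assoc m_closed inv_closed)
    moreover have "inv k' \<otimes> (k' \<otimes> e [^] m) \<otimes> e [^] (- n) = e [^] (m + - n)"
      using kc en e by (simp only: int_pow_mult[OF e] inv_mult_left)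
    ultimately have eq': "inv k' \<otimes> k = e [^] (m - n)" using kc e by simp
    moreover have ik: "inv k' \<in> K" using k' by simp
    moreover have "inv k' \<otimes> k \<in> K" using ik k by simp
    ultimately have "\<phi> (inv k' \<otimes> k) = of_int (m - n) * a" using a[of "m - n"] by simp
    moreover have "\<phi> (inv k' \<otimes> k) = \<phi> k - \<phi> k'" using hD(2)[OF ik k] hI(2)[OF k'] by simp
    ultimately show "v = \<phi> k + of_int n * a" unfolding v by (simp add: algebra_simps)
  qed
  have mult: "(k \<otimes> e [^] n) \<otimes> (k' \<otimes> e [^] m) = (k \<otimes> (e [^] n \<otimes> k' \<otimes> inv (e [^] n))) \<otimes> e [^] (n + m)"
    if "k \<in> K" "k' \<in> K" for k k' and n m :: int
    using that en[of n] en[of m] e by (simp add: int_pow_mult m_assoc inv_mult_left)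
  have KK': "K \<subseteq> K'"
  proof
    fix k assume "k \<in> K"
    then have "k = k \<otimes> e [^] (0 :: int)" by simp
    then show "k \<in> K'" unfolding K'_def using \<open>k \<in> K\<close> by blast
  qed
  have sub: "subgroup K' G"
  proof (rule subgroupI)
    show "K' \<subseteq> carrier G" using e by (auto simp: K'_def)
    show "K' \<noteq> {}" using KK' K.one_closed by blast
  next
    fix x assume "x \<in> K'"
    then obtain k and n :: int where k: "k \<in> K" "x = k \<otimes> e [^] n" by (auto simp: K'_def)
    then have "inv x = (e [^] (- n) \<otimes> inv k \<otimes> inv (e [^] (- n))) \<otimes> e [^] (- n)"
      using e by (simp add: inv_mult_group int_pow_neg m_assoc)
    moreover have "e [^] (- n) \<otimes> inv k \<otimes> inv (e [^] (- n)) \<in> K"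
      using k en by (intro conj) auto
    ultimately show "inv x \<in> K'" unfolding K'_def by blast
  next
    fix x y assume "x \<in> K'" "y \<in> K'"
    then obtain k k' and n m :: int where k: "k \<in> K" "x = k \<otimes> e [^] n" "k' \<in> K" "y = k' \<otimes> e [^] m"
      by (auto simp: K'_def)
    have "k \<otimes> (e [^] n \<otimes> k' \<otimes> inv (e [^] n)) \<in> K" using k conj(1)[OF en, of k' n] by simp
    then show "x \<otimes> y \<in> K'" unfolding K'_def k(2,4) mult[OF k(1,3)] by blast
  qed
  have ext: "\<phi>' k = \<phi> k" if "k \<in> K" for k
    using \<phi>'[OF that, of 0] that by simp
  have "commutator_trivial_hom G K' \<phi>'"
    unfolding commutator_trivial_hom_def
  proof (intro conjI ballI)
    fix x y assume "x \<in> carrier G" "y \<in> carrier G"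
    then show "x \<otimes> y \<otimes> inv x \<otimes> inv y \<in> K'" "\<phi>' (x \<otimes> y \<otimes> inv x \<otimes> inv y) = 0"
      using hD(3,4)[of x y] KK' ext by auto
  next
    fix x y assume "x \<in> K'" "y \<in> K'"
    then obtain k k' and n m :: int where k: "k \<in> K" "x = k \<otimes> e [^] n" "k' \<in> K" "y = k' \<otimes> e [^] m"
      by (auto simp: K'_def)
    have c: "e [^] n \<otimes> k' \<otimes> inv (e [^] n) \<in> K" "\<phi> (e [^] n \<otimes> k' \<otimes> inv (e [^] n)) = \<phi> k'"
      using conj[OF en k(3)] by auto
    then have "\<phi>' (x \<otimes> y) = \<phi> k + \<phi> k' + of_int (n + m) * a"
      unfolding k(2,4) mult[OF k(1,3)] using \<phi>'[of "k \<otimes> (e [^] n \<otimes> k' \<otimes> inv (e [^] n))"] k hD(2)[OF k(1) c(1)]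
      by simp
    then show "\<phi>' (x \<otimes> y) = \<phi>' x + \<phi>' y"
      unfolding k(2,4) \<phi>'[OF k(1)] \<phi>'[OF k(3)] by (simp add: algebra_simps)
  qed (rule sub)
  moreover have "e = \<one> \<otimes> e [^] (1 :: int)" using e by simp
  then have "e \<in> K'" "\<phi>' e = a" unfolding K'_def
    using \<phi>'[OF K.one_closed, of 1] hI(1) K.one_closed e by (blast, simp)
  ultimately show ?thesis using KK' ext by blast
qed

lemma commutator_trivial_hom_extend_finite:
  assumes "finite F" "F \<subseteq> carrier G" and h: "commutator_trivial_hom G K \<phi>"
  shows "\<exists>K' \<phi>'. commutator_trivial_hom G K' \<phi>' \<and> K \<subseteq> K' \<and> F \<subseteq> K' \<and> (\<forall>x\<in>K. \<phi>' x = \<phi> x)"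
  using assms(1,2)
proof (induction F)
  case empty
  then show ?case using h by blast
next
  case (insert e F)
  then obtain K1 \<phi>1 where 1: "commutator_trivial_hom G K1 \<phi>1" "K \<subseteq> K1" "F \<subseteq> K1" "\<forall>x\<in>K. \<phi>1 x = \<phi> x"
    by auto
  have e: "e \<in> carrier G" using insert.prems by simp
  \<comment> \<open>If a nonzero power of \<open>e\<close> lies in \<open>K1\<close>, the value at
    \<open>e\<close> is forced and is obtained by division; otherwise it is free, and 0 will
    do.\<close>
  have "\<exists>a. \<forall>n :: int. e [^] n \<in> K1 \<longrightarrow> \<phi>1 (e [^] n) = of_int n * a"
  proof (cases "\<exists>m :: int. m \<noteq> 0 \<and> e [^] m \<in> K1")
    case True
    then obtain m :: int where m: "m \<noteq> 0" "e [^] m \<in> K1" by blast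
    have "\<phi>1 (e [^] n) = of_int n * (\<phi>1 (e [^] m) / of_int m)" if n: "e [^] n \<in> K1" for n :: int
    proof -
      have "of_int m * \<phi>1 (e [^] n) = \<phi>1 ((e [^] n) [^] m)"
        using commutator_trivial_hom_int_pow[OF 1(1) n] by simp
      also have "(e [^] n) [^] m = (e [^] m) [^] n" using e by (simp add: int_pow_pow mult.commute)
      also have "\<phi>1 \<dots> = of_int n * \<phi>1 (e [^] m)"
        using commutator_trivial_hom_int_pow[OF 1(1) m(2)] by simp
      finally show ?thesis using m(1) by (simp add: field_simps)
    qed
    then show ?thesis by blast
  next
    case False
    then show ?thesis using commutator_trivial_hom_inv[OF 1(1)] e
      by (intro exI[of _ 0]) (metis int_pow_0 mult_zero_right)
  qed
  then obtain a where "\<And>n :: int. e [^] n \<in> K1 \<Longrightarrow> \<phi>1 (e [^] n) = of_int n * a" by blast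
  from commutator_trivial_hom_extend[OF 1(1) e this] obtain K' \<phi>' where
    "commutator_trivial_hom G K' \<phi>'" "K1 \<subseteq> K'" "e \<in> K'" "\<forall>x\<in>K1. \<phi>' x = \<phi>1 x" by blast
  then show ?case using 1 by (intro exI[of _ K'] exI[of _ \<phi>']) auto
qed

lemma commutator_trivial_hom_derived: "commutator_trivial_hom G (derived G (carrier G)) (\<lambda>_. 0)"
  unfolding commutator_trivial_hom_def
proof (intro conjI ballI)
  show "subgroup (derived G (carrier G)) G" by (rule derived_is_subgroup) simp
  fix x y assume "x \<in> carrier G" "y \<in> carrier G"
  then show "x \<otimes> y \<otimes> inv x \<otimes> inv y \<in> derived G (carrier G)"
    unfolding derived_def by (intro generate.incl) auto
qed auto

end

lemma common_denominator:
  assumes "finite S"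
  shows "\<exists>d>0. \<forall>s\<in>S. of_int d * (v s :: rat) \<in> \<int>"
  using assms
proof (induction S)
  case empty
  then show ?case by (intro exI[of _ 1]) simp
next
  case (insert s S)
  then obtain d where d: "d > 0" "\<And>x. x \<in> S \<Longrightarrow> of_int d * v x \<in> \<int>" by blast
  obtain a b where ab: "quotient_of (v s) = (a, b)" by (cases "quotient_of (v s)")
  then have b: "b > 0" "v s = of_int a / of_int b"
    by (auto simp: quotient_of_denom_pos quotient_of_div)
  have "of_int (d * b) * v x \<in> \<int>" if "x \<in> insert s S" for x
  proof (cases "x = s")
    case True
    have "of_int b * v s = of_int a" using b by simp
    then have "of_int (d * b) * v x = of_int (d * a)" using True by (simp add: mult.assoc)
    then show ?thesis by (metis Ints_of_int)
  next
    case False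
    then have "of_int d * v x \<in> \<int>" using that d by auto
    then have "of_int b * (of_int d * v x) \<in> \<int>" by (rule Ints_mult[OF Ints_of_int])
    then show ?thesis by (simp add: ac_simps)
  qed
  then show ?case using b d by (intro exI[of _ "d * b"]) auto
qed

section \<open>Central extensions by the integers\<close>

locale int_extension = G: group G + E: group E
  for G :: "('a, 'b) monoid_scheme" and E :: "('e, 'c) monoid_scheme" +
  fixes \<iota> :: "int \<Rightarrow> 'e" and q :: "'e \<Rightarrow> 'a" and \<sigma> :: "'a \<Rightarrow> 'e" and c :: "'a \<Rightarrow> 'a \<Rightarrow> int"
  assumes ext: "central_extension G E \<iota> q"
    and sec_closed: "s \<in> carrier G \<Longrightarrow> \<sigma> s \<in> carrier E"
    and q_sec: "s \<in> carrier G \<Longrightarrow> q (\<sigma> s) = s"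
    and sec_mult: "\<lbrakk>s \<in> carrier G; t \<in> carrier G\<rbrakk> \<Longrightarrow>
      \<sigma> s \<otimes>\<^bsub>E\<^esub> \<sigma> t = \<iota> (c s t) \<otimes>\<^bsub>E\<^esub> \<sigma> (s \<otimes>\<^bsub>G\<^esub> t)"
begin

lemma iota_closed [simp]: "\<iota> m \<in> carrier E"
  and iota_add: "\<iota> (m + n) = \<iota> m \<otimes>\<^bsub>E\<^esub> \<iota> n"
  and inj_iota: "inj \<iota>"
  and iota_central: "x \<in> carrier E \<Longrightarrow> \<iota> m \<otimes>\<^bsub>E\<^esub> x = x \<otimes>\<^bsub>E\<^esub> \<iota> m"
  and q_hom: "q \<in> hom E G"
  and kernel_q: "range \<iota> = kernel E G q"
  using ext by (auto simp: central_extension_def mon_def epi_def hom_def)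

lemma q_closed [simp]: "x \<in> carrier E \<Longrightarrow> q x \<in> carrier G"
  using q_hom by (auto simp: hom_def)

lemma q_iota [simp]: "q (\<iota> m) = \<one>\<^bsub>G\<^esub>"
  using kernel_q by (auto simp: kernel_def)

lemma iota_0 [simp]: "\<iota> 0 = \<one>\<^bsub>E\<^esub>"
  using iota_add[of 0 0] E.r_cancel_one'[of "\<iota> 0" "\<iota> 0"] by simp

lemma iota_int_pow: "\<iota> 1 [^]\<^bsub>E\<^esub> (n :: int) = \<iota> n"
proof -
  interpret h: group_hom integer_group E \<iota>
    by (intro group_hom.intro group_hom_axioms.intro) (simp_all add: E.group_axioms hom_def iota_add)
  show ?thesis using h.hom_int_pow[of 1 n] by simp
qed

lemma iota_inv: "inv\<^bsub>E\<^esub> (\<iota> m) = \<iota> (- m)"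
  using iota_add[of m "- m"] by (intro E.inv_equality) (simp_all flip: iota_add)

lemma decompose:
  assumes x: "x \<in> carrier E"
  obtains j where "x = \<iota> j \<otimes>\<^bsub>E\<^esub> \<sigma> (q x)"
proof -
  let ?s = "\<sigma> (q x)"
  have s: "?s \<in> carrier E" using x by (simp add: sec_closed)
  interpret h: group_hom E G q by unfold_locales (rule q_hom)
  have "q (x \<otimes>\<^bsub>E\<^esub> inv\<^bsub>E\<^esub> ?s) = \<one>\<^bsub>G\<^esub>" using x s q_sec[of "q x"] by simp
  then have "x \<otimes>\<^bsub>E\<^esub> inv\<^bsub>E\<^esub> ?s \<in> range \<iota>" unfolding kernel_q kernel_def using x s by simp
  then obtain j where "x \<otimes>\<^bsub>E\<^esub> inv\<^bsub>E\<^esub> ?s = \<iota> j" by blast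
  then have "x = \<iota> j \<otimes>\<^bsub>E\<^esub> ?s" using x s E.inv_solve_right' by simp
  then show ?thesis by (rule that)
qed

lemma cocycle: "int_cocycle G c"
  unfolding int_cocycle_def
proof (intro ballI)
  fix s t u assume m: "s \<in> carrier G" "t \<in> carrier G" "u \<in> carrier G"
  have "(\<sigma> s \<otimes>\<^bsub>E\<^esub> \<sigma> t) \<otimes>\<^bsub>E\<^esub> \<sigma> u = \<iota> (c s t) \<otimes>\<^bsub>E\<^esub> (\<sigma> (s \<otimes>\<^bsub>G\<^esub> t) \<otimes>\<^bsub>E\<^esub> \<sigma> u)"
    using m by (simp add: sec_mult[of s t] E.m_assoc sec_closed)
  also have "\<dots> = \<iota> (c s t + c (s \<otimes>\<^bsub>G\<^esub> t) u) \<otimes>\<^bsub>E\<^esub> \<sigma> (s \<otimes>\<^bsub>G\<^esub> t \<otimes>\<^bsub>G\<^esub> u)"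
    using m by (simp add: sec_mult E.m_assoc sec_closed iota_add)
  finally have l: "(\<sigma> s \<otimes>\<^bsub>E\<^esub> \<sigma> t) \<otimes>\<^bsub>E\<^esub> \<sigma> u = \<dots>" .
  have "\<sigma> s \<otimes>\<^bsub>E\<^esub> (\<sigma> t \<otimes>\<^bsub>E\<^esub> \<sigma> u) = (\<sigma> s \<otimes>\<^bsub>E\<^esub> \<iota> (c t u)) \<otimes>\<^bsub>E\<^esub> \<sigma> (t \<otimes>\<^bsub>G\<^esub> u)"
    using m by (simp add: sec_mult[of t u] E.m_assoc sec_closed)
  also have "\<dots> = \<iota> (c t u) \<otimes>\<^bsub>E\<^esub> (\<sigma> s \<otimes>\<^bsub>E\<^esub> \<sigma> (t \<otimes>\<^bsub>G\<^esub> u))"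
    using m by (simp add: E.m_assoc sec_closed flip: iota_central)
  also have "\<dots> = \<iota> (c t u + c s (t \<otimes>\<^bsub>G\<^esub> u)) \<otimes>\<^bsub>E\<^esub> \<sigma> (s \<otimes>\<^bsub>G\<^esub> t \<otimes>\<^bsub>G\<^esub> u)"
    using m by (simp add: sec_mult E.m_assoc G.m_assoc sec_closed iota_add)
  finally have "\<iota> (c s t + c (s \<otimes>\<^bsub>G\<^esub> t) u) = \<iota> (c t u + c s (t \<otimes>\<^bsub>G\<^esub> u))"
    using l m by (simp add: E.m_assoc sec_closed)
  then show "c s t + c (s \<otimes>\<^bsub>G\<^esub> t) u = c t u + c s (t \<otimes>\<^bsub>G\<^esub> u)" using inj_iota by (simp add: inj_eq)
qed

lemma sec_one: "\<sigma> \<one>\<^bsub>G\<^esub> = \<iota> (c \<one>\<^bsub>G\<^esub> \<one>\<^bsub>G\<^esub>)"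
  using sec_mult[of "\<one>\<^bsub>G\<^esub>" "\<one>\<^bsub>G\<^esub>"] by (simp add: sec_closed)

text \<open>Otherwise \<open>\<iota> 1 \<mapsto> 1\<close> would extend to a rational character of \<open>E\<close>, generator by generator, and
  a common denominator of its values on lifted generators would annihilate the class of \<open>c\<close>.\<close>

lemma iota_in_derived:
  assumes fg: "finitely_generated_group G"
    and inf: "\<And>d u. 0 < (d :: int) \<Longrightarrow>
      \<not> (\<forall>s\<in>carrier G. \<forall>t\<in>carrier G. d * c s t = u s + u t - u (s \<otimes>\<^bsub>G\<^esub> t))"
  shows "\<exists>m. m \<noteq> 0 \<and> \<iota> m \<in> derived E (carrier E)"
proof (rule ccontr)
  assume "\<not> ?thesis"
  then have der: "\<iota> m \<in> derived E (carrier E) \<Longrightarrow> m = 0" for m by blast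
  obtain S where S: "finite S" "S \<subseteq> carrier G" "generate G S = carrier G"
    using fg by (auto simp: finitely_generated_group_def)
  \<comment> \<open>The zero character on the derived subgroup is compatible with the value 1 at
    \<open>\<iota> 1\<close>, because by assumption only the trivial power of
    \<open>\<iota> 1\<close> lies there.\<close>
  have "0 = of_int n * (1 :: rat)" if "\<iota> 1 [^]\<^bsub>E\<^esub> n \<in> derived E (carrier E)" for n :: int
    using that der[of n] by (simp add: iota_int_pow)
  from E.commutator_trivial_hom_extend[OF E.commutator_trivial_hom_derived iota_closed this]
  obtain K1 \<phi>1 where 1: "commutator_trivial_hom E K1 \<phi>1" "\<iota> 1 \<in> K1" "\<phi>1 (\<iota> 1) = 1" by blast
  have "finite (\<sigma> ` S)" "\<sigma> ` S \<subseteq> carrier E" using S sec_closed by auto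
  from E.commutator_trivial_hom_extend_finite[OF this 1(1)]
  obtain K \<phi> where K: "commutator_trivial_hom E K \<phi>" "K1 \<subseteq> K" "\<sigma> ` S \<subseteq> K" "\<forall>x\<in>K1. \<phi> x = \<phi>1 x" by blast
  note KD = E.commutator_trivial_homD[OF K(1)]
  interpret K: subgroup K E by (rule KD(1))
  have i1: "\<iota> 1 \<in> K" "\<phi> (\<iota> 1) = 1" using 1 K by auto
  have iK: "\<iota> n \<in> K" for n
    using E.subgroup_int_pow_closed[OF KD(1) i1(1), of n] by (simp add: iota_int_pow)
  have i\<phi>: "\<phi> (\<iota> n) = of_int n" for n
    using E.commutator_trivial_hom_int_pow[OF K(1) i1(1), of n] i1(2) by (simp add: iota_int_pow)
  obtain d where d: "0 < d" "\<And>s. s \<in> S \<Longrightarrow> of_int d * \<phi> (\<sigma> s) \<in> \<int>"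
    using common_denominator[OF S(1), of "\<lambda>s. \<phi> (\<sigma> s)"] by blast
  have prod: "\<sigma> (s \<otimes>\<^bsub>G\<^esub> t) = \<iota> (- c s t) \<otimes>\<^bsub>E\<^esub> (\<sigma> s \<otimes>\<^bsub>E\<^esub> \<sigma> t)"
    if "s \<in> carrier G" "t \<in> carrier G" for s t
    unfolding sec_mult[OF that] using that
    by (simp add: sec_closed flip: E.m_assoc iota_add)
  have inv: "\<sigma> (inv\<^bsub>G\<^esub> s) = \<iota> (c (inv\<^bsub>G\<^esub> s) s + c \<one>\<^bsub>G\<^esub> \<one>\<^bsub>G\<^esub>) \<otimes>\<^bsub>E\<^esub> inv\<^bsub>E\<^esub> (\<sigma> s)"
    if "s \<in> carrier G" for s
  proof -
    have "\<sigma> (inv\<^bsub>G\<^esub> s) \<otimes>\<^bsub>E\<^esub> \<sigma> s = \<iota> (c (inv\<^bsub>G\<^esub> s) s + c \<one>\<^bsub>G\<^esub> \<one>\<^bsub>G\<^esub>)"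
      using that sec_mult[of "inv\<^bsub>G\<^esub> s" s] by (simp add: sec_one iota_add)
    then show ?thesis using that by (metis E.inv_solve_right' G.inv_closed iota_closed sec_closed)
  qed
  \<comment> \<open>Along products and inverses the value at the section changes only by integers
    coming from the cocycle, so a denominator that serves the generators serves every
    element.\<close>
  have int: "\<sigma> g \<in> K \<and> of_int d * \<phi> (\<sigma> g) \<in> \<int>" if "g \<in> carrier G" for g
  proof -
    have "g \<in> generate G S" using that S by simp
    then show ?thesis
    proof (induction rule: generate.induct)
      case one
      then show ?case using iK by (simp add: sec_one i\<phi> Ints_mult)
    next
      case (incl h)
      then show ?case using K d by auto
    next
      case (inv h)
      then have h: "h \<in> carrier G" "\<sigma> h \<in> K" "inv\<^bsub>E\<^esub> (\<sigma> h) \<in> K" "of_int d * \<phi> (\<sigma> h) \<in> \<int>"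
        using K S d by auto
      then show ?case using iK
        unfolding \<open>h \<in> carrier G \<Longrightarrow> \<sigma> (inv\<^bsub>G\<^esub> h) = _\<close>[OF h(1)]
        by (simp add: KD(2) i\<phi> E.commutator_trivial_hom_inv(2)[OF K(1)] distrib_left right_diff_distrib Ints_mult Ints_add Ints_diff
            )
    next
      case (eng g h)
      then have gh: "g \<in> carrier G" "h \<in> carrier G" using S by auto
      show ?case using eng.IH iK
        unfolding prod[OF gh]
        by (simp add: KD(2) i\<phi> distrib_left right_diff_distrib Ints_mult Ints_add Ints_diff)
    qed
  qed
  \<comment> \<open>The floor is exact by \<open>int\<close>; it only converts an integral rational
    into an integer.\<close>
  define u where "u g = \<lfloor>of_int d * \<phi> (\<sigma> g)\<rfloor>" for g
  have u: "of_int (u g) = of_int d * \<phi> (\<sigma> g)" if "g \<in> carrier G" for g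
    using int[OF that] unfolding u_def by (auto elim!: Ints_cases)
  have "d * c s t = u s + u t - u (s \<otimes>\<^bsub>G\<^esub> t)" if st: "s \<in> carrier G" "t \<in> carrier G" for s t
  proof -
    have "\<phi> (\<sigma> s) + \<phi> (\<sigma> t) = of_int (c s t) + \<phi> (\<sigma> (s \<otimes>\<^bsub>G\<^esub> t))"
      using sec_mult[OF st] KD(2) int[OF st(1)] int[OF st(2)] int[of "s \<otimes>\<^bsub>G\<^esub> t"] st iK
      by (metis G.m_closed i\<phi>)
    then have "rat_of_int d * (\<phi> (\<sigma> s) + \<phi> (\<sigma> t)) = of_int d * (of_int (c s t) + \<phi> (\<sigma> (s \<otimes>\<^bsub>G\<^esub> t)))"
      by simp
    then have "rat_of_int (u s + u t) = of_int (d * c s t + u (s \<otimes>\<^bsub>G\<^esub> t))"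
      using st by (simp add: u distrib_left)
    then show ?thesis unfolding of_int_eq_iff by simp
  qed
  then show False using inf[OF d(1), of u] by blast
qed

end

section \<open>Representations with scalar centre obstruct stability\<close>

lemma cmod_cis_minus_one_le: "cmod (cis x - 1) \<le> \<bar>x\<bar>"
proof -
  have "(cmod (cis x - 1))\<^sup>2 = (cos x)\<^sup>2 + (sin x)\<^sup>2 + 1 - 2 * cos x"
    by (simp add: cmod_power2 power2_diff)
  also have "\<dots> = 2 - 2 * cos (2 * (x / 2))" using sin_cos_squared_add2[of x] by simp
  also have "\<dots> = (2 * sin (x / 2))\<^sup>2" unfolding cos_double_sin by (simp add: power_mult_distrib)
  also have "\<dots> \<le> x\<^sup>2"
    using abs_sin_x_le_abs_x[of "x / 2"] by (subst abs_le_square_iff[symmetric]) (simp add: abs_mult)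
  finally show ?thesis by (metis abs_le_square_iff abs_norm_cancel)
qed

context int_extension
begin

text \<open>Both \<open>R n\<close> and \<open>\<pi> n \<circ> q\<close> represent \<open>E\<close>, and they are asymptotically close. Hence the logarithm
  of the determinant of \<open>R n x * (\<pi> n (q x))\<^sup>*\<close> is eventually additive in \<open>x\<close> and so vanishes on products
  of commutators, whereas on the central element \<open>\<iota> m\<close> it is \<open>k n\<close> times a small nonzero number.\<close>

theorem no_nearby_homs:
  fixes R :: "nat \<Rightarrow> 'e \<Rightarrow> complex mat" and \<pi> :: "nat \<Rightarrow> 'a \<Rightarrow> complex mat" and D :: "nat \<Rightarrow> real"
  assumes R: "\<And>n. R n \<in> hom E (unitary_group (k n))" and k: "\<And>n. k n \<ge> 1"
    and Ri: "\<And>n m. R n (\<iota> m) = cis (2 * pi * of_int m / D n) \<cdot>\<^sub>m 1\<^sub>m (k n)"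
    and D: "filterlim D at_top sequentially"
    and \<pi>: "\<And>n. \<pi> n \<in> hom G (unitary_group (k n))"
    and near: "\<And>s. s \<in> carrier G \<Longrightarrow> \<exists>\<epsilon>. \<epsilon> \<longlonglongrightarrow> 0 \<and> (\<forall>n. norm_le (R n (\<sigma> s) - \<pi> n s) (\<epsilon> n))"
    and m: "m \<noteq> 0" "\<iota> m \<in> derived E (carrier E)"
  shows False
proof -
  have Ru: "R n x \<in> carrier (unitary_group (k n))" if "x \<in> carrier E" for n x
    using R[of n] that by (auto simp: hom_def)
  have \<pi>u: "\<pi> n s \<in> carrier (unitary_group (k n))" if "s \<in> carrier G" for n s
    using \<pi>[of n] that by (auto simp: hom_def)
  have Rm: "R n (x \<otimes>\<^bsub>E\<^esub> y) = R n x * R n y" if "x \<in> carrier E" "y \<in> carrier E" for n x y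
    using R[of n] that by (auto simp: hom_def unitary_group_def)
  have \<pi>m: "\<pi> n (s \<otimes>\<^bsub>G\<^esub> t) = \<pi> n s * \<pi> n t" if "s \<in> carrier G" "t \<in> carrier G" for n s t
    using \<pi>[of n] that by (auto simp: hom_def unitary_group_def)
  have qm: "q (x \<otimes>\<^bsub>E\<^esub> y) = q x \<otimes>\<^bsub>G\<^esub> q y" if "x \<in> carrier E" "y \<in> carrier E" for x y
    using q_hom that by (auto simp: hom_def)
  have cis0: "(\<lambda>n. \<bar>2 * pi * of_int j / D n\<bar>) \<longlonglongrightarrow> 0" for j
    using D by (intro tendsto_rabs_zero tendsto_divide_0[OF tendsto_const] filterlim_at_top_imp_at_infinity)
  \<comment> \<open>\<open>U n x\<close> measures the discrepancy between the two representations at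
    \<open>x\<close>. It is not multiplicative in \<open>x\<close>, only up to the conjugation in
    \<open>?V\<close> below.\<close>
  define U where "U n x = R n x * mat_adjoint (\<pi> n (q x))" for n x
  have Uu: "U n x \<in> carrier (unitary_group (k n))" if "x \<in> carrier E" for n x
    unfolding U_def using that Ru \<pi>u by (intro unitary_mult unitary_adjoint) auto
  have Uc: "U n x \<in> carrier_mat (k n) (k n)" if "x \<in> carrier E" for n x
    using unitaryD[OF Uu[OF that]] by simp
  \<comment> \<open>The hypothesis concerns values of the section only. An arbitrary
    \<open>x\<close> differs from one by some \<open>\<iota> j\<close>, which acts by a scalar
    tending to 1 for fixed \<open>j\<close>.\<close>
  have U_near: "eventually (\<lambda>n. norm_le (U n x - 1\<^sub>m (k n)) (1/4)) sequentially" if x: "x \<in> carrier E" for x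
  proof -
    obtain j where j: "x = \<iota> j \<otimes>\<^bsub>E\<^esub> \<sigma> (q x)" using decompose[OF x] .
    have s: "q x \<in> carrier G" "\<sigma> (q x) \<in> carrier E" using x by (auto simp: sec_closed)
    obtain \<epsilon> where \<epsilon>: "\<epsilon> \<longlonglongrightarrow> 0" "\<And>n. norm_le (R n (\<sigma> (q x)) - \<pi> n (q x)) (\<epsilon> n)"
      using near[OF s(1)] by blast
    have "(\<lambda>n. \<bar>2 * pi * of_int j / D n\<bar> + \<epsilon> n) \<longlonglongrightarrow> 0 + 0" using cis0 \<epsilon>(1) by (rule tendsto_add)
    then have "eventually (\<lambda>n. \<bar>2 * pi * of_int j / D n\<bar> + \<epsilon> n < 1/4) sequentially"
      by (rule order_tendstoD) simp
    then show ?thesis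
    proof eventually_elim
      case (elim n)
      let ?z = "cis (2 * pi * of_int j / D n)"
      note Rs = unitaryD[OF Ru[OF s(2), of n]] and \<pi>s = unitaryD[OF \<pi>u[OF s(1), of n]]
      have "R n x = R n (\<iota> j) * R n (\<sigma> (q x))" using Rm[of "\<iota> j" "\<sigma> (q x)" n] s j by simp
      also have "\<dots> = ?z \<cdot>\<^sub>m R n (\<sigma> (q x))"
        unfolding Ri using Rs by (simp add: mult_smult_assoc_mat[of _ "k n" "k n"])
      finally have Rx: "R n x = ?z \<cdot>\<^sub>m R n (\<sigma> (q x))" .
      have "R n x - \<pi> n (q x) = (?z - 1) \<cdot>\<^sub>m R n (\<sigma> (q x)) + (R n (\<sigma> (q x)) - \<pi> n (q x))"
        unfolding Rx using Rs \<pi>s by (intro eq_matI) (auto simp: algebra_simps)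
      moreover have "norm_le ((?z - 1) \<cdot>\<^sub>m R n (\<sigma> (q x)) + (R n (\<sigma> (q x)) - \<pi> n (q x))) (cmod (?z - 1) * 1 + \<epsilon> n)"
        using Rs \<pi>s \<epsilon>(2) norm_le_unitary[OF Ru[OF s(2), of n]]
        by (intro norm_le_add[of _ "k n" "k n"] norm_le_smult[of _ "k n" "k n"]) auto
      ultimately have "norm_le (R n x - \<pi> n (q x)) (1/4)"
        using cmod_cis_minus_one_le[of "2 * pi * of_int j / D n"] elim by (auto elim: norm_le_mono)
      then show ?case
        unfolding U_def using unitaryD[OF Ru[OF x, of n]] by (intro norm_le_right_unitary \<pi>u s)
    qed
  qed
  \<comment> \<open>The choice is arbitrary when no logarithm exists; by \<open>U_near\<close> and
    \<open>det_log_mult\<close> one does exist for each fixed \<open>x\<close> from some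
    \<open>n\<close> on.\<close>
  define l where "l n x = (SOME z. det_log (U n x) z)" for n x
  have l_eq: "l n x = z" if "det_log (U n x) z" for n x z
    unfolding l_def using that det_log_unique by (metis someI)
  have l_add: "eventually (\<lambda>n. l n (x \<otimes>\<^bsub>E\<^esub> y) = l n x + l n y) sequentially"
    if x: "x \<in> carrier E" and y: "y \<in> carrier E" for x y
    using U_near[OF x] U_near[OF y]
  proof eventually_elim
    case (elim n)
    let ?P = "\<pi> n (q x)" and ?Q = "\<pi> n (q y)"
    have P: "?P \<in> carrier (unitary_group (k n))" and Q: "?Q \<in> carrier (unitary_group (k n))"
      using x y \<pi>u by auto
    let ?V = "?P * U n y * mat_adjoint ?P"
    have V: "?V \<in> carrier_mat (k n) (k n)"
      using unitaryD[OF P] Uc[OF y] by (simp add: sq_mat[where n = "k n"])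
    have prod: "U n (x \<otimes>\<^bsub>E\<^esub> y) = U n x * ?V"
      using x y unitaryD[OF P] unitaryD[OF Q] unitaryD[OF Ru[OF x, of n]] unitaryD[OF Ru[OF y, of n]]
      by (simp add: U_def Rm qm \<pi>m sq_mat[where n = "k n"] unitary_cancel[OF P, where k = "k n"])
    obtain a b where ab: "det_log (U n x) a" "det_log ?V b" "det_log (U n x * ?V) (a + b)"
      using det_log_mult[OF Uc[OF x] V elim(1) norm_le_conj[OF P Uc[OF y] elim(2)]] by blast
    obtain b' where b': "det_log (U n y) b'"
      using det_log_mult[OF Uc[OF y] Uc[OF y] elim(2) elim(2)] by blast
    then have "b' = b" using det_log_conj[OF P Uc[OF y] b'] det_log_unique[OF ab(2)] by simp
    then show ?case using ab b' by (simp add: l_eq prod)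
  qed
  have l_one: "eventually (\<lambda>n. l n \<one>\<^bsub>E\<^esub> = 0) sequentially"
    using l_add[OF E.one_closed E.one_closed] by (simp add: eventually_mono)
  have l_inv: "eventually (\<lambda>n. l n (inv\<^bsub>E\<^esub> x) = - l n x) sequentially" if x: "x \<in> carrier E" for x
    using l_add[OF x E.inv_closed[OF x]] l_one
    by eventually_elim (use x in \<open>simp add: eq_neg_iff_add_eq_0 add.commute\<close>)
  have comm: "eventually (\<lambda>n. l n y = 0) sequentially" if y: "y \<in> derived_set E (carrier E)" for y
  proof -
    obtain g h where gh: "g \<in> carrier E" "h \<in> carrier E"
      and yeq: "y = g \<otimes>\<^bsub>E\<^esub> h \<otimes>\<^bsub>E\<^esub> inv\<^bsub>E\<^esub> g \<otimes>\<^bsub>E\<^esub> inv\<^bsub>E\<^esub> h" using y by auto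
    have c: "g \<otimes>\<^bsub>E\<^esub> h \<in> carrier E" "g \<otimes>\<^bsub>E\<^esub> h \<otimes>\<^bsub>E\<^esub> inv\<^bsub>E\<^esub> g \<in> carrier E"
      using gh by auto
    show ?thesis
      using l_add[OF gh] l_add[OF c(1) E.inv_closed[OF gh(1)]] l_add[OF c(2) E.inv_closed[OF gh(2)]]
        l_inv[OF gh(1)] l_inv[OF gh(2)]
      unfolding yeq by eventually_elim simp
  qed
  \<comment> \<open>How large \<open>n\<close> must be depends on \<open>y\<close>; the induction
    over generated elements combines finitely many such conditions.\<close>
  have "eventually (\<lambda>n. l n y = 0) sequentially" if "y \<in> derived E (carrier E)" for y
    using that unfolding derived_def
  proof (induction rule: generate.induct)
    case one
    then show ?case by (rule l_one)
  next
    case (incl h)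
    then show ?case by (rule comm)
  next
    case (inv h)
    then have "h \<in> carrier E" using E.derived_set_in_carrier[of "carrier E"] by blast
    from l_inv[OF this] comm[OF inv] show ?case by eventually_elim simp
  next
    case (eng h1 h2)
    have sub: "derived_set E (carrier E) \<subseteq> carrier E" by (rule E.derived_set_in_carrier) simp
    note h = eng.hyps[THEN E.generate_in_carrier[OF sub]]
    from l_add[OF h] eng.IH show ?case by eventually_elim simp
  qed
  from this[OF m(2)] have "eventually (\<lambda>n. l n (\<iota> m) = 0) sequentially" .
  moreover have "eventually (\<lambda>n. \<bar>2 * pi * of_int m / D n\<bar> < 1) sequentially"
    by (rule order_tendstoD[OF cis0]) simp
  moreover have "eventually (\<lambda>n. 0 < D n) sequentially"
    using D unfolding filterlim_at_top_dense by blast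
  ultimately have "eventually (\<lambda>n. False) sequentially"
  proof eventually_elim
    case (elim n)
    let ?t = "2 * pi * of_int m / D n"
    have "\<pi> n \<one>\<^bsub>G\<^esub> = 1\<^sub>m (k n)"
    proof -
      have o: "\<pi> n \<one>\<^bsub>G\<^esub> * \<pi> n \<one>\<^bsub>G\<^esub> = \<pi> n \<one>\<^bsub>G\<^esub>" using \<pi>m[of "\<one>\<^bsub>G\<^esub>" "\<one>\<^bsub>G\<^esub>" n] by simp
      note u = \<pi>u[OF G.one_closed, of n]
      have "mat_adjoint (\<pi> n \<one>\<^bsub>G\<^esub>) * (\<pi> n \<one>\<^bsub>G\<^esub> * \<pi> n \<one>\<^bsub>G\<^esub>) = \<pi> n \<one>\<^bsub>G\<^esub>"
        by (rule unitary_cancel[OF u]) (rule unitaryD[OF u])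
      then show ?thesis unfolding o using unitaryD[OF u] by simp
    qed
    then have "U n (\<iota> m) = cis ?t \<cdot>\<^sub>m 1\<^sub>m (k n)" by (simp add: U_def Ri)
    moreover have "cmod (cis ?t - 1) < 1" using cmod_cis_minus_one_le[of ?t] elim by linarith
    ultimately have "l n (\<iota> m) = of_nat (k n) * Ln (cis ?t)"
      using l_eq det_log_scalar by simp
    \<comment> \<open>The dimension cancels because it is nonzero. What remains says that
      \<open>?t\<close> is a multiple of \<open>2 * pi\<close>, although it is nonzero and smaller
      than 1 in absolute value.\<close>
    then have "Ln (cis ?t) = 0" using elim k[of n] by simp
    then have "cis ?t = 1" using exp_Ln[of "cis ?t"] by simp
    then have "sin ?t = 0" "cos ?t = 1" by (simp_all add: complex_eq_iff)
    then obtain j :: int where "?t = of_int j * (2 * pi)" using cos_one_2pi_int by auto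
    then have "\<bar>of_int j :: real\<bar> * (2 * pi) < 1" using elim by (simp add: abs_mult)
    moreover have "?t \<noteq> 0" using m elim by simp
    then have "j \<noteq> 0" using \<open>?t = _\<close> by auto
    then have "1 \<le> \<bar>of_int j :: real\<bar>" by linarith
    then have "1 * (2 * pi) \<le> \<bar>of_int j :: real\<bar> * (2 * pi)" by (intro mult_right_mono) auto
    ultimately show ?case using pi_gt3 by linarith
  qed
  then show False by simp
qed

end

section \<open>Asymptotic homomorphisms from representations of the extension\<close>

context int_extension
begin

text \<open>The extension itself stays fixed, so the same representations of \<open>E\<close> serve
  every section; only the cocycle changes, by a coboundary.\<close>

lemma change_section:
  "int_extension G E \<iota> q (\<lambda>s. \<iota> (a s) \<otimes>\<^bsub>E\<^esub> \<sigma> s) (\<lambda>s t. c s t + a s + a t - a (s \<otimes>\<^bsub>G\<^esub> t))"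
proof unfold_locales
  fix s t assume st: "s \<in> carrier G" "t \<in> carrier G"
  have "(\<iota> (a s) \<otimes>\<^bsub>E\<^esub> \<sigma> s) \<otimes>\<^bsub>E\<^esub> (\<iota> (a t) \<otimes>\<^bsub>E\<^esub> \<sigma> t) = \<iota> (a s) \<otimes>\<^bsub>E\<^esub> (\<sigma> s \<otimes>\<^bsub>E\<^esub> \<iota> (a t)) \<otimes>\<^bsub>E\<^esub> \<sigma> t"
    using st by (simp add: E.m_assoc sec_closed)
  also have "\<dots> = \<iota> (a s + a t) \<otimes>\<^bsub>E\<^esub> (\<sigma> s \<otimes>\<^bsub>E\<^esub> \<sigma> t)"
    using st by (simp add: E.m_assoc sec_closed iota_add iota_central[OF sec_closed[OF st(1)], symmetric])
  also have "\<dots> = \<iota> (a s + a t + c s t) \<otimes>\<^bsub>E\<^esub> \<sigma> (s \<otimes>\<^bsub>G\<^esub> t)"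
    using st by (simp add: sec_mult E.m_assoc sec_closed iota_add)
  also have "a s + a t + c s t = (c s t + a s + a t - a (s \<otimes>\<^bsub>G\<^esub> t)) + a (s \<otimes>\<^bsub>G\<^esub> t)" by simp
  also have "\<iota> \<dots> \<otimes>\<^bsub>E\<^esub> \<sigma> (s \<otimes>\<^bsub>G\<^esub> t) =
      \<iota> (c s t + a s + a t - a (s \<otimes>\<^bsub>G\<^esub> t)) \<otimes>\<^bsub>E\<^esub> (\<iota> (a (s \<otimes>\<^bsub>G\<^esub> t)) \<otimes>\<^bsub>E\<^esub> \<sigma> (s \<otimes>\<^bsub>G\<^esub> t))"
    using st unfolding iota_add by (simp add: E.m_assoc sec_closed)
  finally show "(\<iota> (a s) \<otimes>\<^bsub>E\<^esub> \<sigma> s) \<otimes>\<^bsub>E\<^esub> (\<iota> (a t) \<otimes>\<^bsub>E\<^esub> \<sigma> t) =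
      \<iota> (c s t + a s + a t - a (s \<otimes>\<^bsub>G\<^esub> t)) \<otimes>\<^bsub>E\<^esub> (\<iota> (a (s \<otimes>\<^bsub>G\<^esub> t)) \<otimes>\<^bsub>E\<^esub> \<sigma> (s \<otimes>\<^bsub>G\<^esub> t))" .
next
  fix s assume s: "s \<in> carrier G"
  then have "q (\<iota> (a s) \<otimes>\<^bsub>E\<^esub> \<sigma> s) = q (\<iota> (a s)) \<otimes>\<^bsub>G\<^esub> q (\<sigma> s)"
    using q_hom sec_closed[OF s] by (auto simp: hom_def)
  then show "q (\<iota> (a s) \<otimes>\<^bsub>E\<^esub> \<sigma> s) = s" using s by (simp add: q_sec)
qed (use sec_closed ext in auto)

end

text \<open>The assumption \<open>decay\<close> balances dimension against the order of the central
  character: up to a factor depending on the cocycle, its left side bounds the multiplicative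
  defect.\<close>

locale scalar_representations = int_extension G E \<iota> q \<sigma> c
  for G :: "('a, 'b) monoid_scheme" and E :: "('e, 'c) monoid_scheme"
    and \<iota> :: "int \<Rightarrow> 'e" and q :: "'e \<Rightarrow> 'a" and \<sigma> :: "'a \<Rightarrow> 'e" and c :: "'a \<Rightarrow> 'a \<Rightarrow> int" +
  fixes R :: "nat \<Rightarrow> 'e \<Rightarrow> complex mat" and k :: "nat \<Rightarrow> nat" and D :: "nat \<Rightarrow> real"
    and N :: "complex mat \<Rightarrow> real" and e :: real
  assumes R: "R n \<in> hom E (unitary_group (k n))" and k: "k n \<ge> 1"
    and R_iota: "R n (\<iota> m) = cis (2 * pi * of_int m / D n) \<cdot>\<^sub>m 1\<^sub>m (k n)"
    and D_pos: "0 < D n" and D_top: "filterlim D at_top sequentially"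
    and N: "unitary_norm_growth N e"
    and decay: "(\<lambda>n. real (k n) powr e / D n) \<longlonglongrightarrow> 0"
begin

lemma R_unitary: "x \<in> carrier E \<Longrightarrow> R n x \<in> carrier (unitary_group (k n))"
  using R[of n] by (auto simp: hom_def)

lemma R_mult: "x \<in> carrier E \<Longrightarrow> y \<in> carrier E \<Longrightarrow> R n (x \<otimes>\<^bsub>E\<^esub> y) = R n x * R n y"
  using R[of n] by (auto simp: hom_def unitary_group_def)

text \<open>By the section identity the product of the two values is the value at the product times
  the scalar by which \<open>\<iota> (c s t)\<close> acts. The defect is thus a scalar times a
  unitary, and a chord is at most its arc.\<close>

lemma defect_norm:
  assumes st: "s \<in> carrier G" "t \<in> carrier G"
  shows "0 \<le> N (R n (\<sigma> (s \<otimes>\<^bsub>G\<^esub> t)) - R n (\<sigma> s) * R n (\<sigma> t))"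
    and "N (R n (\<sigma> (s \<otimes>\<^bsub>G\<^esub> t)) - R n (\<sigma> s) * R n (\<sigma> t)) \<le>
      real (k n) powr e / D n * (2 * pi * \<bar>of_int (c s t)\<bar>)"
proof -
  let ?z = "cis (2 * pi * of_int (c s t) / D n)"
  have u: "R n (\<sigma> (s \<otimes>\<^bsub>G\<^esub> t)) \<in> carrier (unitary_group (k n))"
    using st by (intro R_unitary sec_closed) simp
  note uc = unitaryD[OF u]
  have "R n (\<sigma> s) * R n (\<sigma> t) = R n (\<iota> (c s t) \<otimes>\<^bsub>E\<^esub> \<sigma> (s \<otimes>\<^bsub>G\<^esub> t))"
    using st by (simp add: sec_closed flip: R_mult sec_mult)
  also have "\<dots> = ?z \<cdot>\<^sub>m R n (\<sigma> (s \<otimes>\<^bsub>G\<^esub> t))"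
    using st uc by (simp add: R_mult sec_closed R_iota mult_smult_assoc_mat[of _ "k n" "k n"])
  finally have "R n (\<sigma> (s \<otimes>\<^bsub>G\<^esub> t)) - R n (\<sigma> s) * R n (\<sigma> t) = (1 - ?z) \<cdot>\<^sub>m R n (\<sigma> (s \<otimes>\<^bsub>G\<^esub> t))"
    using uc by (auto simp: algebra_simps)
  moreover have "N ((1 - ?z) \<cdot>\<^sub>m R n (\<sigma> (s \<otimes>\<^bsub>G\<^esub> t))) \<le> real (k n) powr e * cmod (1 - ?z)"
    using N k[of n] u unfolding unitary_norm_growth_def by blast
  moreover have "cmod (1 - ?z) \<le> 2 * pi * \<bar>of_int (c s t)\<bar> / D n"
    using cmod_cis_minus_one_le[of "2 * pi * of_int (c s t) / D n"] D_pos[of n]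
    by (simp add: norm_minus_commute abs_mult)
  then have "real (k n) powr e * cmod (1 - ?z) \<le> real (k n) powr e * (2 * pi * \<bar>of_int (c s t)\<bar> / D n)"
    by (intro mult_left_mono) auto
  ultimately show "N (R n (\<sigma> (s \<otimes>\<^bsub>G\<^esub> t)) - R n (\<sigma> s) * R n (\<sigma> t)) \<le>
      real (k n) powr e / D n * (2 * pi * \<bar>of_int (c s t)\<bar>)"
    by simp
  show "0 \<le> N (R n (\<sigma> (s \<otimes>\<^bsub>G\<^esub> t)) - R n (\<sigma> s) * R n (\<sigma> t))"
    using N uc(1) unitaryD(1)[OF R_unitary[OF sec_closed[OF st(1)], of n]]
      unitaryD(1)[OF R_unitary[OF sec_closed[OF st(2)], of n]]
    unfolding unitary_norm_growth_def by (meson minus_carrier_mat mult_carrier_mat)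
qed

lemma unital:
  assumes "c \<one>\<^bsub>G\<^esub> \<one>\<^bsub>G\<^esub> = 0"
  shows "unital_unitary_maps G k (\<lambda>n s. R n (\<sigma> s))"
  unfolding unital_unitary_maps_def
proof (intro allI conjI)
  fix n
  show "R n (\<sigma> \<one>\<^bsub>G\<^esub>) = 1\<^sub>m (k n)"
    using R_iota[of n 0] assms by (simp add: sec_one one_smult_mat)
qed (use k R_unitary sec_closed in auto)

lemma not_locally_near_hom:
  assumes m: "m \<noteq> 0" "\<iota> m \<in> derived E (carrier E)"
  shows "\<not> locally_near_hom N G k (\<lambda>n s. R n (\<sigma> s))"
proof
  assume "locally_near_hom N G k (\<lambda>n s. R n (\<sigma> s))"
  then obtain \<pi> where \<pi>: "\<And>n. \<pi> n \<in> hom G (unitary_group (k n))"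
    and lim: "\<And>s. s \<in> carrier G \<Longrightarrow> (\<lambda>n. N (R n (\<sigma> s) - \<pi> n s)) \<longlonglongrightarrow> 0"
    unfolding locally_near_hom_def by blast
  have "\<exists>\<epsilon>. \<epsilon> \<longlonglongrightarrow> 0 \<and> (\<forall>n. norm_le (R n (\<sigma> s) - \<pi> n s) (\<epsilon> n))" if s: "s \<in> carrier G" for s
  proof (intro exI conjI allI)
    fix n
    have "\<pi> n s \<in> carrier (unitary_group (k n))" using \<pi>[of n] s by (auto simp: hom_def)
    then have "R n (\<sigma> s) - \<pi> n s \<in> carrier_mat (k n) (k n)" by (intro minus_carrier_mat unitaryD)
    then show "norm_le (R n (\<sigma> s) - \<pi> n s) (N (R n (\<sigma> s) - \<pi> n s))"
      using N unfolding unitary_norm_growth_def by blast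
  qed (rule lim[OF s])
  from no_nearby_homs[OF R k R_iota D_top \<pi> this m] show False .
qed

theorem not_local_to_local_stable:
  assumes "m \<noteq> 0" "\<iota> m \<in> derived E (carrier E)" "c \<one>\<^bsub>G\<^esub> \<one>\<^bsub>G\<^esub> = 0"
  shows "\<not> local_to_local_stable N G"
proof -
  have "(\<lambda>n. N (R n (\<sigma> (s \<otimes>\<^bsub>G\<^esub> t)) - R n (\<sigma> s) * R n (\<sigma> t))) \<longlonglongrightarrow> 0"
    if st: "s \<in> carrier G" "t \<in> carrier G" for s t
  proof (rule tendsto_sandwich[OF _ _ tendsto_const])
    show "(\<lambda>n. real (k n) powr e / D n * (2 * pi * \<bar>of_int (c s t)\<bar>)) \<longlonglongrightarrow> 0"
      by (rule tendsto_mult_left_zero[OF decay])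
  qed (use defect_norm[OF st] in auto)
  then show ?thesis
    unfolding local_to_local_stable_def using unital[OF assms(3)] not_locally_near_hom[OF assms(1,2)] by blast
qed

theorem not_uniform_to_local_stable:
  assumes "m \<noteq> 0" "\<iota> m \<in> derived E (carrier E)" "c \<one>\<^bsub>G\<^esub> \<one>\<^bsub>G\<^esub> = 0"
    and B: "\<And>s t. s \<in> carrier G \<Longrightarrow> t \<in> carrier G \<Longrightarrow> \<bar>c s t\<bar> \<le> B"
  shows "\<not> uniform_to_local_stable N G"
proof -
  let ?f = "\<lambda>n (s, t). N (R n (\<sigma> (s \<otimes>\<^bsub>G\<^esub> t)) - R n (\<sigma> s) * R n (\<sigma> t))"
  let ?b = "\<lambda>n. real (k n) powr e / D n * (2 * pi * of_int B)"
  have le: "?f n x \<le> ?b n" if xG: "x \<in> carrier G \<times> carrier G" for n x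
  proof -
    obtain s t where x: "x = (s, t)" "s \<in> carrier G" "t \<in> carrier G" using xG by auto
    have "\<bar>real_of_int (c s t)\<bar> \<le> of_int B" using B[OF x(2,3)] by linarith
    then have "real (k n) powr e / D n * (2 * pi * \<bar>of_int (c s t)\<bar>) \<le> ?b n"
      using D_pos[of n] by (intro mult_left_mono) auto
    then show ?thesis using defect_norm(2)[OF x(2,3), of n] x(1) by simp
  qed
  have "(\<lambda>n. SUP x \<in> carrier G \<times> carrier G. ?f n x) \<longlonglongrightarrow> 0"
  proof (rule tendsto_sandwich[OF _ _ tendsto_const])
    show "eventually (\<lambda>n. 0 \<le> (SUP x \<in> carrier G \<times> carrier G. ?f n x)) sequentially"
    proof (intro always_eventually allI)
      fix n
      \<comment> \<open>The real supremum dominates its members only because \<open>?b n\<close>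
        bounds the family; this is where the bound on the cocycle ensures that the supremum is not a
        default value.\<close>
      have "?f n (\<one>\<^bsub>G\<^esub>, \<one>\<^bsub>G\<^esub>) \<le> (SUP x \<in> carrier G \<times> carrier G. ?f n x)"
        using le by (intro cSUP_upper bdd_aboveI2[where M = "?b n"]) auto
      then show "0 \<le> (SUP x \<in> carrier G \<times> carrier G. ?f n x)"
        using defect_norm(1)[of "\<one>\<^bsub>G\<^esub>" "\<one>\<^bsub>G\<^esub>" n] by simp
    qed
    show "eventually (\<lambda>n. (SUP x \<in> carrier G \<times> carrier G. ?f n x) \<le> ?b n) sequentially"
      using le G.one_closed by (intro always_eventually allI cSUP_least) auto
    show "?b \<longlonglongrightarrow> 0" by (rule tendsto_mult_left_zero[OF decay])
  qed
  then show ?thesis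
    unfolding uniform_to_local_stable_def using unital[OF assms(3)] not_locally_near_hom[OF assms(1,2)] by blast
qed

theorem not_stable:
  assumes fg: "finitely_generated_group G"
    and inf: "\<And>d u. 0 < (d :: int) \<Longrightarrow>
      \<not> (\<forall>s\<in>carrier G. \<forall>t\<in>carrier G. d * c s t = u s + u t - u (s \<otimes>\<^bsub>G\<^esub> t))"
  shows "\<not> local_to_local_stable N G"
    and "hyperbolic_group G \<Longrightarrow> \<not> uniform_to_local_stable N G"
proof -
  obtain m where m: "m \<noteq> 0" "\<iota> m \<in> derived E (carrier E)"
    using iota_in_derived[OF fg inf] by blast
  \<comment> \<open>Shifts of the section also serve to normalize the cocycle at the identity, so
    that the resulting maps are unital.\<close>
  have reps: "scalar_representations G E \<iota> q (\<lambda>s. \<iota> (a s) \<otimes>\<^bsub>E\<^esub> \<sigma> s)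
      (\<lambda>s t. c s t + a s + a t - a (s \<otimes>\<^bsub>G\<^esub> t)) R k D N e" for a
    by (intro scalar_representations.intro change_section scalar_representations_axioms.intro
        R k R_iota D_pos D_top N decay)
  define n0 where "n0 = c \<one>\<^bsub>G\<^esub> \<one>\<^bsub>G\<^esub>"
  show "\<not> local_to_local_stable N G"
    using scalar_representations.not_local_to_local_stable[OF reps[of "\<lambda>_. - n0"] m] by (simp add: n0_def)
  assume "hyperbolic_group G"
  then obtain a B where B: "\<And>s t. s \<in> carrier G \<Longrightarrow> t \<in> carrier G \<Longrightarrow> \<bar>c s t + a s + a t - a (s \<otimes>\<^bsub>G\<^esub> t)\<bar> \<le> B"
    using G.hyperbolic_bounded_cocycle[OF _ cocycle] by blast
  define a' where "a' s = a s - (n0 + a \<one>\<^bsub>G\<^esub>)" for s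
  show "\<not> uniform_to_local_stable N G"
  proof (rule scalar_representations.not_uniform_to_local_stable[OF reps[of a'] m])
    show "c \<one>\<^bsub>G\<^esub> \<one>\<^bsub>G\<^esub> + a' \<one>\<^bsub>G\<^esub> + a' \<one>\<^bsub>G\<^esub> - a' (\<one>\<^bsub>G\<^esub> \<otimes>\<^bsub>G\<^esub> \<one>\<^bsub>G\<^esub>) = 0"
      by (simp add: a'_def n0_def)
    fix s t assume "s \<in> carrier G" "t \<in> carrier G"
    then show "\<bar>c s t + a' s + a' t - a' (s \<otimes>\<^bsub>G\<^esub> t)\<bar> \<le> B + \<bar>n0 + a \<one>\<^bsub>G\<^esub>\<bar>"
      using B[of s t] by (simp add: a'_def)
  qed
qed

end

section \<open>Induced representations\<close>

context group
begin

text \<open>In a basis indexed by right cosets with representatives \<open>r i\<close>, the entry of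
  \<open>R x\<close> is \<chi> of \<open>r i \<otimes> x \<otimes> inv (r j)\<close>, or 0 outside
  \<open>H\<close>. Each row has one nonzero entry, so the sum in a matrix product collapses; the
  adjoint of \<open>R x\<close> is \<open>R (inv x)\<close>. A central \<open>z\<close> in
  \<open>H\<close> can be pulled out of every entry, which leaves a scalar matrix.\<close>

theorem induced_representation:
  assumes H: "subgroup H G" and fin: "finite (rcosets H)"
    and \<chi>m: "\<And>x y. x \<in> H \<Longrightarrow> y \<in> H \<Longrightarrow> \<chi> (x \<otimes> y) = \<chi> x * \<chi> y"
    and \<chi>1: "\<And>x. x \<in> H \<Longrightarrow> cmod (\<chi> x) = 1"
  shows "\<exists>R\<in>hom G (unitary_group (card (rcosets H))). \<forall>z\<in>H.
    (\<forall>x\<in>carrier G. z \<otimes> x = x \<otimes> z) \<longrightarrow> R z = \<chi> z \<cdot>\<^sub>m 1\<^sub>m (card (rcosets H))"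
proof -
  interpret H: subgroup H G by (rule H)
  define k where "k = card (rcosets H)"
  obtain f where f: "bij_betw f {0..<k} (rcosets H)"
    using ex_bij_betw_nat_finite[OF fin] unfolding k_def by blast
  have "\<exists>x\<in>carrier G. f i = H #> x" if "i < k" for i
  proof -
    have "f i \<in> rcosets H" using f that by (auto simp: bij_betw_def)
    then show ?thesis by (auto simp: RCOSETS_def)
  qed
  then obtain r where r: "\<And>i. i < k \<Longrightarrow> r i \<in> carrier G" "\<And>i. i < k \<Longrightarrow> f i = H #> r i"
    by metis
  have coset: "x \<otimes> inv (r i) \<in> H \<longleftrightarrow> H #> x = f i" if "x \<in> carrier G" "i < k" for x i
  proof -
    have "x \<otimes> inv (r i) \<in> H \<longleftrightarrow> x \<in> H #> r i" using H.rcos_module[OF is_group r(1)[OF that(2)] that(1)] ..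
    also have "\<dots> \<longleftrightarrow> H #> x = H #> r i"
      using repr_independence[OF _ r(1)[OF that(2)] H, of x] rcos_self[OF that(1) H] by auto
    finally show ?thesis using r(2)[OF that(2)] by simp
  qed
  have uniq: "\<exists>i<k. \<forall>j<k. x \<otimes> inv (r j) \<in> H \<longleftrightarrow> j = i" if x: "x \<in> carrier G" for x
  proof -
    have "H #> x \<in> rcosets H" using x by (auto simp: RCOSETS_def)
    then have "H #> x \<in> f ` {0..<k}" using f by (simp add: bij_betw_def)
    then obtain i where i: "i < k" "f i = H #> x" by auto
    have "x \<otimes> inv (r j) \<in> H \<longleftrightarrow> j = i" if "j < k" for j
      using coset[OF x that] i f that inj_onD[of f "{0..<k}" j i] by (auto simp: bij_betw_def)
    with i show ?thesis by blast
  qed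
  define \<chi>0 where "\<chi>0 x = (if x \<in> H then \<chi> x else 0)" for x
  have \<chi>_one: "\<chi> \<one> = 1"
    using \<chi>m[of \<one> \<one>] \<chi>1[of \<one>] H.one_closed by auto
  have \<chi>_inv: "\<chi>0 (inv x) = cnj (\<chi>0 x)" if x: "x \<in> carrier G" for x
  proof (cases "x \<in> H")
    case True
    then have "\<chi> x * \<chi> (inv x) = 1" using \<chi>m[of x "inv x"] \<chi>_one x by simp
    moreover have "\<chi> x * cnj (\<chi> x) = 1" using \<chi>1[OF True] by (simp flip: complex_norm_square)
    moreover have "\<chi> x \<noteq> 0" using \<chi>1[OF True] by auto
    ultimately have "\<chi> (inv x) = cnj (\<chi> x)" by (metis mult_left_cancel)
    with True show ?thesis by (simp add: \<chi>0_def)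
  next
    case False
    then have "inv x \<notin> H" using x H.m_inv_closed[of "inv x"] by auto
    with False show ?thesis by (simp add: \<chi>0_def)
  qed
  define R where "R x = Matrix.mat k k (\<lambda>(i, j). \<chi>0 (r i \<otimes> x \<otimes> inv (r j)))" for x
  have Rc: "R x \<in> carrier_mat k k" for x by (simp add: R_def)
  have Rm: "R (x \<otimes> y) = R x * R y" if x: "x \<in> carrier G" and y: "y \<in> carrier G" for x y
  proof (rule eq_matI)
    fix i j assume "i < dim_row (R x * R y)" "j < dim_col (R x * R y)"
    then have ij: "i < k" "j < k" using Rc[of x] Rc[of y] by auto
    have rx: "r i \<otimes> x \<in> carrier G" using r ij x by simp
    obtain l where l: "l < k" "\<And>j. j < k \<Longrightarrow> r i \<otimes> x \<otimes> inv (r j) \<in> H \<longleftrightarrow> j = l"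
      using uniq[OF rx] by blast
    have "(R x * R y) $$ (i, j) = (\<Sum>m<k. \<chi>0 (r i \<otimes> x \<otimes> inv (r m)) * \<chi>0 (r m \<otimes> y \<otimes> inv (r j)))"
      using ij by (auto simp: R_def scalar_prod_def lessThan_atLeast0 intro!: sum.cong)
    also have "\<dots> = (\<Sum>m<k. if m = l then \<chi> (r i \<otimes> x \<otimes> inv (r l)) * \<chi>0 (r l \<otimes> y \<otimes> inv (r j)) else 0)"
      using l by (intro sum.cong) (auto simp: \<chi>0_def)
    also have "\<dots> = \<chi> (r i \<otimes> x \<otimes> inv (r l)) * \<chi>0 (r l \<otimes> y \<otimes> inv (r j))" using l(1) by simp
    also have "\<dots> = \<chi>0 (r i \<otimes> (x \<otimes> y) \<otimes> inv (r j))"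
    proof -
      let ?g = "r i \<otimes> x \<otimes> inv (r l)" and ?h = "r l \<otimes> y \<otimes> inv (r j)"
      have g: "?g \<in> H" using l by blast
      have hc: "?h \<in> carrier G" using r l ij y by simp
      have gh: "?g \<otimes> ?h = r i \<otimes> (x \<otimes> y) \<otimes> inv (r j)"
        using r[OF ij(1)] r[OF ij(2)] r[OF l(1)] x y by (simp add: m_assoc inv_mult_left)
      show ?thesis
      proof (cases "?h \<in> H")
        case True
        then show ?thesis using g \<chi>m[OF g True] H.m_closed[OF g True] by (simp add: \<chi>0_def gh)
      next
        case False
        have "?g \<otimes> ?h \<notin> H"
        proof
          assume "?g \<otimes> ?h \<in> H"
          then have "inv ?g \<otimes> (?g \<otimes> ?h) \<in> H" using g by blast
          then show False using False hc g inv_mult_left[of ?g ?h] H.mem_carrier[OF g] by simp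
        qed
        with False show ?thesis unfolding gh by (simp add: \<chi>0_def)
      qed
    qed
    finally show "R (x \<otimes> y) $$ (i, j) = (R x * R y) $$ (i, j)" using ij by (simp add: R_def)
  qed (simp_all add: R_def)
  have Rz: "R z = \<chi> z \<cdot>\<^sub>m 1\<^sub>m k" if z: "z \<in> H" and cent: "\<And>x. x \<in> carrier G \<Longrightarrow> z \<otimes> x = x \<otimes> z" for z
  proof (rule eq_matI)
    fix i j assume "i < dim_row (\<chi> z \<cdot>\<^sub>m 1\<^sub>m k)" "j < dim_col (\<chi> z \<cdot>\<^sub>m 1\<^sub>m k)"
    then have ij: "i < k" "j < k" by auto
    have zc: "z \<in> carrier G" using z by simp
    have eq: "r i \<otimes> z \<otimes> inv (r j) = z \<otimes> (r i \<otimes> inv (r j))"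
      using r[OF ij(1)] r[OF ij(2)] zc by (simp add: cent m_assoc[symmetric])
    have "r i \<otimes> inv (r j) \<in> H \<longleftrightarrow> i = j"
    proof -
      obtain l where l: "l < k" "\<And>j. j < k \<Longrightarrow> r i \<otimes> inv (r j) \<in> H \<longleftrightarrow> j = l"
        using uniq[OF r(1)[OF ij(1)]] by blast
      have "i = l" using l(2)[OF ij(1)] r[OF ij(1)] by simp
      then show ?thesis using l(2)[OF ij(2)] by auto
    qed
    moreover have "z \<otimes> (r i \<otimes> inv (r j)) \<in> H \<longleftrightarrow> r i \<otimes> inv (r j) \<in> H"
    proof
      assume "z \<otimes> (r i \<otimes> inv (r j)) \<in> H"
      then have "inv z \<otimes> (z \<otimes> (r i \<otimes> inv (r j))) \<in> H" using z by blast
      then show "r i \<otimes> inv (r j) \<in> H" using r[OF ij(1)] r[OF ij(2)] zc by (simp add: inv_mult_left)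
    qed (use z in blast)
    moreover have "R z $$ (i, j) = \<chi>0 (z \<otimes> (r i \<otimes> inv (r j)))" using ij by (simp add: R_def eq)
    ultimately show "R z $$ (i, j) = (\<chi> z \<cdot>\<^sub>m 1\<^sub>m k) $$ (i, j)"
      using ij r zc by (cases "i = j") (simp_all add: \<chi>0_def z)
  qed (simp_all add: R_def)
  have adj: "mat_adjoint (R x) = R (inv x)" if x: "x \<in> carrier G" for x
  proof (rule eq_matI)
    fix i j assume "i < dim_row (R (inv x))" "j < dim_col (R (inv x))"
    then have ij: "i < k" "j < k" by (auto simp: R_def)
    have "inv (r j \<otimes> x \<otimes> inv (r i)) = r i \<otimes> inv x \<otimes> inv (r j)"
      using r[OF ij(1)] r[OF ij(2)] x by (simp add: inv_mult_group m_assoc)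
    then show "mat_adjoint (R x) $$ (i, j) = R (inv x) $$ (i, j)"
      using ij r[OF ij(1)] r[OF ij(2)] x \<chi>_inv[of "r j \<otimes> x \<otimes> inv (r i)"] by (simp add: R_def)
  qed (simp_all add: R_def)
  have R1: "R \<one> = 1\<^sub>m k" using Rz[OF H.one_closed] \<chi>_one by (simp add: one_smult_mat)
  have "R x \<in> carrier (unitary_group k)" if x: "x \<in> carrier G" for x
    using x R1 by (intro unitaryI[OF Rc]) (simp add: adj flip: Rm)
  then have "R \<in> hom G (unitary_group k)" using Rm by (auto simp: hom_def unitary_group_def)
  then show ?thesis unfolding k_def[symmetric] using Rz by blast
qed

end

section \<open>Finite index subgroups and Heisenberg extensions\<close>

context group
begin

lemma rcos_eqI:
  assumes "subgroup H G" "x \<in> carrier G" "y \<in> carrier G" "x \<otimes> inv y \<in> H"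
  shows "H #> x = H #> y"
proof -
  have "x \<in> H #> y" using subgroup.rcos_module[OF assms(1) is_group assms(3,2)] assms(4) by simp
  then show ?thesis using repr_independence[OF _ assms(3,1)] by simp
qed

lemma rcos_eqD:
  assumes "subgroup H G" "x \<in> carrier G" "y \<in> carrier G" "H #> x = H #> y"
  shows "x \<otimes> inv y \<in> H"
proof -
  have "x \<in> H #> y" using rcos_self[OF assms(2,1)] assms(4) by simp
  then show ?thesis using subgroup.rcos_module[OF assms(1) is_group assms(3,2)] by simp
qed

text \<open>\<open>F\<close> has to separate cosets but may vary within one; representatives then
  inject the cosets into \<open>A\<close>.\<close>

lemma finite_index_criterion:
  assumes H: "subgroup H G" and A: "finite A" "F ` carrier G \<subseteq> A"
    and F: "\<And>x y. \<lbrakk>x \<in> carrier G; y \<in> carrier G; F x = F y\<rbrakk> \<Longrightarrow> x \<otimes> inv y \<in> H"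
  shows "finite (rcosets H)" "card (rcosets H) \<le> card A" "card (rcosets H) \<ge> 1"
proof -
  define rep where "rep C = (SOME x. x \<in> carrier G \<and> C = H #> x)" for C
  have rep: "rep C \<in> carrier G" "C = H #> rep C" if "C \<in> rcosets H" for C
  proof -
    have "\<exists>x. x \<in> carrier G \<and> C = H #> x" using that by (auto simp: RCOSETS_def)
    then have "rep C \<in> carrier G \<and> C = H #> rep C" unfolding rep_def by (rule someI_ex)
    then show "rep C \<in> carrier G" "C = H #> rep C" by blast+
  qed
  have inj: "inj_on (F \<circ> rep) (rcosets H)"
  proof (rule inj_onI)
    fix C C' assume CC': "C \<in> rcosets H" "C' \<in> rcosets H" "(F \<circ> rep) C = (F \<circ> rep) C'"
    then have "H #> rep C = H #> rep C'" using F rep by (intro rcos_eqI[OF H]) auto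
    then show "C = C'" using rep(2) CC' by simp
  qed
  have img: "(F \<circ> rep) ` (rcosets H) \<subseteq> A" using A rep by auto
  show fin: "finite (rcosets H)" using inj_on_finite[OF inj img A(1)] .
  show "card (rcosets H) \<le> card A" using card_inj_on_le[OF inj img A(1)] .
  have "H #> \<one> \<in> rcosets H" by (auto simp: RCOSETS_def)
  then show "card (rcosets H) \<ge> 1" using fin card_gt_0_iff[of "rcosets H"] by fastforce
qed

lemma finite_index_inter:
  assumes "subgroup H G" "finite (rcosets H)" "subgroup K G" "finite (rcosets K)"
  shows "finite (rcosets (H \<inter> K))"
proof (rule finite_index_criterion(1))
  show "subgroup (H \<inter> K) G" using assms by (simp add: subgroups_Inter_pair)
  show "finite ((rcosets H) \<times> (rcosets K))" using assms by simp
  show "(\<lambda>x. (H #> x, K #> x)) ` carrier G \<subseteq> (rcosets H) \<times> (rcosets K)" by (auto simp: RCOSETS_def)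
qed (use rcos_eqD[OF assms(1)] rcos_eqD[OF assms(3)] in auto)

end

section \<open>Representations of extensions of finite type\<close>

context int_extension
begin

text \<open>\<open>K\<close> meets \<open>range \<iota>\<close> in the multiples of its least
  positive member \<open>d\<close>. Hence the trivial character of \<open>K\<close> and the
  character of order \<open>d\<close> on \<open>range \<iota>\<close> agree on the intersection and
  define a character of the product \<open>H\<close>, which is induced to \<open>E\<close>. The
  elements excluded up to \<open>B\<close> force \<open>d > B\<close>.\<close>

lemma character_representation:
  assumes K: "subgroup K E" "finite (rcosets\<^bsub>E\<^esub> K)" and B: "\<And>i :: nat. 0 < i \<Longrightarrow> i \<le> B \<Longrightarrow> \<iota> (int i) \<notin> K"
  shows "\<exists>d>B. \<exists>k\<ge>1. \<exists>R\<in>hom E (unitary_group k).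
    \<forall>j. R (\<iota> j) = cis (2 * pi * of_int j / real d) \<cdot>\<^sub>m 1\<^sub>m k"
proof -
  interpret K: subgroup K E by (rule K(1))
  \<comment> \<open>Pigeonhole: two powers of \<open>\<iota> 1\<close> share a coset of the finite
    index subgroup.\<close>
  have ex: "\<exists>d>0. \<iota> (int d) \<in> K"
  proof -
    have "(\<lambda>n. K #>\<^bsub>E\<^esub> \<iota> (int n)) ` UNIV \<subseteq> rcosets\<^bsub>E\<^esub> K"
      unfolding RCOSETS_def using iota_closed by blast
    then have "finite (range (\<lambda>n. K #>\<^bsub>E\<^esub> \<iota> (int n)))" using K(2) by (rule finite_subset)
    then have "\<not> inj (\<lambda>n. K #>\<^bsub>E\<^esub> \<iota> (int n))" using finite_imageD infinite_UNIV_nat by blast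
    then obtain a b where ab: "a \<noteq> b" "K #>\<^bsub>E\<^esub> \<iota> (int a) = K #>\<^bsub>E\<^esub> \<iota> (int b)"
      unfolding inj_def by blast
    have "\<iota> (int x - int y) \<in> K" if "K #>\<^bsub>E\<^esub> \<iota> (int x) = K #>\<^bsub>E\<^esub> \<iota> (int y)" for x y
      using E.rcos_eqD[OF K(1) _ _ that] by (simp add: iota_inv flip: iota_add)
    then have "\<iota> (int a - int b) \<in> K" "\<iota> (int b - int a) \<in> K" using ab(2) by metis+
    then show ?thesis using ab(1)
      by (cases "a < b") (auto simp: of_nat_diff intro: exI[of _ "b - a"] exI[of _ "a - b"])
  qed
  define d where "d = (LEAST d. 0 < d \<and> \<iota> (int d) \<in> K)"
  have d: "0 < d" "\<iota> (int d) \<in> K" using LeastI_ex[OF ex] by (auto simp: d_def)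
  have d_least: "\<iota> (int i) \<notin> K" if "0 < i" "i < d" for i
    using that not_less_Least[of i "\<lambda>d. 0 < d \<and> \<iota> (int d) \<in> K"] by (auto simp: d_def)
  have dB: "B < d" using B[of d] d by force
  have dvd: "int d dvd j" if j: "\<iota> j \<in> K" for j
  proof -
    have pow: "\<iota> (int d) [^]\<^bsub>E\<^esub> n = \<iota> (int d * n)" for n :: int
      by (metis E.int_pow_pow iota_closed iota_int_pow)
    have "\<iota> (int d * (- (j div int d))) \<in> K"
      using E.subgroup_int_pow_closed[OF K(1) d(2), of "- (j div int d)"] unfolding pow .
    with j have "\<iota> (j + int d * (- (j div int d))) \<in> K" unfolding iota_add by (rule K.m_closed)
    moreover have "j + int d * (- (j div int d)) = j mod int d"
      by (simp add: minus_mult_div_eq_mod)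
    ultimately have m: "\<iota> (int (nat (j mod int d))) \<in> K" using d(1) by simp
    have "nat (j mod int d) < d" using d(1) by (simp add: nat_less_iff)
    then have "nat (j mod int d) = 0" using d_least[of "nat (j mod int d)"] m by blast
    moreover have "0 \<le> j mod int d" using d(1) by simp
    ultimately have "j mod int d = 0" by simp
    then show ?thesis by (simp add: dvd_eq_mod_eq_0)
  qed
  define H where "H = {\<iota> j \<otimes>\<^bsub>E\<^esub> f | j f. f \<in> K}"
  define \<chi> where "\<chi> x = (THE v. \<exists>j. \<exists>f\<in>K. x = \<iota> j \<otimes>\<^bsub>E\<^esub> f \<and> v = cis (2 * pi * of_int j / real d))" for x
  have prod: "(\<iota> j \<otimes>\<^bsub>E\<^esub> f) \<otimes>\<^bsub>E\<^esub> (\<iota> l \<otimes>\<^bsub>E\<^esub> g) = \<iota> (j + l) \<otimes>\<^bsub>E\<^esub> (f \<otimes>\<^bsub>E\<^esub> g)"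
    if "f \<in> K" "g \<in> K" for j l f g
  proof -
    have "f \<otimes>\<^bsub>E\<^esub> (\<iota> l \<otimes>\<^bsub>E\<^esub> g) = \<iota> l \<otimes>\<^bsub>E\<^esub> (f \<otimes>\<^bsub>E\<^esub> g)"
      using that iota_central[of f l] by (simp flip: E.m_assoc)
    then show ?thesis using that by (simp add: iota_add E.m_assoc)
  qed
  have \<chi>: "\<chi> (\<iota> j \<otimes>\<^bsub>E\<^esub> f) = cis (2 * pi * of_int j / real d)" if f: "f \<in> K" for j f
    unfolding \<chi>_def
  proof (rule the_equality)
    show "\<exists>j'. \<exists>f'\<in>K. \<iota> j \<otimes>\<^bsub>E\<^esub> f = \<iota> j' \<otimes>\<^bsub>E\<^esub> f' \<and>
        cis (2 * pi * of_int j / real d) = cis (2 * pi * of_int j' / real d)"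
      using f by blast
    fix v assume "\<exists>j'. \<exists>f'\<in>K. \<iota> j \<otimes>\<^bsub>E\<^esub> f = \<iota> j' \<otimes>\<^bsub>E\<^esub> f' \<and> v = cis (2 * pi * of_int j' / real d)"
    then obtain j' f' where f': "f' \<in> K" and eq: "\<iota> j \<otimes>\<^bsub>E\<^esub> f = \<iota> j' \<otimes>\<^bsub>E\<^esub> f'"
      and v: "v = cis (2 * pi * of_int j' / real d)" by blast
    have "(\<iota> (- j) \<otimes>\<^bsub>E\<^esub> \<one>\<^bsub>E\<^esub>) \<otimes>\<^bsub>E\<^esub> (\<iota> j' \<otimes>\<^bsub>E\<^esub> f') = f"
      unfolding eq[symmetric] using prod[OF K.one_closed f, of "- j" j] f by simp
    then have "\<iota> (j' - j) \<otimes>\<^bsub>E\<^esub> f' = f" using prod[OF K.one_closed f', of "- j" j'] f' by simp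
    then have "\<iota> (j' - j) = f \<otimes>\<^bsub>E\<^esub> inv\<^bsub>E\<^esub> f'" using f f' by (intro E.inv_solve_right[THEN iffD2]) auto
    then have "\<iota> (j' - j) \<in> K" using f f' by simp
    then obtain n where "j' - j = int d * n" using dvd by (auto simp: dvd_def)
    then have "j' = j + int d * n" by simp
    then have "2 * pi * of_int j' / real d = 2 * pi * of_int j / real d + 2 * pi * of_int n"
      using d(1) by (simp add: field_simps)
    then show "v = cis (2 * pi * of_int j / real d)"
      unfolding v by (simp flip: cis_mult)
  qed
  have KH: "K \<subseteq> H"
  proof
    fix f assume "f \<in> K"
    then have "f = \<iota> 0 \<otimes>\<^bsub>E\<^esub> f" by simp
    then show "f \<in> H" unfolding H_def using \<open>f \<in> K\<close> by blast
  qed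
  have H: "subgroup H E"
  proof (rule E.subgroupI)
    show "H \<subseteq> carrier E" by (auto simp: H_def)
    show "H \<noteq> {}" using KH K.one_closed by blast
  next
    fix x assume "x \<in> H"
    then obtain j f where x: "x = \<iota> j \<otimes>\<^bsub>E\<^esub> f" "f \<in> K" by (auto simp: H_def)
    have "inv\<^bsub>E\<^esub> x = \<iota> (- j) \<otimes>\<^bsub>E\<^esub> inv\<^bsub>E\<^esub> f"
      unfolding x(1) using x(2) by (simp add: E.inv_mult_group iota_inv flip: iota_central)
    then show "inv\<^bsub>E\<^esub> x \<in> H" using x(2) unfolding H_def by blast
  next
    fix x y assume "x \<in> H" "y \<in> H"
    then obtain j f l g where "x = \<iota> j \<otimes>\<^bsub>E\<^esub> f" "f \<in> K" "y = \<iota> l \<otimes>\<^bsub>E\<^esub> g" "g \<in> K"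
      by (auto simp: H_def)
    then show "x \<otimes>\<^bsub>E\<^esub> y \<in> H" using prod[of f g j l] unfolding H_def by auto
  qed
  have cos: "(\<lambda>x. K #>\<^bsub>E\<^esub> x) ` carrier E \<subseteq> rcosets\<^bsub>E\<^esub> K" by (auto simp: RCOSETS_def)
  have quot: "x \<otimes>\<^bsub>E\<^esub> inv\<^bsub>E\<^esub> y \<in> H"
    if "x \<in> carrier E" "y \<in> carrier E" "K #>\<^bsub>E\<^esub> x = K #>\<^bsub>E\<^esub> y" for x y
    using E.rcos_eqD[OF K(1) that] KH by blast
  note fin' = E.finite_index_criterion(1,3)[OF H K(2) cos quot]
  have "\<exists>R\<in>hom E (unitary_group (card (rcosets\<^bsub>E\<^esub> H))). \<forall>z\<in>H.
    (\<forall>x\<in>carrier E. z \<otimes>\<^bsub>E\<^esub> x = x \<otimes>\<^bsub>E\<^esub> z) \<longrightarrow> R z = \<chi> z \<cdot>\<^sub>m 1\<^sub>m (card (rcosets\<^bsub>E\<^esub> H))"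
  proof (rule E.induced_representation[OF H fin'(1)])
    fix x y assume "x \<in> H" "y \<in> H"
    then obtain j f l g where xy: "x = \<iota> j \<otimes>\<^bsub>E\<^esub> f" "f \<in> K" "y = \<iota> l \<otimes>\<^bsub>E\<^esub> g" "g \<in> K"
      by (auto simp: H_def)
    have "\<chi> (x \<otimes>\<^bsub>E\<^esub> y) = cis (2 * pi * of_int (j + l) / real d)"
      unfolding xy(1,3) prod[OF xy(2,4)] using xy by (intro \<chi>) simp
    then show "\<chi> (x \<otimes>\<^bsub>E\<^esub> y) = \<chi> x * \<chi> y"
      unfolding xy(1,3) \<chi>[OF xy(2)] \<chi>[OF xy(4)] by (simp add: cis_mult algebra_simps add_divide_distrib)
  next
    fix x assume "x \<in> H"
    then obtain j f where "x = \<iota> j \<otimes>\<^bsub>E\<^esub> f" "f \<in> K" by (auto simp: H_def)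
    then show "cmod (\<chi> x) = 1" by (simp add: \<chi>)
  qed
  then obtain R where R: "R \<in> hom E (unitary_group (card (rcosets\<^bsub>E\<^esub> H)))"
    "\<And>z. z \<in> H \<Longrightarrow> (\<And>x. x \<in> carrier E \<Longrightarrow> z \<otimes>\<^bsub>E\<^esub> x = x \<otimes>\<^bsub>E\<^esub> z) \<Longrightarrow>
      R z = \<chi> z \<cdot>\<^sub>m 1\<^sub>m (card (rcosets\<^bsub>E\<^esub> H))"
    by blast
  have "R (\<iota> j) = cis (2 * pi * of_int j / real d) \<cdot>\<^sub>m 1\<^sub>m (card (rcosets\<^bsub>E\<^esub> H))" for j
  proof -
    have "\<iota> j = \<iota> j \<otimes>\<^bsub>E\<^esub> \<one>\<^bsub>E\<^esub>" by simp
    then have "\<iota> j \<in> H" "\<chi> (\<iota> j) = cis (2 * pi * of_int j / real d)"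
      unfolding H_def using \<chi>[OF K.one_closed, of j] K.one_closed by (blast, simp)
    then show ?thesis using R(2) iota_central by simp
  qed
  then show ?thesis using dB fin'(2) R(1) by blast
qed

text \<open>Finitely many \<open>F l\<close> are intersected, one excluding each of
  \<open>\<iota> 1\<close>, ..., \<open>\<iota> B\<close>. The intersection still has finite index,
  and the given sequence need not be decreasing.\<close>

lemma separating_representations:
  assumes F: "\<And>k :: nat. subgroup (F k) E" "\<And>k. finite (rcosets\<^bsub>E\<^esub> (F k))"
    and sep: "range \<iota> \<inter> (\<Inter>k. F k) = {\<one>\<^bsub>E\<^esub>}"
  shows "\<exists>d>B. \<exists>k\<ge>1. \<exists>R\<in>hom E (unitary_group k).
    \<forall>j. R (\<iota> j) = cis (2 * pi * of_int j / real d) \<cdot>\<^sub>m 1\<^sub>m k"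
proof -
  have "\<exists>K. subgroup K E \<and> finite (rcosets\<^bsub>E\<^esub> K) \<and> (\<forall>i. 0 < i \<and> i \<le> B \<longrightarrow> \<iota> (int i) \<notin> K)" for B :: nat
  proof (induction B)
    case 0
    then show ?case using F by auto
  next
    case (Suc B)
    then obtain K where K: "subgroup K E" "finite (rcosets\<^bsub>E\<^esub> K)"
      "\<And>i. 0 < i \<Longrightarrow> i \<le> B \<Longrightarrow> \<iota> (int i) \<notin> K" by blast
    have "\<iota> (int (Suc B)) \<noteq> \<iota> 0" unfolding inj_eq[OF inj_iota] by simp
    then have "\<iota> (int (Suc B)) \<notin> range \<iota> \<inter> (\<Inter>k. F k)" unfolding sep iota_0 by simp
    then obtain l where l: "\<iota> (int (Suc B)) \<notin> F l" by blast
    have "subgroup (K \<inter> F l) E" using K F E.subgroups_Inter_pair by blast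
    moreover have "finite (rcosets\<^bsub>E\<^esub> (K \<inter> F l))" using K F by (intro E.finite_index_inter)
    moreover have "\<iota> (int i) \<notin> K \<inter> F l" if "0 < i" "i \<le> Suc B" for i
      using that K(3)[of i] l by (cases "i = Suc B") auto
    ultimately show ?case by blast
  qed
  then obtain K where "subgroup K E" "finite (rcosets\<^bsub>E\<^esub> K)"
    "\<And>i. 0 < i \<Longrightarrow> i \<le> B \<Longrightarrow> \<iota> (int i) \<notin> K" by blast
  then show ?thesis by (rule character_representation)
qed

end

text \<open>The pullback of the integral Heisenberg group along \<open>(a, b)\<close>.\<close>

definition heisenberg :: "('a, 'b) monoid_scheme \<Rightarrow> ('a \<Rightarrow> int) \<Rightarrow> ('a \<Rightarrow> int) \<Rightarrow> ('a \<times> int) monoid" where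
  "heisenberg G a b = \<lparr>carrier = carrier G \<times> UNIV,
     monoid.mult = (\<lambda>(s, j) (t, l). (s \<otimes>\<^bsub>G\<^esub> t, j + l + a s * b t)), one = (\<one>\<^bsub>G\<^esub>, 0)\<rparr>"

lemma heisenberg_simps:
  "carrier (heisenberg G a b) = carrier G \<times> UNIV"
  "(s, j) \<otimes>\<^bsub>heisenberg G a b\<^esub> (t, l) = (s \<otimes>\<^bsub>G\<^esub> t, j + l + a s * b t)"
  "\<one>\<^bsub>heisenberg G a b\<^esub> = (\<one>\<^bsub>G\<^esub>, 0)"
  by (simp_all add: heisenberg_def)

locale two_characters = group G for G :: "('a, 'b) monoid_scheme" (structure) +
  fixes a b :: "'a \<Rightarrow> int"
  assumes a: "s \<in> carrier G \<Longrightarrow> t \<in> carrier G \<Longrightarrow> a (s \<otimes> t) = a s + a t"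
    and b: "s \<in> carrier G \<Longrightarrow> t \<in> carrier G \<Longrightarrow> b (s \<otimes> t) = b s + b t"
begin

lemma characters_one: "a \<one> = 0" "b \<one> = 0"
  using a[of \<one> \<one>] b[of \<one> \<one>] by auto

lemma characters_inv: "s \<in> carrier G \<Longrightarrow> a (inv s) = - a s" "s \<in> carrier G \<Longrightarrow> b (inv s) = - b s"
  using a[of s "inv s"] b[of s "inv s"] characters_one by auto

abbreviation "E \<equiv> heisenberg G a b"

lemma group_heisenberg: "group E"
proof (rule groupI)
  fix x assume "x \<in> carrier E"
  then obtain s j where x: "x = (s, j)" "s \<in> carrier G" by (auto simp: heisenberg_simps)
  show "\<exists>y\<in>carrier E. y \<otimes>\<^bsub>E\<^esub> x = \<one>\<^bsub>E\<^esub>"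
    \<comment> \<open>The integer entry solves for 0 after the product has contributed
      \<open>a (inv s) * b s\<close>.\<close>
    using x by (intro bexI[of _ "(inv s, a s * b s - j)"]) (auto simp: heisenberg_simps characters_inv)
qed (auto simp: heisenberg_simps m_assoc a b characters_one algebra_simps)

lemma int_extension_heisenberg:
  "int_extension G E (\<lambda>j. (\<one>, j)) fst (\<lambda>s. (s, 0)) (\<lambda>s t. a s * b t)"
proof -
  interpret E: group E by (rule group_heisenberg)
  show ?thesis
  proof unfold_locales
    show "central_extension G E (\<lambda>j. (\<one>, j)) fst"
      unfolding central_extension_def
      by (auto simp: group_heisenberg mon_def epi_def hom_def inj_on_def kernel_def heisenberg_simps
          characters_one image_iff)
  qed (auto simp: heisenberg_simps characters_one)
qed

lemma inv_heisenberg: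
  assumes "s \<in> carrier G"
  shows "inv\<^bsub>E\<^esub> (s, j) = (inv s, a s * b s - j)"
proof -
  interpret E: group E by (rule group_heisenberg)
  show ?thesis
    using assms by (intro E.inv_equality) (auto simp: heisenberg_simps characters_inv)
qed

text \<open>The condition is imposed on \<open>b\<close> alone: on \<open>H\<close> the correction
  \<open>a s * b t\<close> is divisible by \<open>n\<close>, which already makes the character
  multiplicative. The index of \<open>H\<close> is thus at most \<open>n\<close>, and this is the
  dimension bound needed for Schatten norms.\<close>

lemma heisenberg_representation:
  assumes n: "0 < n"
  shows "\<exists>k\<ge>1. k \<le> n \<and> (\<exists>R\<in>hom E (unitary_group k).
    \<forall>j. R (\<one>, j) = cis (2 * pi * of_int j / real n) \<cdot>\<^sub>m 1\<^sub>m k)"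
proof -
  interpret E: group E by (rule group_heisenberg)
  define H where "H = {(s, j :: int) | s j. s \<in> carrier G \<and> int n dvd b s}"
  define \<chi> where "\<chi> x = cis (2 * pi * of_int (snd x) / real n)" for x :: "'a \<times> int"
  have H: "subgroup H E"
  proof (rule E.subgroupI)
    show "H \<noteq> {}" using characters_one by (auto simp: H_def)
  qed (auto simp: H_def heisenberg_simps b inv_heisenberg characters_inv)
  have fin: "finite (rcosets\<^bsub>E\<^esub> H)" "card (rcosets\<^bsub>E\<^esub> H) \<le> card {0..<int n}" "card (rcosets\<^bsub>E\<^esub> H) \<ge> 1"
  proof -
    have A: "finite {0..<int n}" "(\<lambda>x. b (fst x) mod int n) ` carrier E \<subseteq> {0..<int n}"
      using n by auto
    have F: "x \<otimes>\<^bsub>E\<^esub> inv\<^bsub>E\<^esub> y \<in> H"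
      if "x \<in> carrier E" "y \<in> carrier E" "b (fst x) mod int n = b (fst y) mod int n" for x y
    proof -
      obtain s j t l where xy: "x = (s, j)" "y = (t, l)" by (cases x; cases y)
      have st: "s \<in> carrier G" "t \<in> carrier G" using that xy by (simp_all add: heisenberg_simps)
      have "int n dvd b s - b t" using that(3) unfolding xy by (simp add: mod_eq_dvd_iff)
      then show ?thesis
        unfolding xy inv_heisenberg[OF st(2)] using st by (simp add: heisenberg_simps H_def b characters_inv)
    qed
    note fic = E.finite_index_criterion[OF H A F]
    show "finite (rcosets\<^bsub>E\<^esub> H)" by (rule fic(1))
    show "card (rcosets\<^bsub>E\<^esub> H) \<le> card {0..<int n}" by (rule fic(2))
    show "card (rcosets\<^bsub>E\<^esub> H) \<ge> 1" by (rule fic(3))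
  qed
  have "\<exists>R\<in>hom E (unitary_group (card (rcosets\<^bsub>E\<^esub> H))). \<forall>z\<in>H.
    (\<forall>x\<in>carrier E. z \<otimes>\<^bsub>E\<^esub> x = x \<otimes>\<^bsub>E\<^esub> z) \<longrightarrow> R z = \<chi> z \<cdot>\<^sub>m 1\<^sub>m (card (rcosets\<^bsub>E\<^esub> H))"
  proof (rule E.induced_representation[OF H fin(1)])
    fix x y assume "x \<in> H" "y \<in> H"
    moreover obtain s j t l where xy': "x = (s, j)" "y = (t, l)" by (cases x; cases y)
    ultimately have "int n dvd b t" by (simp add: H_def)
    then obtain m where xy: "x = (s, j)" "y = (t, l)" "b t = int n * m" using xy' by (auto simp: dvd_def)
    \<comment> \<open>The last summand is the contribution of the Heisenberg cocycle, a full number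
      of turns.\<close>
    have "2 * pi * of_int (j + l + a s * b t) / real n
        = (2 * pi * of_int j / real n + 2 * pi * of_int l / real n) + 2 * pi * of_int (a s * m)"
      using n unfolding xy(3) by (simp add: field_simps)
    then show "\<chi> (x \<otimes>\<^bsub>E\<^esub> y) = \<chi> x * \<chi> y"
      unfolding \<chi>_def xy(1,2) heisenberg_simps snd_conv by (simp only: cis_mult[symmetric] cis_multiple_2pi Ints_of_int mult_1_right)
  qed (simp add: \<chi>_def)
  then obtain R where R: "R \<in> hom E (unitary_group (card (rcosets\<^bsub>E\<^esub> H)))"
    "\<And>z. z \<in> H \<Longrightarrow> (\<And>x. x \<in> carrier E \<Longrightarrow> z \<otimes>\<^bsub>E\<^esub> x = x \<otimes>\<^bsub>E\<^esub> z) \<Longrightarrow>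
      R z = \<chi> z \<cdot>\<^sub>m 1\<^sub>m (card (rcosets\<^bsub>E\<^esub> H))"
    by blast
  have "R (\<one>, j) = cis (2 * pi * of_int j / real n) \<cdot>\<^sub>m 1\<^sub>m (card (rcosets\<^bsub>E\<^esub> H))" for j
  proof -
    have "(\<one>, j) \<in> H" by (simp add: H_def characters_one)
    then show ?thesis
      using R(2)[of "(\<one>, j)"] by (auto simp: \<chi>_def heisenberg_simps characters_one)
  qed
  then show ?thesis using fin(2,3) R(1) by (intro exI[of _ "card (rcosets\<^bsub>E\<^esub> H)"]) auto
qed

end

context group
begin

text \<open>With trivial coefficients the coboundary in degree 0 vanishes, so a class in degree 1 is
  a single homomorphism to the integers.\<close>

lemma cohomology_group_1_carrier:
  assumes "x \<in> carrier (cohomology_group G 1)"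
  obtains f where "x = {f}" "\<And>s t. s \<in> carrier G \<Longrightarrow> t \<in> carrier G \<Longrightarrow> f [s \<otimes> t] = f [s] + f [t]"
proof -
  interpret C1: comm_group "cochain_group G 1" by (rule comm_group_cochain_group)
  have t0: "tl xs = []" "butlast xs = []" if "xs \<in> tuples G 1" for xs
    using that by (auto simp: tuples_def length_Suc_conv)
  have "coboundary G 0 h = \<one>\<^bsub>cochain_group G 1\<^esub>" for h
    unfolding cochain_group_simps
  proof (rule coboundary_eqI)
    fix xs assume "xs \<in> tuples G (Suc 0)"
    then show "coboundary G 0 h xs = (\<lambda>xs\<in>tuples G 1. 0) xs" using t0 by (simp add: coboundary_def)
  qed simp
  moreover have "\<one>\<^bsub>cochain_group G 0\<^esub> \<in> carrier (cochain_group G 0)" by (simp add: cochain_group_simps)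
  ultimately have "coboundaries G 1 = {\<one>\<^bsub>cochain_group G 1\<^esub>}"
    by (auto simp: coboundaries_def)
  moreover obtain f where f: "f \<in> cocycles G 1"
    "x = coboundaries G 1 #>\<^bsub>(cochain_group G 1)\<lparr>carrier := cocycles G 1\<rparr>\<^esub> f"
    using assms by (auto simp: cohomology_group_def FactGroup_def RCOSETS_def)
  moreover have fc: "f \<in> carrier (cochain_group G 1)" using f by (auto simp: cocycles_def kernel_def)
  ultimately have "x = {f}" using C1.l_one[OF fc] by (simp add: r_coset_def)
  moreover have "f [s \<otimes> t] = f [s] + f [t]" if st: "s \<in> carrier G" "t \<in> carrier G" for s t
  proof -
    have "coboundary G 1 f = \<one>\<^bsub>cochain_group G (Suc 1)\<^esub>" using f(1) by (simp add: cocycles_def kernel_def)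
    then have "coboundary G 1 f [s, t] = 0"
      using st tuples_2[of "[s, t]" G] by (simp add: cochain_group_simps numeral_2_eq_2)
    then show ?thesis unfolding coboundary_1[OF st] by simp
  qed
  ultimately show ?thesis using that by blast
qed

end

lemma powr_div_tendsto_0:
  assumes e: "0 \<le> e" "e < 1" and k: "\<And>n. 1 \<le> k n" "\<And>n. k n \<le> Suc n"
  shows "(\<lambda>n. real (k n) powr e / real (Suc n)) \<longlonglongrightarrow> 0"
proof (rule tendsto_sandwich[OF _ _ tendsto_const])
  have "(\<lambda>n. real n powr (e - 1)) \<longlonglongrightarrow> 0"
    using e by (intro tendsto_neg_powr filterlim_real_sequentially) auto
  then show "(\<lambda>n. real (Suc n) powr (e - 1)) \<longlonglongrightarrow> 0" by (rule LIMSEQ_Suc)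
  show "eventually (\<lambda>n. real (k n) powr e / real (Suc n) \<le> real (Suc n) powr (e - 1)) sequentially"
  proof (intro always_eventually allI)
    fix n
    have "real (k n) powr e \<le> real (Suc n) powr e"
      using e k[of n] by (intro powr_mono2) (auto simp del: of_nat_Suc)
    then have "real (k n) powr e / real (Suc n) \<le> real (Suc n) powr e / real (Suc n)"
      by (intro divide_right_mono) auto
    then show "real (k n) powr e / real (Suc n) \<le> real (Suc n) powr (e - 1)"
      by (simp add: powr_diff)
  qed
qed auto

theorem corollary6p2_part1:
  fixes \<Gamma> :: "('a, 'b) monoid_scheme"
  assumes "group \<Gamma>" and fg: "finitely_generated_group \<Gamma>"
    and x: "x \<in> carrier (cohomology_group \<Gamma> 2)" "finite_type_class \<Gamma> x"
      "group.ord (cohomology_group \<Gamma> 2) x = 0"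
  shows "\<not> local_to_local_stable op_norm \<Gamma>"
    and "hyperbolic_group \<Gamma> \<Longrightarrow> \<not> uniform_to_local_stable op_norm \<Gamma>"
proof -
  interpret G: group \<Gamma> by (rule assms(1))
  obtain E :: "('a \<times> int) monoid" and \<iota> q and F :: "nat \<Rightarrow> ('a \<times> int) set" where
    E': "central_extension \<Gamma> E \<iota> q \<and> is_extension_class \<Gamma> E \<iota> q x \<and>
      (\<forall>k. subgroup (F k) E \<and> finite (rcosets\<^bsub>E\<^esub> (F k))) \<and> range \<iota> \<inter> (\<Inter>k. F k) = {\<one>\<^bsub>E\<^esub>}"
    using x(2) unfolding finite_type_class_def by (elim exE) (rule that)
  then have E: "central_extension \<Gamma> E \<iota> q" "is_extension_class \<Gamma> E \<iota> q x"
    "\<And>k. subgroup (F k) E" "\<And>k. finite (rcosets\<^bsub>E\<^esub> (F k))" "range \<iota> \<inter> (\<Inter>k. F k) = {\<one>\<^bsub>E\<^esub>}"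
    by simp_all
  obtain \<sigma> c where \<sigma>: "\<sigma> \<in> carrier \<Gamma> \<rightarrow> carrier E" "\<And>s. s \<in> carrier \<Gamma> \<Longrightarrow> q (\<sigma> s) = s"
    "c \<in> carrier (cochain_group \<Gamma> 2)"
    "\<And>s t. s \<in> carrier \<Gamma> \<Longrightarrow> t \<in> carrier \<Gamma> \<Longrightarrow>
       \<sigma> s \<otimes>\<^bsub>E\<^esub> \<sigma> t = \<iota> (c [s, t]) \<otimes>\<^bsub>E\<^esub> \<sigma> (s \<otimes>\<^bsub>\<Gamma>\<^esub> t)"
    "x = cohomology_class \<Gamma> 2 c"
    using E(2) unfolding is_extension_class_def by blast
  interpret E: group E using E(1) by (simp add: central_extension_def)
  interpret int_extension \<Gamma> E \<iota> q \<sigma> "\<lambda>s t. c [s, t]"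
    by unfold_locales (use E(1) \<sigma> in auto)
  \<comment> \<open>Requiring \<open>n < d\<close> makes the orders tend to infinity. The dimension
    remains uncontrolled, which is harmless for exponent 0.\<close>
  have "\<forall>n. \<exists>d k R. n < d \<and> 1 \<le> k \<and> R \<in> hom E (unitary_group k) \<and>
      (\<forall>j. R (\<iota> j) = cis (2 * pi * of_int j / real d) \<cdot>\<^sub>m 1\<^sub>m k)"
    using separating_representations[OF E(3-5)] by blast
  then obtain d k R where R: "\<And>n :: nat. n < d n" "\<And>n. 1 \<le> k n" "\<And>n. R n \<in> hom E (unitary_group (k n))"
    "\<And>n j. R n (\<iota> j) = cis (2 * pi * of_int j / real (d n)) \<cdot>\<^sub>m 1\<^sub>m (k n)"
    by metis
  have top: "filterlim (\<lambda>n. real (d n)) at_top sequentially"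
    by (rule filterlim_at_top_mono[OF filterlim_real_sequentially])
      (use R(1) in \<open>auto intro!: always_eventually less_imp_le\<close>)
  interpret scalar_representations \<Gamma> E \<iota> q \<sigma> "\<lambda>s t. c [s, t]" R k "\<lambda>n. real (d n)" op_norm 0
  proof unfold_locales
    show "0 < real (d n)" for n using R(1)[of n] by simp
    have "(\<lambda>n. 1 / real (d n)) \<longlonglongrightarrow> 0"
      using top by (intro tendsto_divide_0[OF tendsto_const] filterlim_at_top_imp_at_infinity)
    moreover have "real (k n) powr 0 = 1" for n using R(2)[of n] by simp
    ultimately show "(\<lambda>n. real (k n) powr 0 / real (d n)) \<longlonglongrightarrow> 0" by presburger
  qed (use R top unitary_norm_growth_op in auto)
  have inf: "\<not> (\<forall>s\<in>carrier \<Gamma>. \<forall>t\<in>carrier \<Gamma>. d * c [s, t] = u s + u t - u (s \<otimes>\<^bsub>\<Gamma>\<^esub> t))"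
    if "0 < d" for d :: int and u
    using G.infinite_order_cocycle[OF \<sigma>(3) x(1)[unfolded \<sigma>(5)] x(3)[unfolded \<sigma>(5)], of "nat d" u] that
    by auto
  show "\<not> local_to_local_stable op_norm \<Gamma>"
    "hyperbolic_group \<Gamma> \<Longrightarrow> \<not> uniform_to_local_stable op_norm \<Gamma>"
    using not_stable[OF fg inf] by auto
qed

theorem corollary6p2_part2:
  fixes \<Gamma> :: "('a, 'b) monoid_scheme"
  assumes "group \<Gamma>" and hyp: "hyperbolic_group \<Gamma>"
    and \<beta>: "\<beta> \<in> carrier (cohomology_group \<Gamma> 1)" and \<psi>: "\<psi> \<in> carrier (cohomology_group \<Gamma> 1)"
    and ord: "group.ord (cohomology_group \<Gamma> 2) (cup_product \<Gamma> 1 1 \<beta> \<psi>) = 0"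
    and p: "1 < (p :: ereal)"
  shows "\<not> uniform_to_local_stable (schatten_norm p) \<Gamma>"
proof -
  interpret G: group \<Gamma> by (rule assms(1))
  obtain f g where f: "\<beta> = {f}" "\<And>s t. s \<in> carrier \<Gamma> \<Longrightarrow> t \<in> carrier \<Gamma> \<Longrightarrow> f [s \<otimes>\<^bsub>\<Gamma>\<^esub> t] = f [s] + f [t]"
    and g: "\<psi> = {g}" "\<And>s t. s \<in> carrier \<Gamma> \<Longrightarrow> t \<in> carrier \<Gamma> \<Longrightarrow> g [s \<otimes>\<^bsub>\<Gamma>\<^esub> t] = g [s] + g [t]"
    using G.cohomology_group_1_carrier[OF \<beta>] G.cohomology_group_1_carrier[OF \<psi>] by metis
  interpret two_characters \<Gamma> "\<lambda>s. f [s]" "\<lambda>s. g [s]"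
    by unfold_locales (use f g in auto)
  define h where "h = cup_cochain \<Gamma> 1 1 f g"
  \<comment> \<open>Both classes are singletons, so the union defining the cup product is one
    coset.\<close>
  have cup: "cup_product \<Gamma> 1 1 \<beta> \<psi> = cohomology_class \<Gamma> 2 h"
    by (simp add: cup_product_def f(1) g(1) h_def numeral_2_eq_2)
  have c: "h [s, t] = f [s] * g [t]" if "s \<in> carrier \<Gamma>" "t \<in> carrier \<Gamma>" for s t
    using that tuples_2[of "[s, t]" \<Gamma>] by (simp add: h_def cup_cochain_def numeral_2_eq_2)
  have cc: "h \<in> carrier (cochain_group \<Gamma> 2)"
    by (simp add: cochain_group_simps h_def cup_cochain_def numeral_2_eq_2)
  interpret E: group E by (rule group_heisenberg)
  interpret int_extension \<Gamma> E "\<lambda>j. (\<one>\<^bsub>\<Gamma>\<^esub>, j)" fst "\<lambda>s. (s, 0)" "\<lambda>s t. f [s] * g [t]"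
    by (rule int_extension_heisenberg)
  \<comment> \<open>The cocycle identity is read off from the Heisenberg extension, whose section
    has exactly this cocycle.\<close>
  have "h \<in> cocycles \<Gamma> 2"
    using cocycle cc unfolding cocycles_2_iff int_cocycle_def by (auto simp: c)
  then have x: "cohomology_class \<Gamma> 2 h \<in> carrier (cohomology_group \<Gamma> 2)"
    using G.cohomology_class_carrier_iff[OF cc] by simp
  have inf: "\<not> (\<forall>s\<in>carrier \<Gamma>. \<forall>t\<in>carrier \<Gamma>. d * (f [s] * g [t]) = u s + u t - u (s \<otimes>\<^bsub>\<Gamma>\<^esub> t))"
    if "0 < d" for d :: int and u
    using G.infinite_order_cocycle[OF cc x ord[unfolded cup], of "nat d" u] that c by auto
  have "\<forall>n. \<exists>k R. 1 \<le> k \<and> k \<le> Suc n \<and> R \<in> hom E (unitary_group k) \<and>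
      (\<forall>j. R (\<one>\<^bsub>\<Gamma>\<^esub>, j) = cis (2 * pi * of_int j / real (Suc n)) \<cdot>\<^sub>m 1\<^sub>m k)"
  proof
    fix n
    from heisenberg_representation[of "Suc n"]
    show "\<exists>k R. 1 \<le> k \<and> k \<le> Suc n \<and> R \<in> hom E (unitary_group k) \<and>
      (\<forall>j. R (\<one>\<^bsub>\<Gamma>\<^esub>, j) = cis (2 * pi * of_int j / real (Suc n)) \<cdot>\<^sub>m 1\<^sub>m k)"
      by blast
  qed
  then obtain k R where R: "\<And>n. 1 \<le> k n" "\<And>n. k n \<le> Suc n" "\<And>n. R n \<in> hom E (unitary_group (k n))"
    "\<And>n j. R n (\<one>\<^bsub>\<Gamma>\<^esub>, j) = cis (2 * pi * of_int j / real (Suc n)) \<cdot>\<^sub>m 1\<^sub>m (k n)"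
    by metis
  obtain e where e: "0 \<le> e" "e < 1" "unitary_norm_growth (schatten_norm p) e"
    using unitary_norm_growth_schatten[OF p] by blast
  interpret scalar_representations \<Gamma> E "\<lambda>j. (\<one>\<^bsub>\<Gamma>\<^esub>, j)" fst "\<lambda>s. (s, 0)" "\<lambda>s t. f [s] * g [t]"
    R k "\<lambda>n. real (Suc n)" "schatten_norm p" e
  proof unfold_locales
    show "filterlim (\<lambda>n. real (Suc n)) at_top sequentially"
      using filterlim_real_sequentially by (simp only: filterlim_sequentially_Suc)
    show "(\<lambda>n. real (k n) powr e / real (Suc n)) \<longlonglongrightarrow> 0"
      using e R by (intro powr_div_tendsto_0)
  qed (use R e in \<open>auto simp del: of_nat_Suc\<close>)
  have "finitely_generated_group \<Gamma>"
    using hyp unfolding hyperbolic_group_def finitely_generated_group_def by blast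
  from not_stable(2)[OF this inf hyp] show ?thesis by blast
qed

theorem corollary6p2:
  fixes \<Gamma> :: "('a, 'b) monoid_scheme"
  assumes "group \<Gamma>"
  shows "(finitely_generated_group \<Gamma> \<and>
            (\<exists>x \<in> carrier (cohomology_group \<Gamma> 2).
               finite_type_class \<Gamma> x \<and> group.ord (cohomology_group \<Gamma> 2) x = 0)
            \<longrightarrow> \<not> local_to_local_stable op_norm \<Gamma> \<and>
                (hyperbolic_group \<Gamma> \<longrightarrow> \<not> uniform_to_local_stable op_norm \<Gamma>)) \<and>
         (\<forall>\<beta> \<in> carrier (cohomology_group \<Gamma> 1). \<forall>\<psi> \<in> carrier (cohomology_group \<Gamma> 1). \<forall>p :: ereal.
            hyperbolic_group \<Gamma> \<and>
            group.ord (cohomology_group \<Gamma> 2) (cup_product \<Gamma> 1 1 \<beta> \<psi>) = 0 \<and> 1 < p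
            \<longrightarrow> \<not> uniform_to_local_stable (schatten_norm p) \<Gamma>)"
  using corollary6p2_part1[OF assms] corollary6p2_part2[OF assms] by blast

end
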